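(* Let $\varphi\in A_\infty(\Omega)$ be a Musielak–Orlicz function of uniformly lower type $p_\varphi^-$ and uniformly upper type $p_\varphi^+$ with $q(\varphi)<p_\varphi^-\le p_\varphi^+<\infty$. Then for every $r\in(1,\infty)$ there is $C>0$ such that for every sequence $(f_j)_{j\in\mathbb N}$ of measurable functions, $$\Big\|\Big\{\sum_{j\in\mathbb N}[M(f_j)]^r\Big\}^{1/r}\Big\|_{L^\varphi(\Omega)}\le C\Big\|\Big(\sum_{j\in\mathbb N}|f_j|^r\Big)^{1/r}\Big\|_{L^\varphi(\Omega)}.$$
   Context: Let $(\Omega,\mathcal F,\mathbb P)$ be a probability space, $(\mathcal F_n)_{n\in\mathbb Z_+}$ a nondecreasing sequence of sub-$\sigma$-algebras of $\mathcal F$, $\mathbb E_n$ the conditional expectation w.r.t. $\mathcal F_n$, and $M(f):=\sup_{n\in\mathbb Z_+}|\mathbb E_n f|$. A Musielak–Orlicz function is $\varphi:\Omega\times[0,\infty)\to[0,\infty)$ with $\varphi(x,\cdot)$ nondecreasing, $\varphi(x,0)=0$, $\lim_{t\to\infty}\varphi(x,t)=\infty$ for each $x$ and $\varphi(\cdot,t)$ measurable (positive, integrable) for each $t$. $\|f\|_{L^\varphi(\Omega)}:=\inf\{\lambda>0:\int_\Omega\varphi(x,|f(x)|/\lambda)\,d\mathbb P\le1\}$. Uniformly lower (upper) type $p$: $\varphi(x,st)\le Cs^p\varphi(x,t)$ for all $x$, $t\ge0$, $s\in(0,1)$ (resp. $s\ge1$). For $q>1$, $\varphi\in A_q(\Omega)$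 if $\sup_{t>0}\mathbb E_n(\varphi(\cdot,t))[\mathbb E_n(\varphi(\cdot,t)^{-1/(q-1)})]^{q-1}\le K$ a.e. for all $n$; $\varphi\in A_1(\Omega)$ if $\sup_{t>0}\mathbb E_n(\varphi(\cdot,t))/\varphi(\cdot,t)\le K$ a.e.; $A_\infty(\Omega)=\bigcup_{q\ge1}A_q(\Omega)$; $q(\varphi):=\inf\{q\ge1:\varphi\in A_q(\Omega)\}$. *)

theory Defs
  imports "HOL-Probability.Probability"
begin

definition filtration_of :: "'a measure \<Rightarrow> (nat \<Rightarrow> 'a measure) \<Rightarrow> bool" where
  "filtration_of M F \<longleftrightarrow> (\<forall>n. subalgebra M (F n)) \<and> (\<forall>m n. m \<le> n \<longrightarrow> sets (F m) \<subseteq> sets (F n))"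

definition ennpow :: "ennreal \<Rightarrow> real \<Rightarrow> ennreal" where
  "ennpow s a = (if s = \<top> then \<top> else ennreal (enn2real s powr a))"

definition doob_max :: "'a measure \<Rightarrow> (nat \<Rightarrow> 'a measure) \<Rightarrow> ('a \<Rightarrow> real) \<Rightarrow> 'a \<Rightarrow> ennreal" where
  "doob_max M F f x = (SUP n. ennreal \<bar>real_cond_exp M (F n) f x\<bar>)"

definition musielak_orlicz :: "'a measure \<Rightarrow> ('a \<Rightarrow> real \<Rightarrow> real) \<Rightarrow> bool" where
  "musielak_orlicz M \<phi> \<longleftrightarrow>
     (\<forall>x\<in>space M. mono_on {0..} (\<phi> x) \<and> \<phi> x 0 = 0 \<and> (\<forall>t\<ge>0. \<phi> x t \<ge> 0)
        \<and> filterlim (\<phi> x) at_top at_top)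
   \<and> (\<forall>t\<ge>0. (\<lambda>x. \<phi> x t) \<in> borel_measurable M)
   \<and> (\<forall>t>0. integrable M (\<lambda>x. \<phi> x t) \<and> (\<forall>x\<in>space M. \<phi> x t > 0))"

definition unif_lower_type :: "'a measure \<Rightarrow> ('a \<Rightarrow> real \<Rightarrow> real) \<Rightarrow> real \<Rightarrow> bool" where
  "unif_lower_type M \<phi> p \<longleftrightarrow> (\<exists>C>0. \<forall>x\<in>space M. \<forall>t\<ge>0. \<forall>s. 0 < s \<and> s < 1 \<longrightarrow>
      \<phi> x (s * t) \<le> C * s powr p * \<phi> x t)"

definition unif_upper_type :: "'a measure \<Rightarrow> ('a \<Rightarrow> real \<Rightarrow> real) \<Rightarrow> real \<Rightarrow> bool" where
  "unif_upper_type M \<phi> p \<longleftrightarrow> (\<exists>C>0. \<forall>x\<in>space M. \<forall>t\<ge>0. \<forall>s\<ge>1.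
      \<phi> x (s * t) \<le> C * s powr p * \<phi> x t)"

definition A_class :: "'a measure \<Rightarrow> (nat \<Rightarrow> 'a measure) \<Rightarrow> ('a \<Rightarrow> real \<Rightarrow> real) \<Rightarrow> real \<Rightarrow> bool" where
  "A_class M F \<phi> q \<longleftrightarrow>
     (if q = 1 then
        (\<exists>K. \<forall>n. \<forall>t>0. AE x in M. real_cond_exp M (F n) (\<lambda>y. \<phi> y t) x \<le> K * \<phi> x t)
      else
        (\<exists>K. \<forall>n. \<forall>t>0. AE x in M.
           nn_cond_exp M (F n) (\<lambda>y. ennreal (\<phi> y t)) x *
           ennpow (nn_cond_exp M (F n) (\<lambda>y. ennreal (\<phi> y t powr (- 1 / (q - 1)))) x) (q - 1)
           \<le> ennreal K))"

definition A_infty :: "'a measure \<Rightarrow> (nat \<Rightarrow> 'a measure) \<Rightarrow> ('a \<Rightarrow> real \<Rightarrow> real) \<Rightarrow> bool" where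
  "A_infty M F \<phi> \<longleftrightarrow> (\<exists>q\<ge>1. A_class M F \<phi> q)"

definition critical_index :: "'a measure \<Rightarrow> (nat \<Rightarrow> 'a measure) \<Rightarrow> ('a \<Rightarrow> real \<Rightarrow> real) \<Rightarrow> real" where
  "critical_index M F \<phi> = Inf {q. q \<ge> 1 \<and> A_class M F \<phi> q}"

definition phi_ext :: "('a \<Rightarrow> real \<Rightarrow> real) \<Rightarrow> 'a \<Rightarrow> ennreal \<Rightarrow> ennreal" where
  "phi_ext \<phi> x t = (if t = \<top> then \<top> else ennreal (\<phi> x (enn2real t)))"

text \<open>Luxemburg (quasi-)norm on L^phi, valued in [0,\<infinity>] (= \<infinity> if f is not in L^phi).\<close>
definition lux_norm :: "'a measure \<Rightarrow> ('a \<Rightarrow> real \<Rightarrow> real) \<Rightarrow> ('a \<Rightarrow> ennreal) \<Rightarrow> ennreal" where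
  "lux_norm M \<phi> g = Inf (ennreal ` {l::real. l > 0 \<and>
      (\<integral>\<^sup>+ x. phi_ext \<phi> x (g x / ennreal l) \<partial>M) \<le> 1})"

end

theory Submission
  imports Defs "HOL-Library.Nat_Bijection"
begin

text \<open>
Uniformly in \<open>t\<close>, the functions \<open>\<phi>(\<cdot>, t)\<close> are $A_p$ weights for every \<open>p\<close> above the critical index.
For one weight \<open>w\<close> with dual weight \<open>\<sigma> = w powr (- 1 / (p - 1))\<close>, the maximal function is dominated
through two Doob maximal functions taken with respect to the measures \<open>\<sigma> dP\<close> and \<open>w dP\<close>, so it is bounded
on $L^p(w)$ without any regularity of the filtration. Summing over \<open>j\<close> gives the vector-valued
bound on $L^r(w)$; Rubio de Francia extrapolation carries it over to $L^p(w)$ for \<open>p \<noteq> r\<close>.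
Finally the bounds for an exponent \<open>p0 < pminus\<close> and an exponent \<open>p1 > pplus\<close> are interpolated: on the level
set \<open>{G > 2\<^sup>k}\<close> the weight \<open>\<phi>(\<cdot>, 2\<^sup>k\<^sup>+\<^sup>1)\<close> is used, and the types of \<open>\<phi>\<close> make the sum over \<open>k\<close> geometric.
\<close>

section \<open>Powers on the extended half-line and conditional expectations\<close>

text \<open>The constants must not see the weight: the sum over \<open>k\<close> uses infinitely
  many weights at once, and the Luxemburg norm adds a dilation of \<phi>. Hence the weighted bounds
  fix \<open>C\<close> before the weight is quantified and let it depend on the weight only through
  the exponents and the weight constant \<open>K\<close>. \<phi> is neither convex nor continuous in
  its second argument, so \<open>lux_norm\<close> need not be a norm and offers no duality to
  extrapolate with. Extrapolation is therefore carried out on ordinary weighted spaces, by comparing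
  functions pointwise with a majorant. The strict inequality between the critical index and
  \<open>pminus\<close> is what supplies \<open>p0\<close>: this exponent has to exceed some
  admissible \<open>q\<close>, so that the weights belong to its class, and to stay below
  \<open>pminus\<close>, so that the dyadic sum converges. Above \<open>pplus\<close> there is
  always room, since the weight classes grow with the exponent. The level sets ask only for
  weak-type information, so weighted bounds for the maximal function truncated at the level are
  enough. A modular inequality with a constant \<open>C\<close> finally becomes a norm inequality
  because the lower type makes the modular decay when the Luxemburg parameter grows.\<close>

lemma ennpow_ennreal: "0 \<le> x \<Longrightarrow> ennpow (ennreal x) a = ennreal (x powr a)"
  by (simp add: ennpow_def)

lemma ennpow_top [simp]: "ennpow \<top> a = \<top>"
  by (simp add: ennpow_def)

lemma ennpow_0 [simp]: "ennpow 0 a = 0"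
  by (simp add: ennpow_def)

lemma ennpow_1_left [simp]: "ennpow 1 a = 1"
  by (simp add: ennpow_def)

lemma ennpow_1_right [simp]: "ennpow x 1 = x"
  by (cases x) (simp_all add: ennpow_ennreal)

lemma ennpow_mono: "0 \<le> a \<Longrightarrow> x \<le> y \<Longrightarrow> ennpow x a \<le> ennpow y a"
  by (cases x; cases y) (auto simp: ennpow_ennreal top_unique intro!: ennreal_leI powr_mono2)

text \<open>The conventions that 0 stays 0 and \<top> stays \<top> under every real exponent, zero
  and negative ones included, free this law and the next two from side conditions; they agree with
  \<open>0 * \<top> = 0\<close>.\<close>

lemma ennpow_mult: "ennpow (x * y) a = ennpow x a * ennpow y a"
  by (cases x; cases y)
     (auto simp: ennpow_ennreal ennreal_mult[symmetric] powr_mult ennreal_mult_top ennreal_top_mult)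

lemma ennpow_ennpow: "ennpow (ennpow x a) b = ennpow x (a * b)"
  by (cases x) (auto simp: ennpow_ennreal powr_powr)

lemma ennpow_add: "ennpow x (a + b) = ennpow x a * ennpow x b"
  by (cases x) (auto simp: ennpow_ennreal powr_add ennreal_mult)

lemma ennpow_eq_0_iff [simp]: "ennpow x a = 0 \<longleftrightarrow> x = 0"
  by (cases x) (auto simp: ennpow_ennreal)

lemma ennpow_eq_top_iff [simp]: "ennpow x a = \<top> \<longleftrightarrow> x = \<top>"
  by (cases x) (auto simp: ennpow_ennreal)

lemma ennpow_le_iff:
  assumes "0 < a" shows "ennpow x a \<le> ennpow y a \<longleftrightarrow> x \<le> y"
proof
  assume "ennpow x a \<le> ennpow y a"
  then have "ennpow (ennpow x a) (1 / a) \<le> ennpow (ennpow y a) (1 / a)"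
    using assms by (intro ennpow_mono[of "1 / a"]) auto
  then show "x \<le> y" using assms by (simp add: ennpow_ennpow)
qed (use assms in \<open>auto intro: ennpow_mono\<close>)

lemma borel_measurable_ennpow [measurable (raw)]:
  assumes [measurable]: "f \<in> borel_measurable N"
  shows "(\<lambda>x. ennpow (f x) a) \<in> borel_measurable N"
  unfolding ennpow_def by measurable

section \<open>Conditional expectations with values in [0, infinity]\<close>

locale filtered_prob_space = prob_space M for M :: "'a measure" +
  fixes F :: "nat \<Rightarrow> 'a measure"
  assumes filtration: "filtration_of M F"
begin

abbreviation E :: "nat \<Rightarrow> ('a \<Rightarrow> ennreal) \<Rightarrow> 'a \<Rightarrow> ennreal" where
  "E n \<equiv> nn_cond_exp M (F n)"

definition Mx :: "('a \<Rightarrow> ennreal) \<Rightarrow> 'a \<Rightarrow> ennreal" where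
  "Mx f x = (SUP n. E n f x)"

lemma subalg_F: "subalgebra M (F n)"
  using filtration by (simp add: filtration_of_def)

lemma sigma_finite_F: "sigma_finite_subalgebra M (F n)"
  by (rule finite_measure_subalgebra_is_sigma_finite)
     (simp add: finite_measure_subalgebra_def finite_measure_axioms
       finite_measure_subalgebra_axioms_def subalg_F)

lemma F_measurable_M: "f \<in> measurable (F n) N \<Longrightarrow> f \<in> measurable M N"
  using measurable_from_subalg[OF subalg_F] .

lemmas E_intg = sigma_finite_subalgebra.nn_cond_exp_intg[OF sigma_finite_F]
lemmas E_mono = sigma_finite_subalgebra.nn_cond_exp_mono[OF sigma_finite_F]
lemmas E_cong = sigma_finite_subalgebra.nn_cond_exp_cong[OF sigma_finite_F]
lemmas E_add = sigma_finite_subalgebra.nn_cond_exp_sum[OF sigma_finite_F]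
lemmas E_prod = sigma_finite_subalgebra.nn_cond_exp_prod[OF sigma_finite_F]
lemmas E_F_meas = sigma_finite_subalgebra.nn_cond_exp_F_meas[OF sigma_finite_F]
lemmas E_charact = sigma_finite_subalgebra.nn_cond_exp_charact[OF sigma_finite_F]

lemma borel_measurable_Mx [measurable]: "Mx f \<in> borel_measurable M"
  unfolding Mx_def by measurable

lemma E_le_Mx: "E n f x \<le> Mx f x"
  unfolding Mx_def by (rule SUP_upper) simp

text \<open>The zero set of \<open>E n f\<close> lies in \<open>F n\<close>, and \<open>f\<close>
  integrates to 0 over it.\<close>

lemma E_pos:
  assumes [measurable]: "f \<in> borel_measurable M" and "AE x in M. 0 < f x"
  shows "AE x in M. 0 < E n f x"
proof -
  define A where "A = {x \<in> space (F n). E n f x = 0}"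
  have A [measurable]: "A \<in> sets (F n)" unfolding A_def by measurable
  then have [measurable]: "A \<in> sets M" using subalg_F[of n] by (auto simp: subalgebra_def)
  have "(\<integral>\<^sup>+x. indicator A x * f x \<partial>M) = (\<integral>\<^sup>+x. indicator A x * E n f x \<partial>M)"
    by (rule E_intg[symmetric]) auto
  also have "\<dots> = (\<integral>\<^sup>+x. 0 \<partial>M)"
    by (rule nn_integral_cong) (auto simp: A_def indicator_def)
  finally have "AE x in M. indicator A x * f x = 0"
    using nn_integral_0_iff_AE[of "\<lambda>x. indicator A x * f x" M] by simp
  with assms(2) AE_space show ?thesis
  proof eventually_elim
    case (elim x)
    then have "x \<notin> A" by (auto simp: indicator_def split: if_splits)
    then show ?case
      using elim subalg_F[of n] by (auto simp: A_def subalgebra_def zero_less_iff_neq_zero)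
  qed
qed

lemma E_suminf:
  fixes f :: "nat \<Rightarrow> 'a \<Rightarrow> ennreal"
  assumes [measurable]: "\<And>i. f i \<in> borel_measurable M"
  shows "AE x in M. (\<Sum>i. E n (f i) x) = E n (\<lambda>x. \<Sum>i. f i x) x"
proof (rule E_charact)
  fix A assume [measurable]: "A \<in> sets (F n)"
  then have [measurable]: "A \<in> sets M" using subalg_F[of n] by (auto simp: subalgebra_def)
  have "(\<integral>\<^sup>+x\<in>A. (\<Sum>i. f i x) \<partial>M) = (\<integral>\<^sup>+x. (\<Sum>i. indicator A x * f i x) \<partial>M)"
    by (simp add: mult.commute)
  also have "\<dots> = (\<Sum>i. \<integral>\<^sup>+x. indicator A x * f i x \<partial>M)"
    by (rule nn_integral_suminf) auto
  also have "\<dots> = (\<Sum>i. \<integral>\<^sup>+x. indicator A x * E n (f i) x \<partial>M)"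
    by (simp add: E_intg)
  also have "\<dots> = (\<integral>\<^sup>+x. (\<Sum>i. indicator A x * E n (f i) x) \<partial>M)"
    by (rule nn_integral_suminf[symmetric]) auto
  also have "\<dots> = (\<integral>\<^sup>+x\<in>A. (\<Sum>i. E n (f i) x) \<partial>M)"
    by (simp add: mult.commute)
  finally show "(\<integral>\<^sup>+x\<in>A. (\<Sum>i. f i x) \<partial>M) = (\<integral>\<^sup>+x\<in>A. (\<Sum>i. E n (f i) x) \<partial>M)" .
qed auto

lemma E_cmult:
  assumes [measurable]: "f \<in> borel_measurable M"
  shows "AE x in M. c * E n f x = E n (\<lambda>x. c * f x) x"
  using E_prod[of "\<lambda>_. c" n f] by simp

text \<open>Young's inequality for \<open>f\<close> and \<open>g\<close> normalised by their
  conditional expectations. The normalising factor \<open>c\<close> is \<open>F n\<close>-measurable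
  and can be pulled out, and the conditional expectation of the right-hand side is s + (1 - s) =
  1.\<close>

lemma E_holder:
  fixes f g :: "'a \<Rightarrow> real"
  assumes [measurable]: "f \<in> borel_measurable M" "g \<in> borel_measurable M"
    and pos: "\<And>x. x \<in> space M \<Longrightarrow> 0 < f x" "\<And>x. x \<in> space M \<Longrightarrow> 0 < g x"
    and s: "0 < s" "s < 1"
    and fin: "AE x in M. E n (\<lambda>x. ennreal (f x)) x < \<top>" "AE x in M. E n (\<lambda>x. ennreal (g x)) x < \<top>"
  shows "AE x in M. E n (\<lambda>x. ennreal (f x powr s * g x powr (1 - s))) x
           \<le> ennpow (E n (\<lambda>x. ennreal (f x)) x) s * ennpow (E n (\<lambda>x. ennreal (g x)) x) (1 - s)"
proof -
  define a where "a x = enn2real (E n (\<lambda>x. ennreal (f x)) x)" for x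
  define b where "b x = enn2real (E n (\<lambda>x. ennreal (g x)) x)" for x
  define c where "c x = ennreal (a x powr (- s) * b x powr (s - 1))" for x
  have [measurable]: "a \<in> borel_measurable (F n)" "b \<in> borel_measurable (F n)"
    unfolding a_def b_def by measurable
  have [measurable]: "a \<in> borel_measurable M" "b \<in> borel_measurable M"
    by (auto intro!: F_measurable_M[of _ n])
  have [measurable]: "c \<in> borel_measurable (F n)" "c \<in> borel_measurable M"
    unfolding c_def by measurable
  have posf: "AE x in M. 0 < E n (\<lambda>x. ennreal (f x)) x" and posg: "AE x in M. 0 < E n (\<lambda>x. ennreal (g x)) x"
    using pos by (auto intro!: E_pos)
  have a: "AE x in M. 0 < a x \<and> E n (\<lambda>x. ennreal (f x)) x = ennreal (a x)"
    using posf fin(1) by eventually_elim (auto simp: a_def enn2real_positive_iff)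
  have b: "AE x in M. 0 < b x \<and> E n (\<lambda>x. ennreal (g x)) x = ennreal (b x)"
    using posg fin(2) by eventually_elim (auto simp: b_def enn2real_positive_iff)
  have le: "AE x in M. c x * ennreal (f x powr s * g x powr (1 - s))
      \<le> ennreal (s / a x) * ennreal (f x) + ennreal ((1 - s) / b x) * ennreal (g x)"
    using a b AE_space
  proof eventually_elim
    case (elim x)
    have fx: "0 < f x" and gx: "0 < g x" using pos elim by auto
    have "a x powr (- s) * b x powr (s - 1) * (f x powr s * g x powr (1 - s))
       = (f x / a x) powr s * (g x / b x) powr (1 - s)"
      using elim fx gx by (simp add: powr_divide powr_minus powr_diff field_simps)
    also have "\<dots> \<le> s * (f x / a x) + (1 - s) * (g x / b x)"
      using elim fx gx s by (intro Youngs_inequality_0) auto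
    finally have "a x powr (- s) * b x powr (s - 1) * (f x powr s * g x powr (1 - s))
       \<le> s / a x * f x + (1 - s) / b x * g x" by simp
    then show ?case
      unfolding c_def using elim fx gx s
      by (simp add: ennreal_mult[symmetric] ennreal_plus[symmetric] ennreal_leI del: ennreal_plus)
  qed
  have "AE x in M. c x * E n (\<lambda>x. ennreal (f x powr s * g x powr (1 - s))) x
      = E n (\<lambda>x. c x * ennreal (f x powr s * g x powr (1 - s))) x"
    by (rule E_prod) auto
  moreover have "AE x in M. E n (\<lambda>x. c x * ennreal (f x powr s * g x powr (1 - s))) x
     \<le> E n (\<lambda>x. ennreal (s / a x) * ennreal (f x) + ennreal ((1 - s) / b x) * ennreal (g x)) x"
    by (rule E_mono[OF le]) auto
  moreover have "AE x in M. E n (\<lambda>x. ennreal (s / a x) * ennreal (f x)) x + E n (\<lambda>x. ennreal ((1 - s) / b x) * ennreal (g x)) x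
     = E n (\<lambda>x. ennreal (s / a x) * ennreal (f x) + ennreal ((1 - s) / b x) * ennreal (g x)) x"
    by (rule E_add) auto
  moreover have "AE x in M. ennreal (s / a x) * E n (\<lambda>x. ennreal (f x)) x = E n (\<lambda>x. ennreal (s / a x) * ennreal (f x)) x"
    by (rule E_prod) auto
  moreover have "AE x in M. ennreal ((1 - s) / b x) * E n (\<lambda>x. ennreal (g x)) x = E n (\<lambda>x. ennreal ((1 - s) / b x) * ennreal (g x)) x"
    by (rule E_prod) auto
  ultimately show ?thesis using a b
  proof eventually_elim
    case (elim x)
    let ?E = "E n (\<lambda>x. ennreal (f x powr s * g x powr (1 - s))) x"
    have ab: "0 < a x" "0 < b x" using elim by auto
    have "c x * ?E \<le> ennreal (s / a x) * ennreal (a x) + ennreal ((1 - s) / b x) * ennreal (b x)"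
      using elim by simp
    also have "\<dots> = 1"
      using ab s by (simp add: ennreal_mult[symmetric] ennreal_plus[symmetric] del: ennreal_plus)
    finally have 1: "c x * ?E \<le> 1" .
    have "?E = ennreal (a x powr s * b x powr (1 - s)) * c x * ?E"
      unfolding c_def using ab
      by (simp add: ennreal_mult[symmetric] powr_minus powr_diff field_simps)
    also have "\<dots> \<le> ennreal (a x powr s * b x powr (1 - s)) * 1"
      unfolding mult.assoc by (intro mult_left_mono 1) auto
    finally show ?case using elim ab by (simp add: ennpow_ennreal ennreal_mult)
  qed
qed

text \<open>An A_1 bound keeps \<open>H\<close> above its conditional expectation divided by
  \<open>B\<close>, so a negative power of \<open>H\<close> is dominated by an
  \<open>F n\<close>-measurable function, which can leave the conditional expectation.\<close>

lemma E_neg_powr_le: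
  fixes H w :: "'a \<Rightarrow> real"
  assumes [measurable]: "H \<in> borel_measurable M" "w \<in> borel_measurable M"
    and pos: "\<And>x. x \<in> space M \<Longrightarrow> 0 < H x" and w: "\<And>x. x \<in> space M \<Longrightarrow> 0 \<le> w x"
    and B: "0 < B" and e: "0 < e"
    and H: "AE x in M. E n (\<lambda>x. ennreal (H x)) x \<le> ennreal (B * H x)"
  shows "AE x in M. E n (\<lambda>x. ennreal (H x powr (- e) * w x)) x
    \<le> ennreal (B powr e * enn2real (E n (\<lambda>x. ennreal (H x)) x) powr (- e)) * E n (\<lambda>x. ennreal (w x)) x"
proof -
  define a where "a x = enn2real (E n (\<lambda>x. ennreal (H x)) x)" for x
  have [measurable]: "a \<in> borel_measurable (F n)" unfolding a_def by measurable
  then have [measurable]: "a \<in> borel_measurable M" by (rule F_measurable_M)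
  have posH: "AE x in M. 0 < E n (\<lambda>x. ennreal (H x)) x" using pos by (auto intro!: E_pos)
  have "AE x in M. ennreal (H x powr (- e) * w x) \<le> ennreal (B powr e * a x powr (- e)) * ennreal (w x)"
    using H posH AE_space
  proof eventually_elim
    case (elim x)
    have Hx: "0 < H x" using pos elim by auto
    have "E n (\<lambda>x. ennreal (H x)) x < \<top>"
      using elim(1) by (auto simp: less_top[symmetric] top_unique)
    then have a0: "0 < a x" and "E n (\<lambda>x. ennreal (H x)) x = ennreal (a x)"
      using elim by (auto simp: a_def enn2real_positive_iff)
    then have "a x \<le> B * H x" using elim B Hx by (simp add: ennreal_le_iff)
    then have "(B * H x) powr (- e) \<le> a x powr (- e)"
      using a0 e by (intro powr_mono2') auto
    then have "H x powr (- e) \<le> B powr e * a x powr (- e)"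
      using B Hx by (simp add: powr_mult powr_minus field_simps)
    then have "H x powr (- e) * w x \<le> (B powr e * a x powr (- e)) * w x"
      using w elim by (intro mult_right_mono) auto
    then show ?case using w elim by (simp add: ennreal_mult[symmetric] ennreal_leI)
  qed
  then have "AE x in M. E n (\<lambda>x. ennreal (H x powr (- e) * w x)) x
      \<le> E n (\<lambda>x. ennreal (B powr e * a x powr (- e)) * ennreal (w x)) x"
    by (rule E_mono) auto
  moreover have "AE x in M. ennreal (B powr e * a x powr (- e)) * E n (\<lambda>x. ennreal (w x)) x
      = E n (\<lambda>x. ennreal (B powr e * a x powr (- e)) * ennreal (w x)) x"
    by (rule E_prod) auto
  ultimately show ?thesis by eventually_elim (simp add: a_def)
qed

end

section \<open>Interpolation between two weak-type bounds\<close>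

text \<open>Integrability of \<open>\<phi>(\<cdot>, t)\<close> is left out, so that \<open>t powr p * v x\<close> is covered for non-integrable
  dual weights \<open>v\<close>.\<close>

definition orlicz_type :: "'a measure \<Rightarrow> ('a \<Rightarrow> real \<Rightarrow> real) \<Rightarrow> real \<Rightarrow> real \<Rightarrow> real \<Rightarrow> bool" where
  "orlicz_type M \<phi> pm pp c \<longleftrightarrow> (\<forall>t\<ge>0. (\<lambda>x. \<phi> x t) \<in> borel_measurable M) \<and>
     (\<forall>x\<in>space M. mono_on {0..} (\<phi> x) \<and> \<phi> x 0 = 0 \<and> filterlim (\<phi> x) at_top at_top \<and>
        (\<forall>t\<ge>0. \<forall>s. 0 < s \<and> s < 1 \<longrightarrow> \<phi> x (s * t) \<le> c * s powr pm * \<phi> x t) \<and>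
        (\<forall>t\<ge>0. \<forall>s\<ge>1. \<phi> x (s * t) \<le> c * s powr pp * \<phi> x t))"

text \<open>Needed because \<open>\<phi> x (g x)\<close> may fail to be measurable in \<open>x\<close>:
  \<open>\<phi>\<close> is monotone but not continuous in its second argument.\<close>

lemma nn_integral_cmult_le:
  fixes f :: "'a \<Rightarrow> ennreal"
  assumes "0 < c"
  shows "(\<integral>\<^sup>+x. ennreal c * f x \<partial>M) \<le> ennreal c * (\<integral>\<^sup>+x. f x \<partial>M)"
  unfolding nn_integral_def[of M "\<lambda>x. ennreal c * f x"]
proof (rule SUP_least, clarify)
  fix g assume g: "simple_function M g" "g \<le> (\<lambda>x. ennreal c * f x)"
  have [measurable]: "g \<in> borel_measurable M" using g by (rule_tac borel_measurable_simple_function)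
  have eq: "ennreal c * (ennreal (1 / c) * a) = a" for a
    using assms by (simp add: mult.assoc[symmetric] ennreal_mult[symmetric])
  have eq': "ennreal (1 / c) * (ennreal c * a) = a" for a
    using assms by (simp add: mult.assoc[symmetric] ennreal_mult[symmetric])
  have "integral\<^sup>S M g = (\<integral>\<^sup>+x. g x \<partial>M)" using g by (simp add: nn_integral_eq_simple_integral)
  \<comment> \<open>The constant may be moved out here because the simple function \<open>g\<close>
    is measurable, whatever \<open>f\<close> is.\<close>
  also have "\<dots> = ennreal c * (\<integral>\<^sup>+x. ennreal (1 / c) * g x \<partial>M)"
    by (simp add: nn_integral_cmult eq)
  also have "\<dots> \<le> ennreal c * (\<integral>\<^sup>+x. f x \<partial>M)"
  proof (intro mult_left_mono nn_integral_mono)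
    fix x
    have "ennreal (1 / c) * g x \<le> ennreal (1 / c) * (ennreal c * f x)"
      using g(2) by (intro mult_left_mono) (auto simp: le_fun_def)
    then show "ennreal (1 / c) * g x \<le> f x" by (simp add: eq')
  qed auto
  finally show "integral\<^sup>S M g \<le> ennreal c * (\<integral>\<^sup>+x. f x \<partial>M)" .
qed

section \<open>Two-sided geometric sums over the integers\<close>

lemma nat_div2_le_abs_int_decode: "n div 2 \<le> \<bar>int_decode n\<bar>"
  by (auto simp: int_decode_def sum_decode_def)

text \<open>Uniformity in \<open>y\<close> is the point: \<open>y\<close> will be
  \<open>log 2\<close> of a function value. The dyadic scales are enumerated by
  \<open>int_decode\<close> so that the sums run over \<open>nat\<close>.\<close>

lemma dyadic_sum_bounded:
  fixes d :: real
  assumes d: "0 < d"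
  obtains S where "0 < S"
    "\<And>y. (\<Sum>n. ennreal (2 powr (- d * \<bar>real_of_int (int_decode n) - y\<bar>))) \<le> ennreal S"
proof -
  define q where "q = 2 powr (- d / 2)"
  have q: "0 < q" "q < 1" unfolding q_def using d by (auto simp: powr_less_one)
  define S where "S = 2 powr d * (2 powr (d / 2) * (1 / (1 - q)))"
  have "0 < S" unfolding S_def using q by auto
  moreover have "(\<Sum>n. ennreal (2 powr (- d * \<bar>real_of_int (int_decode n) - y\<bar>))) \<le> ennreal S" for y
  proof -
    \<comment> \<open>Replacing \<open>y\<close> by its floor changes the distance to an integer by
      at most 1, whence the factor \<open>2 powr d\<close>. The remaining shift is by an integer and
      leaves the sum over all integers unchanged.\<close>
    define m where "m = \<lfloor>y\<rfloor>"
    let ?g = "\<lambda>k::int. ennreal (2 powr (- d * \<bar>real_of_int k\<bar>))"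
    have bij: "bij_betw (\<lambda>k::int. k - m) UNIV UNIV"
      by (rule bij_betw_byWitness[where f' = "\<lambda>k. k + m"]) auto
    have dec: "bij_betw int_decode UNIV UNIV" by (rule bij_int_decode)
    have "(\<Sum>n. ennreal (2 powr (- d * \<bar>real_of_int (int_decode n) - y\<bar>)))
      \<le> (\<Sum>n. ennreal (2 powr d) * ?g (int_decode n - m))"
    proof (intro suminf_le)
      fix n
      have "\<bar>real_of_int (int_decode n - m)\<bar> - 1 \<le> \<bar>real_of_int (int_decode n) - y\<bar>"
        unfolding m_def using floor_correct[of y] by (simp; linarith)
      then have "d * (\<bar>real_of_int (int_decode n - m)\<bar> - 1) \<le> d * \<bar>real_of_int (int_decode n) - y\<bar>"
        using d by (intro mult_left_mono) auto
      then have "2 powr (- d * \<bar>real_of_int (int_decode n) - y\<bar>)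
          \<le> 2 powr (d + - d * \<bar>real_of_int (int_decode n - m)\<bar>)"
        by (intro powr_mono) (auto simp: algebra_simps)
      then show "ennreal (2 powr (- d * \<bar>real_of_int (int_decode n) - y\<bar>))
          \<le> ennreal (2 powr d) * ?g (int_decode n - m)"
        by (metis ennreal_leI ennreal_mult powr_add powr_ge_zero)
    qed auto
    also have "\<dots> = ennreal (2 powr d) * (\<Sum>n. ?g (int_decode n - m))" by simp
    finally have 1: "(\<Sum>n. ennreal (2 powr (- d * \<bar>real_of_int (int_decode n) - y\<bar>)))
      \<le> ennreal (2 powr d) * (\<Sum>n. ?g (int_decode n - m))" .
    have "(\<Sum>n. ?g (int_decode n - m)) = (\<integral>\<^sup>+k. ?g (k - m) \<partial>count_space UNIV)"
      using nn_integral_bij_count_space[OF dec, of "\<lambda>k. ?g (k - m)"]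
      by (simp add: nn_integral_count_space_nat)
    also have "\<dots> = (\<integral>\<^sup>+k. ?g k \<partial>count_space UNIV)"
      by (rule nn_integral_bij_count_space[OF bij])
    also have "\<dots> = (\<Sum>n. ?g (int_decode n))"
      using nn_integral_bij_count_space[OF dec, of ?g] by (simp add: nn_integral_count_space_nat)
    also have "\<dots> \<le> (\<Sum>n. ennreal (2 powr (d / 2) * q ^ n))"
    proof (intro suminf_le)
      fix n
      \<comment> \<open>\<open>int_decode\<close> runs through 0, -1, 1, -2, ..., so the absolute
        value at \<open>n\<close> is at least \<open>n div 2\<close>, hence at least (n - 1) / 2.
        This gives the ratio \<open>q\<close> and the extra factor
        \<open>2 powr (d / 2)\<close>.\<close>
      have "int n \<le> 2 * int (n div 2) + 1" by linarith
      then have "int n - 1 \<le> 2 * \<bar>int_decode n\<bar>" using nat_div2_le_abs_int_decode[of n] by linarith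
      then have "real_of_int (int n - 1) \<le> real_of_int (2 * \<bar>int_decode n\<bar>)" by (rule of_int_le_iff[THEN iffD2])
      then have "(real n - 1) / 2 \<le> \<bar>real_of_int (int_decode n)\<bar>" by simp
      then have "d * ((real n - 1) / 2) \<le> d * \<bar>real_of_int (int_decode n)\<bar>" using d by (intro mult_left_mono) auto
      then have "2 powr (- d * \<bar>real_of_int (int_decode n)\<bar>) \<le> 2 powr (d / 2 + real n * (- d / 2))"
        by (intro powr_mono) (auto simp: field_simps)
      also have "\<dots> = 2 powr (d / 2) * q ^ n"
        by (simp only: powr_add q_def powr_realpow[symmetric] powr_gt_zero powr_powr mult.commute)
      finally show "?g (int_decode n) \<le> ennreal (2 powr (d / 2) * q ^ n)" by (rule ennreal_leI)
    qed auto
    also have "\<dots> = ennreal (2 powr (d / 2) * (1 / (1 - q)))"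
      using q by (intro suminf_ennreal_eq sums_mult geometric_sums) auto
    finally have "ennreal (2 powr d) * (\<Sum>n. ?g (int_decode n - m)) \<le> ennreal (2 powr d) * ennreal (2 powr (d / 2) * (1 / (1 - q)))"
      by (rule mult_left_mono) simp
    also have "\<dots> = ennreal S" unfolding S_def using q by (intro ennreal_mult[symmetric]) auto
    finally show ?thesis using 1 by (rule order_trans[rotated])
  qed
  ultimately show ?thesis using that by blast
qed

text \<open>Splitting a function at height 1 and using the exponent \<open>p0\<close> above and \<open>p1\<close> below the cut gives this kernel.\<close>

definition kern :: "real \<Rightarrow> real \<Rightarrow> ennreal \<Rightarrow> ennreal" where
  "kern p0 p1 a = (if 1 < a then ennpow a p0 else ennpow a p1)"

lemma borel_measurable_kern [measurable (raw)]:
  assumes [measurable]: "f \<in> borel_measurable N"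
  shows "(\<lambda>x. kern p0 p1 (f x)) \<in> borel_measurable N"
  unfolding kern_def by measurable

lemma le_suminf_ennreal: "f n \<le> (\<Sum>n. f n :: ennreal)"
  using sum_le_suminf[of f "{n}"] by simp

text \<open>A finite positive value lies in one interval (2^k, 2^(k+1)], and the summand of that
  \<open>k\<close> already dominates by monotonicity. At infinity every indicator is 1 and the
  growth of \<open>\<phi> x\<close> makes the summands unbounded.\<close>

lemma phi_ext_le_dyadic_sum:
  fixes \<phi> :: "'a \<Rightarrow> real \<Rightarrow> real"
  assumes mono: "mono_on {0..} (\<phi> x)" and 0: "\<phi> x 0 = 0" and lim: "filterlim (\<phi> x) at_top at_top"
  shows "phi_ext \<phi> x g \<le> (\<Sum>n. indicator {a. ennreal (2 powr real_of_int (int_decode n)) < a} g *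
            ennreal (\<phi> x (2 * 2 powr real_of_int (int_decode n))))"
    (is "_ \<le> (\<Sum>n. ?t n)")
proof -
  have single: "?t n \<le> (\<Sum>n. ?t n)" for n
    by (rule le_suminf_ennreal)
  show ?thesis
  proof (cases g)
    case (real y)
    show ?thesis
    proof (cases "y = 0")
      case True
      then show ?thesis using real 0 by (simp add: phi_ext_def)
    next
      case False
      then have y: "0 < y" using real by simp
      \<comment> \<open>The indicator uses a strict inequality, so \<open>y\<close> must sit
        strictly above 2^k; the ceiling minus 1 achieves this also when \<open>y\<close> is a power
        of 2.\<close>
      define k where "k = \<lceil>log 2 y\<rceil> - 1"
      have "real_of_int k < log 2 y" "log 2 y \<le> real_of_int k + 1"
        unfolding k_def by linarith+
      then have "2 powr real_of_int k < y" "y \<le> 2 powr (real_of_int k + 1)"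
        using y by (auto simp: less_log_iff log_le_iff)
      then have k: "2 powr real_of_int k < y" "y \<le> 2 * 2 powr real_of_int k"
        by (auto simp: powr_add)
      have "phi_ext \<phi> x g = ennreal (\<phi> x y)" using real by (simp add: phi_ext_def)
      also have "\<dots> \<le> ennreal (\<phi> x (2 * 2 powr real_of_int k))"
        using k y by (intro ennreal_leI mono_onD[OF mono]) auto
      also have "\<dots> = ?t (int_encode k)" using k real by (simp add: ennreal_less_iff)
      also have "\<dots> \<le> (\<Sum>n. ?t n)" by (rule single)
      finally show ?thesis .
    qed
  next
    case top
    have "of_nat N \<le> (\<Sum>n. ?t n)" for N :: nat
    proof -
      obtain T where T: "\<And>t. T \<le> t \<Longrightarrow> real N \<le> \<phi> x t"
        using lim by (auto simp: filterlim_at_top eventually_at_top_linorder)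
      define k where "k = \<lceil>log 2 (max T 1)\<rceil>"
      have "max T 1 \<le> 2 powr real_of_int k"
        unfolding k_def by (subst log_le_iff[symmetric]) auto
      then have "T \<le> 2 * 2 powr real_of_int k" using powr_gt_zero[of 2 "real_of_int k"] by linarith
      then have "ennreal (real N) \<le> ennreal (\<phi> x (2 * 2 powr real_of_int k))"
        by (intro ennreal_leI T)
      also have "\<dots> = ?t (int_encode k)" using top by simp
      also have "\<dots> \<le> (\<Sum>n. ?t n)" by (rule single)
      finally show ?thesis by (simp add: ennreal_of_nat_eq_real_of_nat)
    qed
    then have "(\<Sum>n. ?t n) = \<top>"
      using ennreal_Ex_less_of_nat[of "\<Sum>n. ?t n"] by (auto simp: less_top[symmetric] not_less[symmetric])
    then show ?thesis by simp
  qed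
qed

text \<open>For 2^k below \<open>h\<close> the lower type beats the growth of (h / 2^k)^p0 because
  \<open>p0 < pm\<close>; for larger 2^k the decay of (h / 2^k)^p1 beats the upper type because
  \<open>pp < p1\<close>. Either way the summand is at most a constant times 2^(-d |k - log2 h|)
  times the value of \<phi> at \<open>h\<close>, where \<open>d\<close> is the smaller of the two
  gaps.\<close>

lemma kern_dyadic_sum_le_phi_ext:
  assumes pm: "p0 < pm" and pp: "pp < p1" and c: "0 < c"
  obtains C where "0 < C" "\<And>(M::'a measure) \<phi> x h. orlicz_type M \<phi> pm pp c \<Longrightarrow> x \<in> space M \<Longrightarrow>
    (\<Sum>n. kern p0 p1 (h / ennreal (2 powr real_of_int (int_decode n))) *
          ennreal (\<phi> x (2 * 2 powr real_of_int (int_decode n)))) \<le> ennreal C * phi_ext \<phi> x h"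
proof -
  define d where "d = min (pm - p0) (p1 - pp)"
  have d: "0 < d" using pm pp by (simp add: d_def)
  obtain S where S: "0 < S" "\<And>y. (\<Sum>n. ennreal (2 powr (- d * \<bar>real_of_int (int_decode n) - y\<bar>))) \<le> ennreal S"
    using dyadic_sum_bounded[OF d] by blast
  \<comment> \<open>\<open>c * 2 powr pp\<close> is the doubling constant, the second
    \<open>c\<close> comes from one use of a type inequality, and \<open>S\<close> from the dyadic
    sum.\<close>
  define C where "C = c * 2 powr pp * c * S"
  have C: "0 < C" using c S by (simp add: C_def)
  have "(\<Sum>n. kern p0 p1 (h / ennreal (2 powr real_of_int (int_decode n))) *
          ennreal (\<phi> x (2 * 2 powr real_of_int (int_decode n)))) \<le> ennreal C * phi_ext \<phi> x h"
    if phi: "orlicz_type M \<phi> pm pp c" "x \<in> space M" for M :: "'a measure" and \<phi> x h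
  proof -
    have mono: "mono_on {0..} (\<phi> x)" and 0: "\<phi> x 0 = 0"
      and low: "\<And>t s. 0 \<le> t \<Longrightarrow> 0 < s \<Longrightarrow> s < 1 \<Longrightarrow> \<phi> x (s * t) \<le> c * s powr pm * \<phi> x t"
      and up: "\<And>t s. 0 \<le> t \<Longrightarrow> 1 \<le> s \<Longrightarrow> \<phi> x (s * t) \<le> c * s powr pp * \<phi> x t"
      using phi by (auto simp: orlicz_type_def)
    have nonneg: "0 \<le> \<phi> x t" if "0 \<le> t" for t
      using mono_onD[OF mono, of 0 t] that 0 by simp
    consider "h = \<top>" | "h = 0" | y where "h = ennreal y" "0 < y"
      by (cases h) (auto simp: le_less)
    then show ?thesis
    proof cases
      case 1
      then show ?thesis using C by (simp add: phi_ext_def ennreal_mult_top)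
    next
      case 2
      then show ?thesis by (simp add: kern_def)
    next
      case (3 y)
      have trm: "kern p0 p1 (h / ennreal (2 powr real_of_int k)) * ennreal (\<phi> x (2 * 2 powr real_of_int k))
        \<le> ennreal (c * 2 powr pp * c * \<phi> x y) * ennreal (2 powr (- d * \<bar>real_of_int k - log 2 y\<bar>))" for k
      proof -
        define L where "L = 2 powr real_of_int k"
        have L: "0 < L" by (simp add: L_def)
        have Ly: "L / y = 2 powr (real_of_int k - log 2 y)" using 3 by (simp add: L_def powr_diff)
        have yL: "y / L = 2 powr (log 2 y - real_of_int k)" using 3 by (simp add: L_def powr_diff)
        \<comment> \<open>Even for \<open>L < y\<close> the point \<open>2 * L\<close> can exceed
          \<open>y\<close>, where the lower type cannot be applied; doubling first reduces to
          \<open>L\<close>.\<close>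
        have dbl: "\<phi> x (2 * L) \<le> c * 2 powr pp * \<phi> x L" using up[of L 2] L by simp
        have hL: "h / ennreal L = ennreal (y / L)" using 3 L by (simp add: divide_ennreal)
        show ?thesis
        proof (cases "1 < y / L")
          case True
          then have s: "L / y < 1" "0 < L / y" using L 3 by (auto simp: field_simps)
          have less: "real_of_int k - log 2 y < 0" using s(1) 3 by (simp add: less_log_iff L_def field_simps)
          have "\<phi> x L \<le> c * (L / y) powr pm * \<phi> x y" using low[of y "L / y"] s 3 by simp
          then have "c * 2 powr pp * \<phi> x L \<le> c * 2 powr pp * (c * (L / y) powr pm * \<phi> x y)"
            using c by (intro mult_left_mono) auto
          with dbl have "(y / L) powr p0 * \<phi> x (2 * L) \<le> (y / L) powr p0 * (c * 2 powr pp * (c * (L / y) powr pm * \<phi> x y))"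
            by (intro mult_left_mono) auto
          also have "\<dots> = (c * 2 powr pp * c * \<phi> x y) * 2 powr ((real_of_int k - log 2 y) * (pm - p0))"
            unfolding Ly yL powr_powr by (simp add: powr_add[symmetric] algebra_simps)
          also have "\<dots> \<le> (c * 2 powr pp * c * \<phi> x y) * 2 powr (- d * \<bar>real_of_int k - log 2 y\<bar>)"
          proof (intro mult_left_mono powr_mono)
            have "(log 2 y - real_of_int k) * d \<le> (log 2 y - real_of_int k) * (pm - p0)"
              using less by (intro mult_left_mono) (auto simp: d_def)
            then show "(real_of_int k - log 2 y) * (pm - p0) \<le> - d * \<bar>real_of_int k - log 2 y\<bar>"
              using less by (simp add: algebra_simps)
          qed (use c nonneg 3 in auto)
          finally have *: "(y / L) powr p0 * \<phi> x (2 * L) \<le> (c * 2 powr pp * c * \<phi> x y) * 2 powr (- d * \<bar>real_of_int k - log 2 y\<bar>)" .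
          have "kern p0 p1 (h / ennreal L) * ennreal (\<phi> x (2 * L)) = ennreal ((y / L) powr p0 * \<phi> x (2 * L))"
            unfolding hL kern_def using True L 3 nonneg[of "2 * L"] by (simp add: ennpow_ennreal ennreal_mult)
          also have "\<dots> \<le> ennreal (c * 2 powr pp * c * \<phi> x y * 2 powr (- d * \<bar>real_of_int k - log 2 y\<bar>))"
            by (rule ennreal_leI[OF *])
          finally show ?thesis using c nonneg[of y] 3 by (simp add: L_def ennreal_mult)
        next
          case False
          then have s: "1 \<le> L / y" using L 3 by (auto simp: field_simps)
          have less: "0 \<le> real_of_int k - log 2 y" using s 3 by (simp add: log_le_iff L_def field_simps)
          have "\<phi> x L \<le> c * (L / y) powr pp * \<phi> x y" using up[of y "L / y"] s 3 by simp
          then have "c * 2 powr pp * \<phi> x L \<le> c * 2 powr pp * (c * (L / y) powr pp * \<phi> x y)"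
            using c by (intro mult_left_mono) auto
          with dbl have "(y / L) powr p1 * \<phi> x (2 * L) \<le> (y / L) powr p1 * (c * 2 powr pp * (c * (L / y) powr pp * \<phi> x y))"
            by (intro mult_left_mono) auto
          also have "\<dots> = (c * 2 powr pp * c * \<phi> x y) * 2 powr ((log 2 y - real_of_int k) * (p1 - pp))"
            unfolding Ly yL powr_powr by (simp add: powr_add[symmetric] algebra_simps)
          also have "\<dots> \<le> (c * 2 powr pp * c * \<phi> x y) * 2 powr (- d * \<bar>real_of_int k - log 2 y\<bar>)"
          proof (intro mult_left_mono powr_mono)
            have "(real_of_int k - log 2 y) * d \<le> (real_of_int k - log 2 y) * (p1 - pp)"
              using less by (intro mult_left_mono) (auto simp: d_def)
            then show "(log 2 y - real_of_int k) * (p1 - pp) \<le> - d * \<bar>real_of_int k - log 2 y\<bar>"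
              using less by (simp add: algebra_simps)
          qed (use c nonneg 3 in auto)
          finally have *: "(y / L) powr p1 * \<phi> x (2 * L) \<le> (c * 2 powr pp * c * \<phi> x y) * 2 powr (- d * \<bar>real_of_int k - log 2 y\<bar>)" .
          have "kern p0 p1 (h / ennreal L) * ennreal (\<phi> x (2 * L)) = ennreal ((y / L) powr p1 * \<phi> x (2 * L))"
            unfolding hL kern_def using False L 3 nonneg[of "2 * L"] by (simp add: ennpow_ennreal ennreal_mult)
          also have "\<dots> \<le> ennreal (c * 2 powr pp * c * \<phi> x y * 2 powr (- d * \<bar>real_of_int k - log 2 y\<bar>))"
            by (rule ennreal_leI[OF *])
          finally show ?thesis using c nonneg[of y] 3 by (simp add: L_def ennreal_mult)
        qed
      qed
      have "(\<Sum>n. kern p0 p1 (h / ennreal (2 powr real_of_int (int_decode n))) *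
          ennreal (\<phi> x (2 * 2 powr real_of_int (int_decode n))))
        \<le> (\<Sum>n. ennreal (c * 2 powr pp * c * \<phi> x y) * ennreal (2 powr (- d * \<bar>real_of_int (int_decode n) - log 2 y\<bar>)))"
        by (intro suminf_le trm) auto
      also have "\<dots> = ennreal (c * 2 powr pp * c * \<phi> x y) * (\<Sum>n. ennreal (2 powr (- d * \<bar>real_of_int (int_decode n) - log 2 y\<bar>)))"
        by simp
      also have "\<dots> \<le> ennreal (c * 2 powr pp * c * \<phi> x y) * ennreal S"
        by (intro mult_left_mono S) auto
      also have "\<dots> = ennreal C * phi_ext \<phi> x h"
        using 3 c S nonneg[of y] by (simp add: phi_ext_def C_def ennreal_mult[symmetric] mult_ac)
      finally show ?thesis .
    qed
  qed
  with C that show ?thesis by blast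
qed

text \<open>\<open>C\<close> depends only on the exponents, \<open>c\<close> and \<open>A\<close>.
  Since \<open>M\<close> and \<phi> are quantified after it, one constant serves all weights
  \<open>v\<close> in \<open>Qv_strong_type\<close> and all dilations of \<phi> in
  \<open>vector_maximal_modular\<close>.\<close>

lemma musielak_orlicz_interpolation:
  assumes pm: "p0 < pm" and pp: "pp < p1" and c: "0 < c" and A: "0 < A"
  obtains C where "0 < C" "\<And>(M::'a measure) \<phi> G H. orlicz_type M \<phi> pm pp c \<Longrightarrow>
    G \<in> borel_measurable M \<Longrightarrow> H \<in> borel_measurable M \<Longrightarrow>
    (\<And>l. 0 < l \<Longrightarrow> (\<integral>\<^sup>+x. indicator {a. ennreal l < a} (G x) * ennreal (\<phi> x (2 * l)) \<partial>M)
       \<le> ennreal A * (\<integral>\<^sup>+x. kern p0 p1 (H x / ennreal l) * ennreal (\<phi> x (2 * l)) \<partial>M)) \<Longrightarrow>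
    (\<integral>\<^sup>+x. phi_ext \<phi> x (G x) \<partial>M) \<le> ennreal C * (\<integral>\<^sup>+x. phi_ext \<phi> x (H x) \<partial>M)"
proof -
  obtain C where C: "0 < C" "\<And>(M::'a measure) \<phi> x h. orlicz_type M \<phi> pm pp c \<Longrightarrow> x \<in> space M \<Longrightarrow>
    (\<Sum>n. kern p0 p1 (h / ennreal (2 powr real_of_int (int_decode n))) *
          ennreal (\<phi> x (2 * 2 powr real_of_int (int_decode n)))) \<le> ennreal C * phi_ext \<phi> x h"
    using kern_dyadic_sum_le_phi_ext[OF pm pp c] by blast
  have "(\<integral>\<^sup>+x. phi_ext \<phi> x (G x) \<partial>M) \<le> ennreal (A * C) * (\<integral>\<^sup>+x. phi_ext \<phi> x (H x) \<partial>M)"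
    if phi: "orlicz_type M \<phi> pm pp c"
      and [measurable]: "G \<in> borel_measurable M" "H \<in> borel_measurable M"
      and lev: "\<And>l. 0 < l \<Longrightarrow> (\<integral>\<^sup>+x. indicator {a. ennreal l < a} (G x) * ennreal (\<phi> x (2 * l)) \<partial>M)
       \<le> ennreal A * (\<integral>\<^sup>+x. kern p0 p1 (H x / ennreal l) * ennreal (\<phi> x (2 * l)) \<partial>M)"
    for M :: "'a measure" and \<phi> G H
  proof -
    have [measurable]: "(\<lambda>x. \<phi> x (2 * 2 powr real_of_int k)) \<in> borel_measurable M" for k
      using phi by (auto simp: orlicz_type_def)
    let ?l = "\<lambda>n. 2 powr real_of_int (int_decode n)"
    have "(\<integral>\<^sup>+x. phi_ext \<phi> x (G x) \<partial>M)
      \<le> (\<integral>\<^sup>+x. (\<Sum>n. indicator {a. ennreal (?l n) < a} (G x) * ennreal (\<phi> x (2 * ?l n))) \<partial>M)"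
      using phi by (intro nn_integral_mono phi_ext_le_dyadic_sum) (auto simp: orlicz_type_def)
    also have "\<dots> = (\<Sum>n. \<integral>\<^sup>+x. indicator {a. ennreal (?l n) < a} (G x) * ennreal (\<phi> x (2 * ?l n)) \<partial>M)"
      by (rule nn_integral_suminf) measurable
    also have "\<dots> \<le> (\<Sum>n. ennreal A * (\<integral>\<^sup>+x. kern p0 p1 (H x / ennreal (?l n)) * ennreal (\<phi> x (2 * ?l n)) \<partial>M))"
      by (intro suminf_le lev) auto
    also have "\<dots> = ennreal A * (\<integral>\<^sup>+x. (\<Sum>n. kern p0 p1 (H x / ennreal (?l n)) * ennreal (\<phi> x (2 * ?l n))) \<partial>M)"
      by (subst nn_integral_suminf) auto
    also have "\<dots> \<le> ennreal A * (\<integral>\<^sup>+x. ennreal C * phi_ext \<phi> x (H x) \<partial>M)"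
      using phi by (intro mult_left_mono nn_integral_mono C) auto
    also have "\<dots> \<le> ennreal A * (ennreal C * (\<integral>\<^sup>+x. phi_ext \<phi> x (H x) \<partial>M))"
      using C by (intro mult_left_mono nn_integral_cmult_le) auto
    finally show ?thesis using A C by (simp add: ennreal_mult mult.assoc)
  qed
  with A C(1) that[of "A * C"] show ?thesis by simp
qed

section \<open>The weighted Doob inequality\<close>

lemma filterlim_powr_at_top:
  fixes p :: real
  assumes p: "0 < p"
  shows "filterlim (\<lambda>t. t powr p) at_top at_top"
  unfolding filterlim_at_top
proof
  fix Z :: real
  have "Z \<le> t powr p" if "max Z 1 powr (1 / p) \<le> t" for t
  proof -
    have "Z \<le> (max Z 1 powr (1 / p)) powr p" using p by (simp add: powr_powr)
    also have "\<dots> \<le> t powr p" using that p by (intro powr_mono2) auto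
    finally show ?thesis .
  qed
  then show "\<forall>\<^sub>F t in at_top. Z \<le> t powr p"
    by (auto simp: eventually_at_top_linorder)
qed

context filtered_prob_space
begin

text \<open>The Doob maximal function of \<open>h / v\<close> with respect to the measure \<open>v dP\<close>.\<close>

definition Qv :: "('a \<Rightarrow> real) \<Rightarrow> ('a \<Rightarrow> ennreal) \<Rightarrow> 'a \<Rightarrow> ennreal" where
  "Qv v h x = (SUP n. E n h x / E n (\<lambda>x. ennreal (v x)) x)"

lemma borel_measurable_Qv [measurable]: "Qv v h \<in> borel_measurable M"
  unfolding Qv_def by measurable

text \<open>Doob's stopping argument, run with the part \<open>h1\<close> of \<open>h\<close> above
  \<open>l * v\<close>: a ratio above \<open>2 * l\<close> for \<open>h\<close> forces a ratio above
  \<open>l\<close> for \<open>h1\<close>. Keeping only that part on the right is what makes the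
  estimate fit the interpolation kernel.\<close>

lemma Qv_weak_type:
  assumes [measurable]: "v \<in> borel_measurable M" "h \<in> borel_measurable M"
    and v: "\<And>x. x \<in> space M \<Longrightarrow> 0 < v x" and fin: "\<And>n. AE x in M. E n (\<lambda>x. ennreal (v x)) x < \<top>"
    and l: "0 < l"
  shows "ennreal l * (\<integral>\<^sup>+x. indicator {a. ennreal (2 * l) < a} (Qv v h x) * ennreal (v x) \<partial>M)
     \<le> (\<integral>\<^sup>+x. (if ennreal (l * v x) < h x then h x else 0) \<partial>M)"
proof -
  define h1 where "h1 x = (if ennreal (l * v x) < h x then h x else 0)" for x
  have [measurable]: "h1 \<in> borel_measurable M" unfolding h1_def by measurable
  define A where "A n = {x \<in> space (F n). ennreal l * E n (\<lambda>x. ennreal (v x)) x < E n h1 x}" for n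
  have A: "A n \<in> sets (F n)" for n unfolding A_def by measurable
  have AF: "A m \<in> sets (F n)" if "m \<le> n" for m n
    using A[of m] filtration that by (auto simp: filtration_of_def)
  \<comment> \<open>\<open>D n\<close> is the set where the level is first crossed at time
    \<open>n\<close>; it belongs to \<open>F n\<close> because the earlier sets \<open>A m\<close>
    do, the filtration being increasing.\<close>
  define D where "D = disjointed A"
  have D [measurable]: "D n \<in> sets (F n)" for n
    unfolding D_def disjointed_def by (intro sets.Diff sets.finite_UN AF) auto
  have [measurable]: "D n \<in> sets M" for n using D[of n] subalg_F[of n] by (auto simp: subalgebra_def)
  have DA: "(\<Union>n. D n) = (\<Union>n. A n)" unfolding D_def by (rule UN_disjointed_eq)
  have disj: "disjoint_family D" unfolding D_def by (rule disjoint_family_disjointed)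
  have piece: "ennreal l * (\<integral>\<^sup>+x. indicator (D n) x * ennreal (v x) \<partial>M) \<le> (\<integral>\<^sup>+x. indicator (D n) x * h1 x \<partial>M)" for n
  proof -
    have "ennreal l * (\<integral>\<^sup>+x. indicator (D n) x * ennreal (v x) \<partial>M)
      = ennreal l * (\<integral>\<^sup>+x. indicator (D n) x * E n (\<lambda>x. ennreal (v x)) x \<partial>M)"
      by (subst E_intg) auto
    also have "\<dots> = (\<integral>\<^sup>+x. ennreal l * (indicator (D n) x * E n (\<lambda>x. ennreal (v x)) x) \<partial>M)"
      by (rule nn_integral_cmult[symmetric]) auto
    also have "\<dots> \<le> (\<integral>\<^sup>+x. indicator (D n) x * E n h1 x \<partial>M)"
    proof (rule nn_integral_mono)
      fix x
      have "x \<in> A n" if "x \<in> D n" using that unfolding D_def disjointed_def by auto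
      then show "ennreal l * (indicator (D n) x * E n (\<lambda>x. ennreal (v x)) x) \<le> indicator (D n) x * E n h1 x"
        by (auto simp: A_def indicator_def)
    qed
    also have "\<dots> = (\<integral>\<^sup>+x. indicator (D n) x * h1 x \<partial>M)" by (rule E_intg) auto
    finally show ?thesis .
  qed
  have sub: "AE x in M. indicator {a. ennreal (2 * l) < a} (Qv v h x) \<le> (indicator (\<Union>n. D n) x :: ennreal)"
  proof -
    have 1: "AE x in M. \<forall>n. E n (\<lambda>x. ennreal (v x)) x < \<top>" using fin by (simp add: AE_all_countable)
    have 2: "AE x in M. \<forall>n. 0 < E n (\<lambda>x. ennreal (v x)) x" unfolding AE_all_countable
      using v by (auto intro!: E_pos)
    \<comment> \<open>Pointwise \<open>h\<close> is at most \<open>h1 + l * v\<close>: where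
      \<open>h1\<close> vanishes, \<open>h\<close> itself is at most \<open>l * v\<close>.\<close>
    have 3: "AE x in M. \<forall>n. E n h x \<le> E n h1 x + ennreal l * E n (\<lambda>x. ennreal (v x)) x"
      unfolding AE_all_countable
    proof
      fix n
      have "AE x in M. E n h x \<le> E n (\<lambda>x. h1 x + ennreal l * ennreal (v x)) x"
        using l v by (intro E_mono) (auto simp: h1_def ennreal_mult'[symmetric] not_less intro: add_increasing2)
      moreover have "AE x in M. E n h1 x + E n (\<lambda>x. ennreal l * ennreal (v x)) x = E n (\<lambda>x. h1 x + ennreal l * ennreal (v x)) x"
        by (rule E_add) auto
      moreover have "AE x in M. ennreal l * E n (\<lambda>x. ennreal (v x)) x = E n (\<lambda>x. ennreal l * ennreal (v x)) x"
        by (rule E_cmult) auto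
      ultimately show "AE x in M. E n h x \<le> E n h1 x + ennreal l * E n (\<lambda>x. ennreal (v x)) x"
        by eventually_elim simp
    qed
    show ?thesis using 1 2 3 AE_space
    proof eventually_elim
      case (elim x)
      have "x \<in> (\<Union>n. A n)" if "ennreal (2 * l) < Qv v h x"
      proof (rule ccontr)
        assume no: "x \<notin> (\<Union>n. A n)"
        have "Qv v h x \<le> ennreal (2 * l)" unfolding Qv_def
        proof (rule SUP_least)
          fix n
          let ?v = "E n (\<lambda>x. ennreal (v x)) x"
          have "x \<in> space (F n)" using elim subalg_F[of n] by (auto simp: subalgebra_def)
          then have "E n h1 x \<le> ennreal l * ?v" using no by (auto simp: A_def not_less)
          then have "E n h x \<le> ennreal l * ?v + ennreal l * ?v"
            using elim(3)[rule_format, of n] by (meson add_right_mono order_trans)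
          also have "\<dots> = ennreal (2 * l) * ?v"
            using l by (simp add: distrib_right[symmetric] ennreal_plus[symmetric] del: ennreal_plus)
          finally show "E n h x / ?v \<le> ennreal (2 * l)"
            using elim by (intro divide_le_posI_ennreal) (auto simp: mult.commute)
        qed
        then show False using that by simp
      qed
      then show ?case by (auto simp: DA indicator_def)
    qed
  qed
  have "ennreal l * (\<integral>\<^sup>+x. indicator {a. ennreal (2 * l) < a} (Qv v h x) * ennreal (v x) \<partial>M)
    \<le> ennreal l * (\<integral>\<^sup>+x. indicator (\<Union>n. D n) x * ennreal (v x) \<partial>M)"
    by (intro mult_left_mono nn_integral_mono_AE) (use sub in \<open>auto intro!: mult_right_mono\<close>)
  also have "\<dots> = ennreal l * (\<integral>\<^sup>+x. (\<Sum>n. indicator (D n) x * ennreal (v x)) \<partial>M)"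
    by (simp add: suminf_indicator[OF disj])
  also have "\<dots> = (\<Sum>n. ennreal l * (\<integral>\<^sup>+x. indicator (D n) x * ennreal (v x) \<partial>M))"
    by (subst nn_integral_suminf) auto
  also have "\<dots> \<le> (\<Sum>n. \<integral>\<^sup>+x. indicator (D n) x * h1 x \<partial>M)"
    by (intro suminf_le piece) auto
  also have "\<dots> = (\<integral>\<^sup>+x. indicator (\<Union>n. D n) x * h1 x \<partial>M)"
    by (subst nn_integral_suminf[symmetric]) (auto simp: suminf_indicator[OF disj])
  also have "\<dots> \<le> (\<integral>\<^sup>+x. h1 x \<partial>M)"
    by (intro nn_integral_mono) (auto simp: indicator_def)
  finally show ?thesis unfolding h1_def .
qed

lemma orlicz_type_powr:
  assumes [measurable]: "v \<in> borel_measurable M"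
    and v: "\<And>x. x \<in> space M \<Longrightarrow> 0 < v x" and p: "0 < p"
  shows "orlicz_type M (\<lambda>x t. t powr p * v x) p p 1"
  unfolding orlicz_type_def
proof (intro conjI ballI allI impI)
  fix x assume x: "x \<in> space M"
  show "mono_on {0..} (\<lambda>t. t powr p * v x)"
    using v[OF x] p by (intro mono_onI mult_right_mono powr_mono2) auto
  have "filterlim (\<lambda>t::real. t powr p) at_top at_top" using p by (rule filterlim_powr_at_top)
  then show "filterlim (\<lambda>t. t powr p * v x) at_top at_top"
    using v[OF x] by (rule filterlim_at_top_mult_tendsto_pos[OF tendsto_const, rotated])
qed (auto simp: powr_mult)

text \<open>Marcinkiewicz interpolation, obtained from the function \<open>t powr p * v x\<close>.
  The upper branch of the kernel has the exponent 1 of the weak-type estimate. The right-hand side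
  of that estimate vanishes below the cut, so any exponent above \<open>p\<close>, here
  \<open>p + 1\<close>, fits in the lower branch.\<close>

lemma Qv_strong_type:
  assumes p: "1 < p"
  obtains C where "0 < C" "\<And>v h. v \<in> borel_measurable M \<Longrightarrow> h \<in> borel_measurable M \<Longrightarrow>
    (\<And>x. x \<in> space M \<Longrightarrow> 0 < v x) \<Longrightarrow> (\<And>n. AE x in M. E n (\<lambda>x. ennreal (v x)) x < \<top>) \<Longrightarrow>
    (\<integral>\<^sup>+x. ennpow (Qv v h x) p * ennreal (v x) \<partial>M)
      \<le> ennreal C * (\<integral>\<^sup>+x. ennpow (h x / ennreal (v x)) p * ennreal (v x) \<partial>M)"
proof -
  obtain C where C: "0 < C" "\<And>(M::'a measure) \<phi> G H. orlicz_type M \<phi> p p 1 \<Longrightarrow>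
    G \<in> borel_measurable M \<Longrightarrow> H \<in> borel_measurable M \<Longrightarrow>
    (\<And>l. 0 < l \<Longrightarrow> (\<integral>\<^sup>+x. indicator {a. ennreal l < a} (G x) * ennreal (\<phi> x (2 * l)) \<partial>M)
       \<le> ennreal 1 * (\<integral>\<^sup>+x. kern 1 (p + 1) (H x / ennreal l) * ennreal (\<phi> x (2 * l)) \<partial>M)) \<Longrightarrow>
    (\<integral>\<^sup>+x. phi_ext \<phi> x (G x) \<partial>M) \<le> ennreal C * (\<integral>\<^sup>+x. phi_ext \<phi> x (H x) \<partial>M)"
    using musielak_orlicz_interpolation[OF p, of p "p + 1" 1 1] by auto
  have "(\<integral>\<^sup>+x. ennpow (Qv v h x) p * ennreal (v x) \<partial>M)
      \<le> ennreal (C * 2 powr p) * (\<integral>\<^sup>+x. ennpow (h x / ennreal (v x)) p * ennreal (v x) \<partial>M)"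
    if [measurable]: "v \<in> borel_measurable M" "h \<in> borel_measurable M"
      and v: "\<And>x. x \<in> space M \<Longrightarrow> 0 < v x" and fin: "\<And>n. AE x in M. E n (\<lambda>x. ennreal (v x)) x < \<top>" for v h
  proof -
    \<comment> \<open>\<open>Qv_weak_type\<close> at \<open>l / 2\<close> has the level
      \<open>l\<close> on the left and the cut \<open>l / 2 * v x < h x\<close> on the right; with
      the factor 2 in \<open>H\<close> this cut is \<open>1 < H x / ennreal l\<close>, the threshold
      of \<open>kern\<close>.\<close>
    define H where "H x = 2 * h x / ennreal (v x)" for x
    have [measurable]: "H \<in> borel_measurable M" unfolding H_def by measurable
    have pe: "phi_ext (\<lambda>x t. t powr p * v x) x t = ennpow t p * ennreal (v x)" if "x \<in> space M" for x t
      using v[OF that] by (cases t) (auto simp: phi_ext_def ennpow_ennreal ennreal_mult ennreal_top_mult)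
    have lev: "(\<integral>\<^sup>+x. indicator {a. ennreal l < a} (Qv v h x) * ennreal ((2 * l) powr p * v x) \<partial>M)
       \<le> ennreal 1 * (\<integral>\<^sup>+x. kern 1 (p + 1) (H x / ennreal l) * ennreal ((2 * l) powr p * v x) \<partial>M)"
      if l: "0 < l" for l
    proof -
      \<comment> \<open>Chosen so that \<open>(2 * l) powr p = k * (l / 2)\<close>, where
        \<open>l / 2\<close> is the factor on the left of the weak-type estimate.\<close>
      define k where "k = (2 * l) powr p * (2 / l)"
      have k: "0 < k" "(2 * l) powr p = k * (l / 2)" using l by (auto simp: k_def)
      have "(\<integral>\<^sup>+x. indicator {a. ennreal l < a} (Qv v h x) * ennreal ((2 * l) powr p * v x) \<partial>M)
        = (\<integral>\<^sup>+x. ennreal k * (ennreal (l / 2) * (indicator {a. ennreal l < a} (Qv v h x) * ennreal (v x))) \<partial>M)"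
      proof (intro nn_integral_cong)
        fix x assume "x \<in> space M"
        have "ennreal ((2 * l) powr p * v x) = ennreal k * (ennreal (l / 2) * ennreal (v x))"
          unfolding k(2) using k(1) l v[OF \<open>x \<in> space M\<close>]
          by (simp only: ennreal_mult[symmetric] less_imp_le mult_nonneg_nonneg half_gt_zero mult.assoc)
        then show "indicator {a. ennreal l < a} (Qv v h x) * ennreal ((2 * l) powr p * v x)
          = ennreal k * (ennreal (l / 2) * (indicator {a. ennreal l < a} (Qv v h x) * ennreal (v x)))"
          by (cases "ennreal l < Qv v h x") auto
      qed
      also have "\<dots> = ennreal k * (ennreal (l / 2) * (\<integral>\<^sup>+x. indicator {a. ennreal l < a} (Qv v h x) * ennreal (v x) \<partial>M))"
        by (simp add: nn_integral_cmult)
      also have "\<dots> \<le> ennreal k * (\<integral>\<^sup>+x. (if ennreal (l / 2 * v x) < h x then h x else 0) \<partial>M)"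
        using Qv_weak_type[of v h "l / 2"] v fin l by (intro mult_left_mono) auto
      also have "\<dots> = (\<integral>\<^sup>+x. ennreal k * (if ennreal (l / 2 * v x) < h x then h x else 0) \<partial>M)"
        by (rule nn_integral_cmult[symmetric]) measurable
      also have "\<dots> \<le> (\<integral>\<^sup>+x. kern 1 (p + 1) (H x / ennreal l) * ennreal ((2 * l) powr p * v x) \<partial>M)"
      proof (rule nn_integral_mono)
        fix x assume "x \<in> space M"
        note vx = v[OF this]
        show "ennreal k * (if ennreal (l / 2 * v x) < h x then h x else 0)
          \<le> kern 1 (p + 1) (H x / ennreal l) * ennreal ((2 * l) powr p * v x)"
        proof (cases "ennreal (l / 2 * v x) < h x")
          case True
          show ?thesis
          proof (cases "h x")
            case (real y)
            have y: "l / 2 * v x < y" using True real vx l by (simp add: ennreal_less_iff)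
            have Hx: "H x / ennreal l = ennreal (2 * y / (v x * l))"
              unfolding H_def using real vx l
              by (simp add: divide_ennreal numeral_mult_ennreal)
            have "1 < 2 * y / (v x * l)" using y vx l by (simp add: field_simps)
            then have "kern 1 (p + 1) (H x / ennreal l) = ennreal (2 * y / (v x * l))"
              unfolding Hx kern_def by simp
            then have "kern 1 (p + 1) (H x / ennreal l) * ennreal ((2 * l) powr p * v x)
               = ennreal (2 * y / (v x * l) * ((2 * l) powr p * v x))"
              using vx l real by (subst ennreal_mult) auto
            also have "2 * y / (v x * l) * ((2 * l) powr p * v x) = k * y"
              using vx l by (simp add: k_def)
            finally show ?thesis using True real k(1) by (simp add: ennreal_mult)
          next
            case top
            then have "H x / ennreal l = \<top>"
              unfolding H_def by (simp add: ennreal_top_divide ennreal_mult_top)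
            then show ?thesis using vx l by (simp add: kern_def ennreal_top_mult)
          qed
        qed simp
      qed
      finally show ?thesis by simp
    qed
    have "(\<integral>\<^sup>+x. ennpow (Qv v h x) p * ennreal (v x) \<partial>M) = (\<integral>\<^sup>+x. phi_ext (\<lambda>x t. t powr p * v x) x (Qv v h x) \<partial>M)"
      by (intro nn_integral_cong) (simp add: pe)
    also have "\<dots> \<le> ennreal C * (\<integral>\<^sup>+x. phi_ext (\<lambda>x t. t powr p * v x) x (H x) \<partial>M)"
      using lev p v by (intro C orlicz_type_powr) auto
    also have "(\<integral>\<^sup>+x. phi_ext (\<lambda>x t. t powr p * v x) x (H x) \<partial>M)
       = (\<integral>\<^sup>+x. ennreal (2 powr p) * (ennpow (h x / ennreal (v x)) p * ennreal (v x)) \<partial>M)"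
    proof (intro nn_integral_cong)
      fix x assume "x \<in> space M"
      have "H x = ennreal 2 * (h x / ennreal (v x))" by (simp add: H_def ennreal_times_divide)
      then have "ennpow (H x) p = ennreal (2 powr p) * ennpow (h x / ennreal (v x)) p"
        by (simp only: ennpow_mult) (simp add: ennpow_def)
      then show "phi_ext (\<lambda>x t. t powr p * v x) x (H x) = ennreal (2 powr p) * (ennpow (h x / ennreal (v x)) p * ennreal (v x))"
        using \<open>x \<in> space M\<close> by (simp add: pe mult.assoc)
    qed
    also have "\<dots> = ennreal (2 powr p) * (\<integral>\<^sup>+x. ennpow (h x / ennreal (v x)) p * ennreal (v x) \<partial>M)"
      by (rule nn_integral_cmult) measurable
    finally show ?thesis using C by (simp add: ennreal_mult mult.assoc)
  qed
  with C(1) that[of "C * 2 powr p"] show ?thesis by simp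
qed

section \<open>Weights with a uniform constant and the scalar maximal inequality\<close>

definition Ap :: "real \<Rightarrow> real \<Rightarrow> ('a \<Rightarrow> real) \<Rightarrow> bool" where
  "Ap p K w \<longleftrightarrow> w \<in> borel_measurable M \<and> (\<forall>x\<in>space M. 0 < w x) \<and>
     (\<forall>n. AE x in M. E n (\<lambda>x. ennreal (w x)) x *
        ennpow (E n (\<lambda>x. ennreal (w x powr (- 1 / (p - 1)))) x) (p - 1) \<le> ennreal K)"

lemma ApD:
  assumes "Ap p K w"
  shows "w \<in> borel_measurable M" "x \<in> space M \<Longrightarrow> 0 < w x"
    "AE x in M. E n (\<lambda>x. ennreal (w x)) x *
        ennpow (E n (\<lambda>x. ennreal (w x powr (- 1 / (p - 1)))) x) (p - 1) \<le> ennreal K"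
  using assms by (auto simp: Ap_def)

text \<open>Both conditional expectations are positive and the product in the weight condition is
  finite, so each factor is finite.\<close>

lemma Ap_pos_finite:
  assumes w: "Ap p K w"
  shows "AE x in M. 0 < E n (\<lambda>x. ennreal (w x)) x \<and> E n (\<lambda>x. ennreal (w x)) x < \<top> \<and>
     0 < E n (\<lambda>x. ennreal (w x powr (- 1 / (p - 1)))) x \<and> E n (\<lambda>x. ennreal (w x powr (- 1 / (p - 1)))) x < \<top>"
proof -
  note [measurable] = ApD(1)[OF w]
  have "AE x in M. 0 < E n (\<lambda>x. ennreal (w x)) x"
    using ApD(2)[OF w] by (intro E_pos) auto
  moreover have "AE x in M. 0 < E n (\<lambda>x. ennreal (w x powr (- 1 / (p - 1)))) x"
    using ApD(2)[OF w] by (intro E_pos) (auto intro: AE_I2 dest: less_imp_neq[THEN not_sym])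
  ultimately show ?thesis using ApD(3)[OF w, of n]
  proof eventually_elim
    case (elim x)
    let ?a = "E n (\<lambda>x. ennreal (w x)) x" and ?b = "E n (\<lambda>x. ennreal (w x powr (- 1 / (p - 1)))) x"
    have "?a * ennpow ?b (p - 1) \<noteq> \<top>" using elim by (auto simp: top_unique)
    then show ?case using elim by (auto simp: ennreal_mult_eq_top_iff less_top[symmetric])
  qed
qed

text \<open>With \<open>S = Qv \<sigma> f\<close> the weight condition gives
  \<open>(E n f) powr (p - 1) \<le> K * E n (S powr (p - 1)) / E n w \<le> K * Qv w (S powr (p - 1))\<close>.\<close>

lemma Ap_maximal:
  assumes p: "1 < p" and K: "0 < K"
  obtains C where "0 < C" "\<And>w f. Ap p K w \<Longrightarrow> f \<in> borel_measurable M \<Longrightarrow>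
    (\<integral>\<^sup>+x. ennpow (Mx f x) p * ennreal (w x) \<partial>M) \<le> ennreal C * (\<integral>\<^sup>+x. ennpow (f x) p * ennreal (w x) \<partial>M)"
proof -
  define p' where "p' = p / (p - 1)"
  have p': "1 < p'" "(p - 1) * p' = p" "p' = 1 + 1 / (p - 1)" using p by (auto simp: p'_def field_simps)
  obtain C1 where C1: "0 < C1" "\<And>v h. v \<in> borel_measurable M \<Longrightarrow> h \<in> borel_measurable M \<Longrightarrow>
    (\<And>x. x \<in> space M \<Longrightarrow> 0 < v x) \<Longrightarrow> (\<And>n. AE x in M. E n (\<lambda>x. ennreal (v x)) x < \<top>) \<Longrightarrow>
    (\<integral>\<^sup>+x. ennpow (Qv v h x) p' * ennreal (v x) \<partial>M)
      \<le> ennreal C1 * (\<integral>\<^sup>+x. ennpow (h x / ennreal (v x)) p' * ennreal (v x) \<partial>M)"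
    using Qv_strong_type[OF p'(1)] by blast
  obtain C2 where C2: "0 < C2" "\<And>v h. v \<in> borel_measurable M \<Longrightarrow> h \<in> borel_measurable M \<Longrightarrow>
    (\<And>x. x \<in> space M \<Longrightarrow> 0 < v x) \<Longrightarrow> (\<And>n. AE x in M. E n (\<lambda>x. ennreal (v x)) x < \<top>) \<Longrightarrow>
    (\<integral>\<^sup>+x. ennpow (Qv v h x) p * ennreal (v x) \<partial>M)
      \<le> ennreal C2 * (\<integral>\<^sup>+x. ennpow (h x / ennreal (v x)) p * ennreal (v x) \<partial>M)"
    using Qv_strong_type[OF p] by blast
  have "(\<integral>\<^sup>+x. ennpow (Mx f x) p * ennreal (w x) \<partial>M)
      \<le> ennreal (K powr p' * C1 * C2) * (\<integral>\<^sup>+x. ennpow (f x) p * ennreal (w x) \<partial>M)"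
    if w: "Ap p K w" and [measurable]: "f \<in> borel_measurable M" for w f
  proof -
    note [measurable] = ApD(1)[OF w]
    note wpos = ApD(2)[OF w]
    define \<sigma> where "\<sigma> x = w x powr (- 1 / (p - 1))" for x
    have [measurable]: "\<sigma> \<in> borel_measurable M" unfolding \<sigma>_def by measurable
    have \<sigma>pos: "0 < \<sigma> x" if "x \<in> space M" for x using wpos[OF that] by (simp add: \<sigma>_def)
    note pf = Ap_pos_finite[OF w, folded \<sigma>_def]
    define S where "S = Qv \<sigma> f"
    define R where "R = Qv w (\<lambda>x. ennpow (S x) (p - 1))"
    have [measurable]: "S \<in> borel_measurable M" "R \<in> borel_measurable M" unfolding S_def R_def by measurable
    have "AE x in M. \<forall>n. ennpow (E n f x) (p - 1) \<le> ennreal K * R x"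
      unfolding AE_all_countable
    proof
      fix n
      \<comment> \<open>The quotient is \<open>F n\<close>-measurable, so its power is its own
        conditional expectation; together with \<open>a \<le> S\<close> this brings \<open>S\<close>
        under \<open>E n\<close>.\<close>
      define a where "a x = E n f x / E n (\<lambda>x. ennreal (\<sigma> x)) x" for x
      have [measurable]: "a \<in> borel_measurable (F n)" "a \<in> borel_measurable M" unfolding a_def by measurable
      have aS: "a x \<le> S x" for x unfolding a_def S_def Qv_def by (rule SUP_upper) simp
      have "AE x in M. ennpow (a x) (p - 1) = E n (\<lambda>x. ennpow (a x) (p - 1)) x"
        by (rule E_F_meas) measurable
      moreover have "AE x in M. E n (\<lambda>x. ennpow (a x) (p - 1)) x \<le> E n (\<lambda>x. ennpow (S x) (p - 1)) x"
        using p by (intro E_mono AE_I2 ennpow_mono aS) auto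
      ultimately show "AE x in M. ennpow (E n f x) (p - 1) \<le> ennreal K * R x"
        using pf[of n] ApD(3)[OF w, of n, folded \<sigma>_def]
      proof eventually_elim
        case (elim x)
        let ?s = "E n (\<lambda>x. ennreal (\<sigma> x)) x" and ?w = "E n (\<lambda>x. ennreal (w x)) x"
          and ?S = "E n (\<lambda>x. ennpow (S x) (p - 1)) x"
        have w0: "?w \<noteq> 0" "?w \<noteq> \<top>" "?s \<noteq> 0" "?s \<noteq> \<top>" using elim by auto
        have "E n f x = a x * ?s"
          unfolding a_def using w0 by (simp add: ennreal_divide_times ennreal_divide_self less_top)
        then have "ennpow (E n f x) (p - 1) = ennpow (a x) (p - 1) * ennpow ?s (p - 1)"
          by (simp add: ennpow_mult)
        also have "\<dots> \<le> ?S * ennpow ?s (p - 1)" using elim by (intro mult_right_mono) auto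
        also have "\<dots> = ?S / ?w * (?w * ennpow ?s (p - 1))"
        proof -
          have "?w * ennpow ?s (p - 1) / ?w = ennpow ?s (p - 1)"
            using w0 mult_divide_eq_ennreal[of ?w "ennpow ?s (p - 1)"] by (simp add: mult.commute)
          then show ?thesis by (simp add: ennreal_divide_times)
        qed
        also have "\<dots> \<le> ?S / ?w * ennreal K" using elim by (intro mult_left_mono) auto
        also have "\<dots> \<le> R x * ennreal K"
          unfolding R_def Qv_def by (intro mult_right_mono SUP_upper) auto
        finally show ?case by (simp add: mult.commute)
      qed
    qed
    then have MR: "AE x in M. ennpow (Mx f x) p \<le> ennreal (K powr p') * ennpow (R x) p'"
    proof eventually_elim
      case (elim x)
      have "Mx f x \<le> ennpow (ennreal K * R x) (1 / (p - 1))" unfolding Mx_def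
      proof (rule SUP_least)
        fix n
        have "ennpow (ennpow (E n f x) (p - 1)) (1 / (p - 1)) \<le> ennpow (ennreal K * R x) (1 / (p - 1))"
          using elim p by (intro ennpow_mono[of "1 / (p - 1)"]) auto
        then show "E n f x \<le> ennpow (ennreal K * R x) (1 / (p - 1))" using p by (simp add: ennpow_ennpow)
      qed
      then have "ennpow (Mx f x) p \<le> ennpow (ennpow (ennreal K * R x) (1 / (p - 1))) p"
        using p by (intro ennpow_mono[of p]) auto
      also have "\<dots> = ennreal (K powr p') * ennpow (R x) p'"
        using K by (simp add: ennpow_ennpow ennpow_mult ennpow_ennreal powr_powr p'_def)
      finally show ?case .
    qed
    have "(\<integral>\<^sup>+x. ennpow (Mx f x) p * ennreal (w x) \<partial>M)
      \<le> (\<integral>\<^sup>+x. ennreal (K powr p') * (ennpow (R x) p' * ennreal (w x)) \<partial>M)"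
      unfolding mult.assoc[symmetric]
      by (intro nn_integral_mono_AE eventually_mono[OF MR] mult_right_mono) auto
    also have "\<dots> = ennreal (K powr p') * (\<integral>\<^sup>+x. ennpow (R x) p' * ennreal (w x) \<partial>M)"
      by (rule nn_integral_cmult) measurable
    also have "\<dots> \<le> ennreal (K powr p') * (ennreal C1 * (\<integral>\<^sup>+x. ennpow (ennpow (S x) (p - 1) / ennreal (w x)) p' * ennreal (w x) \<partial>M))"
      unfolding R_def using pf wpos by (intro mult_left_mono C1) (auto elim: eventually_mono)
    \<comment> \<open>Because \<open>(p - 1) * p' = p\<close> and
      \<open>w powr (1 - p') = \<sigma>\<close>, the second maximal function is integrated exactly
      against the dual weight.\<close>
    also have "(\<integral>\<^sup>+x. ennpow (ennpow (S x) (p - 1) / ennreal (w x)) p' * ennreal (w x) \<partial>M)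
       = (\<integral>\<^sup>+x. ennpow (S x) p * ennreal (\<sigma> x) \<partial>M)"
    proof (rule nn_integral_cong)
      fix x assume "x \<in> space M"
      then have wx: "0 < w x" by (rule wpos)
      have "ennpow (ennpow (S x) (p - 1) / ennreal (w x)) p'
         = ennpow (S x) p * ennreal ((1 / w x) powr p')"
        using wx by (simp add: divide_ennreal_def inverse_ennreal ennpow_mult ennpow_ennpow p'(2) ennpow_ennreal inverse_eq_divide)
      moreover have "(1 / w x) powr p' * w x = \<sigma> x"
        using wx by (simp add: \<sigma>_def p'(3) powr_add powr_divide powr_minus field_simps)
      ultimately show "ennpow (ennpow (S x) (p - 1) / ennreal (w x)) p' * ennreal (w x) = ennpow (S x) p * ennreal (\<sigma> x)"
        using wx by (simp add: mult.assoc ennreal_mult[symmetric])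
    qed
    also have "\<dots> \<le> ennreal C2 * (\<integral>\<^sup>+x. ennpow (f x / ennreal (\<sigma> x)) p * ennreal (\<sigma> x) \<partial>M)"
      unfolding S_def using pf \<sigma>pos by (intro C2) (auto elim: eventually_mono)
    \<comment> \<open>\<open>\<sigma> powr (1 - p) = w\<close>, which turns the dual weight back
      into the original one.\<close>
    also have "(\<integral>\<^sup>+x. ennpow (f x / ennreal (\<sigma> x)) p * ennreal (\<sigma> x) \<partial>M)
       = (\<integral>\<^sup>+x. ennpow (f x) p * ennreal (w x) \<partial>M)"
    proof (rule nn_integral_cong)
      fix x assume "x \<in> space M"
      then have wx: "0 < w x" and sx: "0 < \<sigma> x" by (auto intro: wpos \<sigma>pos)
      have "ennpow (f x / ennreal (\<sigma> x)) p = ennpow (f x) p * ennreal (\<sigma> x powr (- p))"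
        using sx by (simp add: divide_ennreal_def inverse_ennreal ennpow_mult ennpow_ennreal powr_minus powr_divide inverse_eq_divide)
      moreover have "\<sigma> x powr (- p) * \<sigma> x = \<sigma> x powr (1 - p)"
        using sx by (simp add: powr_diff powr_minus field_simps)
      moreover have "\<sigma> x powr (1 - p) = w x"
      proof -
        have "- 1 / (p - 1) * (1 - p) = 1" using p by (simp add: field_simps)
        then show ?thesis using wx unfolding \<sigma>_def powr_powr by simp
      qed
      ultimately show "ennpow (f x / ennreal (\<sigma> x)) p * ennreal (\<sigma> x) = ennpow (f x) p * ennreal (w x)"
        using sx by (simp add: mult.assoc ennreal_mult[symmetric])
    qed
    finally show ?thesis using C1 C2 K
      by (simp add: ennreal_mult mult.assoc mult_left_mono)
  qed
  with C1(1) C2(1) K that[of "K powr p' * C1 * C2"] show ?thesis by simp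
qed

section \<open>Operations on $A_p$ weights and the Rubio de Francia iteration\<close>

lemma E_one: "AE x in M. E n (\<lambda>x. 1) x = 1"
  using E_F_meas[of "\<lambda>_. 1" n] by auto

text \<open>Conditional Jensen inequality, as \<open>E_holder\<close> with second function 1. The
  exponent \<theta> is the quotient of the exponents of the two dual weights; raising to the power
  \<open>p - 1\<close> turns it into \<open>q - 1\<close>, so the constant is preserved.\<close>

lemma Ap_mono:
  assumes w: "Ap q K w" and q: "1 < q" "q < p"
  shows "Ap p K w"
  unfolding Ap_def
proof (intro conjI allI ballI)
  note [measurable] = ApD(1)[OF w]
  show "w \<in> borel_measurable M" by measurable
  show "0 < w x" if "x \<in> space M" for x using ApD(2)[OF w that] .
  fix n
  define \<theta> where "\<theta> = (q - 1) / (p - 1)"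
  have \<theta>: "0 < \<theta>" "\<theta> < 1" using q by (auto simp: \<theta>_def)
  have eq: "w x powr (- 1 / (p - 1)) = (w x powr (- 1 / (q - 1))) powr \<theta> * 1 powr (1 - \<theta>)" for x
    using q by (simp add: powr_powr \<theta>_def)
  have "AE x in M. E n (\<lambda>x. ennreal ((w x powr (- 1 / (q - 1))) powr \<theta> * 1 powr (1 - \<theta>))) x
     \<le> ennpow (E n (\<lambda>x. ennreal (w x powr (- 1 / (q - 1)))) x) \<theta> * ennpow (E n (\<lambda>x. ennreal 1) x) (1 - \<theta>)"
  proof (rule E_holder)
    show "AE x in M. E n (\<lambda>x. ennreal (w x powr (- 1 / (q - 1)))) x < \<top>"
      using Ap_pos_finite[OF w, of n] by eventually_elim simp
    show "AE x in M. E n (\<lambda>x. ennreal 1) x < \<top>" using E_one[of n] by eventually_elim simp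
    show "0 < w x powr (- 1 / (q - 1))" if "x \<in> space M" for x using ApD(2)[OF w that] by simp
  qed (use \<theta> in auto)
  then show "AE x in M. E n (\<lambda>x. ennreal (w x)) x *
        ennpow (E n (\<lambda>x. ennreal (w x powr (- 1 / (p - 1)))) x) (p - 1) \<le> ennreal K"
    using E_one[of n] ApD(3)[OF w, of n]
  proof eventually_elim
    case (elim x)
    have "ennpow (E n (\<lambda>x. ennreal (w x powr (- 1 / (p - 1)))) x) (p - 1)
       \<le> ennpow (ennpow (E n (\<lambda>x. ennreal (w x powr (- 1 / (q - 1)))) x) \<theta>) (p - 1)"
      using elim(1,2) q unfolding eq by (intro ennpow_mono) auto
    also have "\<dots> = ennpow (E n (\<lambda>x. ennreal (w x powr (- 1 / (q - 1)))) x) (q - 1)"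
      using q by (simp add: ennpow_ennpow \<theta>_def)
    finally show ?case using elim(3) by (meson mult_left_mono order_trans zero_le)
  qed
qed

text \<open>\<open>E_neg_powr_le\<close> with the exponent 1 / (p - 1) bounds the dual average; its
  power \<open>p - 1\<close> is then at most \<open>K\<close> divided by the average of
  \<open>w\<close>.\<close>

lemma Ap_of_A1:
  assumes [measurable]: "w \<in> borel_measurable M" and wpos: "\<And>x. x \<in> space M \<Longrightarrow> 0 < w x"
    and K: "0 < K" and A1: "\<And>n. AE x in M. E n (\<lambda>x. ennreal (w x)) x \<le> ennreal (K * w x)" and p: "1 < p"
  shows "Ap p K w"
  unfolding Ap_def
proof (intro conjI allI ballI)
  fix n
  define e where "e = 1 / (p - 1)"
  have e: "0 < e" "e * (p - 1) = 1" using p by (auto simp: e_def)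
  have "AE x in M. E n (\<lambda>x. ennreal (w x powr (- e) * 1)) x
    \<le> ennreal (K powr e * enn2real (E n (\<lambda>x. ennreal (w x)) x) powr (- e)) * E n (\<lambda>x. ennreal 1) x"
    using e K wpos A1 by (intro E_neg_powr_le) auto
  moreover have "AE x in M. 0 < E n (\<lambda>x. ennreal (w x)) x" using wpos by (auto intro!: E_pos)
  ultimately show "AE x in M. E n (\<lambda>x. ennreal (w x)) x *
        ennpow (E n (\<lambda>x. ennreal (w x powr (- 1 / (p - 1)))) x) (p - 1) \<le> ennreal K"
    using E_one[of n] A1[of n]
  proof eventually_elim
    case (elim x)
    define a where "a = enn2real (E n (\<lambda>x. ennreal (w x)) x)"
    have "E n (\<lambda>x. ennreal (w x)) x < \<top>" using elim(4) by (auto simp: less_top[symmetric] top_unique)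
    then have a: "0 < a" "E n (\<lambda>x. ennreal (w x)) x = ennreal a"
      using elim by (auto simp: a_def enn2real_positive_iff)
    have "ennpow (E n (\<lambda>x. ennreal (w x powr (- 1 / (p - 1)))) x) (p - 1)
       \<le> ennpow (ennreal (K powr e * a powr (- e))) (p - 1)"
      using elim(1,3) p by (intro ennpow_mono[of "p - 1"]) (auto simp: a_def e_def)
    also have "\<dots> = ennreal (K * (1 / a))"
      using K a e by (simp add: ennpow_ennreal powr_mult powr_divide powr_powr powr_minus inverse_eq_divide)
    finally have "ennreal a * ennpow (E n (\<lambda>x. ennreal (w x powr (- 1 / (p - 1)))) x) (p - 1) \<le> ennreal a * ennreal (K * (1 / a))"
      by (rule mult_left_mono) simp
    also have "\<dots> = ennreal K" using a K by (simp add: ennreal_mult[symmetric])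
    finally show ?case by (simp add: a)
  qed
qed (use wpos in auto)

text \<open>Raising the weight condition to the power 1 / (p - 1) exchanges its two factors, because
  dualising twice gives back \<open>w\<close>.\<close>

lemma Ap_dual:
  assumes w: "Ap p K w" and p: "1 < p" and K: "0 < K"
  shows "Ap (p / (p - 1)) (K powr (1 / (p - 1))) (\<lambda>x. w x powr (- 1 / (p - 1)))"
  unfolding Ap_def
proof (intro conjI allI ballI)
  note [measurable] = ApD(1)[OF w]
  show "(\<lambda>x. w x powr (- 1 / (p - 1))) \<in> borel_measurable M" by measurable
  show "0 < w x powr (- 1 / (p - 1))" if "x \<in> space M" for x using ApD(2)[OF w that] by simp
  fix n
  have p': "p / (p - 1) - 1 = 1 / (p - 1)" using p by (simp add: field_simps)
  have "AE x in M. E n (\<lambda>x. ennreal ((w x powr (- 1 / (p - 1))) powr (- 1 / (p / (p - 1) - 1)))) x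
     = E n (\<lambda>x. ennreal (w x)) x"
  proof (intro E_cong AE_I2)
    fix x assume "x \<in> space M"
    moreover have "- 1 / (p - 1) * (- 1 / (p / (p - 1) - 1)) = 1" unfolding p' using p by (simp add: field_simps)
    ultimately show "ennreal ((w x powr (- 1 / (p - 1))) powr (- 1 / (p / (p - 1) - 1))) = ennreal (w x)"
      using ApD(2)[OF w, of x] by (simp only: powr_powr) simp
  qed auto
  then show "AE x in M. E n (\<lambda>x. ennreal (w x powr (- 1 / (p - 1)))) x *
      ennpow (E n (\<lambda>x. ennreal ((w x powr (- 1 / (p - 1))) powr (- 1 / (p / (p - 1) - 1)))) x) (p / (p - 1) - 1)
      \<le> ennreal (K powr (1 / (p - 1)))"
    using ApD(3)[OF w, of n]
  proof eventually_elim
    case (elim x)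
    let ?a = "E n (\<lambda>x. ennreal (w x)) x" and ?b = "E n (\<lambda>x. ennreal (w x powr (- 1 / (p - 1)))) x"
    have "ennpow (?a * ennpow ?b (p - 1)) (1 / (p - 1)) \<le> ennpow (ennreal K) (1 / (p - 1))"
      using elim p by (intro ennpow_mono) auto
    then have "?b * ennpow ?a (1 / (p - 1)) \<le> ennreal (K powr (1 / (p - 1)))"
      using p K by (simp add: ennpow_mult ennpow_ennpow ennpow_ennreal mult.commute)
    then show ?case by (simp only: p' elim(1)[unfolded p'])
  qed
qed

text \<open>Moves a weight from the class of \<open>p\<close> to the class of \<open>r\<close>,
  where the diagonal estimate lives. In the first average the negative power of \<open>H\<close> is
  pulled out by the A_1 bound; in the second, conditional Hoelder with the exponent \<theta>
  separates \<open>H\<close> from the dual weight. The two resulting powers of the conditional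
  expectation of \<open>H\<close> cancel.\<close>

lemma Ap_factor:
  assumes w: "Ap p K w" and p: "1 < p" "p < r" and K: "0 < K"
    and [measurable]: "H \<in> borel_measurable M" and Hpos: "\<And>x. x \<in> space M \<Longrightarrow> 0 < H x"
    and B: "0 < B" and HB: "\<And>n. AE x in M. E n (\<lambda>x. ennreal (H x)) x \<le> ennreal (B * H x)"
  shows "Ap r (B powr (r - p) * K) (\<lambda>x. H x powr (p - r) * w x)"
  unfolding Ap_def
proof (intro conjI allI ballI)
  note [measurable] = ApD(1)[OF w]
  show "(\<lambda>x. H x powr (p - r) * w x) \<in> borel_measurable M" by measurable
  show "0 < H x powr (p - r) * w x" if "x \<in> space M" for x using ApD(2)[OF w that] Hpos[OF that] by simp
  fix n
  define \<theta> where "\<theta> = (r - p) / (r - 1)"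
  have \<theta>: "0 < \<theta>" "\<theta> < 1" "\<theta> * (r - 1) = r - p" "(1 - \<theta>) * (r - 1) = p - 1"
    using p by (auto simp: \<theta>_def field_simps)
  have \<theta>': "1 - \<theta> = (p - 1) / (r - 1)" using p by (auto simp: \<theta>_def field_simps)
  let ?\<sigma> = "\<lambda>x. w x powr (- 1 / (p - 1))"
  let ?u = "\<lambda>x. H x powr (p - r) * w x"
  have 1: "AE x in M. E n (\<lambda>x. ennreal (H x powr (- (r - p)) * w x)) x
    \<le> ennreal (B powr (r - p) * enn2real (E n (\<lambda>x. ennreal (H x)) x) powr (- (r - p))) * E n (\<lambda>x. ennreal (w x)) x"
    using p B HB Hpos ApD(2)[OF w] by (intro E_neg_powr_le) (auto intro: less_imp_le)
  have HF: "AE x in M. E n (\<lambda>x. ennreal (H x)) x < \<top>"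
    using HB[of n] by eventually_elim (auto simp: less_top[symmetric] top_unique)
  have Hp: "AE x in M. 0 < E n (\<lambda>x. ennreal (H x)) x" using Hpos by (auto intro!: E_pos)
  have 2: "AE x in M. E n (\<lambda>x. ennreal (H x powr \<theta> * ?\<sigma> x powr (1 - \<theta>))) x
     \<le> ennpow (E n (\<lambda>x. ennreal (H x)) x) \<theta> * ennpow (E n (\<lambda>x. ennreal (?\<sigma> x)) x) (1 - \<theta>)"
  proof (rule E_holder)
    show "AE x in M. E n (\<lambda>x. ennreal (?\<sigma> x)) x < \<top>"
      using Ap_pos_finite[OF w, of n] by eventually_elim simp
    show "0 < ?\<sigma> x" if "x \<in> space M" for x using ApD(2)[OF w that] by simp
  qed (use \<theta> HF Hpos in auto)
  have 3: "AE x in M. E n (\<lambda>x. ennreal (?u x powr (- 1 / (r - 1)))) x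
      = E n (\<lambda>x. ennreal (H x powr \<theta> * ?\<sigma> x powr (1 - \<theta>))) x"
  proof (intro E_cong AE_I2)
    fix x assume "x \<in> space M"
    then have "0 < H x" "0 < w x" using Hpos ApD(2)[OF w] by auto
    moreover have "- 1 / (r - 1) = - 1 / (p - 1) * (1 - \<theta>)" unfolding \<theta>' using p by simp
    moreover have "(p - r) * (- 1 / (r - 1)) = \<theta>" unfolding \<theta>_def using p by (simp add: field_simps)
    ultimately have "?u x powr (- 1 / (r - 1)) = H x powr \<theta> * ?\<sigma> x powr (1 - \<theta>)"
      by (simp only: powr_mult powr_powr)
    then show "ennreal (?u x powr (- 1 / (r - 1))) = ennreal (H x powr \<theta> * ?\<sigma> x powr (1 - \<theta>))" by simp
  qed auto
  show "AE x in M. E n (\<lambda>x. ennreal (?u x)) x * ennpow (E n (\<lambda>x. ennreal (?u x powr (- 1 / (r - 1)))) x) (r - 1)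
     \<le> ennreal (B powr (r - p) * K)"
    using 1 2 3 HF Hp ApD(3)[OF w, of n]
  proof eventually_elim
    case (elim x)
    define h where "h = enn2real (E n (\<lambda>x. ennreal (H x)) x)"
    have h: "0 < h" "E n (\<lambda>x. ennreal (H x)) x = ennreal h"
      using elim by (auto simp: h_def enn2real_positive_iff)
    let ?w = "E n (\<lambda>x. ennreal (w x)) x" and ?s = "E n (\<lambda>x. ennreal (?\<sigma> x)) x"
    have u: "E n (\<lambda>x. ennreal (?u x)) x \<le> ennreal (B powr (r - p) * h powr (p - r)) * ?w"
      using elim(1) by (simp add: h_def)
    have "ennpow (E n (\<lambda>x. ennreal (?u x powr (- 1 / (r - 1)))) x) (r - 1)
        \<le> ennpow (ennpow (ennreal h) \<theta> * ennpow ?s (1 - \<theta>)) (r - 1)"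
      unfolding elim(3) using elim(2) p h by (intro ennpow_mono) auto
    also have "\<dots> = ennreal (h powr (r - p)) * ennpow ?s (p - 1)"
      using h \<theta> by (simp add: ennpow_mult ennpow_ennpow ennpow_ennreal powr_powr)
    finally have "E n (\<lambda>x. ennreal (?u x)) x * ennpow (E n (\<lambda>x. ennreal (?u x powr (- 1 / (r - 1)))) x) (r - 1)
      \<le> (ennreal (B powr (r - p) * h powr (p - r)) * ?w) * (ennreal (h powr (r - p)) * ennpow ?s (p - 1))"
      using u by (intro mult_mono) auto
    also have "\<dots> = ennreal (B powr (r - p) * h powr (p - r)) * ennreal (h powr (r - p)) * (?w * ennpow ?s (p - 1))"
      by (simp only: mult.assoc mult.left_commute[of ?w])
    also have "ennreal (B powr (r - p) * h powr (p - r)) * ennreal (h powr (r - p)) = ennreal (B powr (r - p))"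
    proof -
      have "h powr (p - r) * h powr (r - p) = 1" using h by (simp flip: powr_add)
      then show ?thesis by (simp add: ennreal_mult[symmetric] mult.assoc)
    qed
    also have "ennreal (B powr (r - p)) * (?w * ennpow ?s (p - 1)) \<le> ennreal (B powr (r - p)) * ennreal K"
      using elim by (intro mult_left_mono) auto
    also have "\<dots> = ennreal (B powr (r - p) * K)" using K by (simp add: ennreal_mult)
    finally show ?case .
  qed
qed

text \<open>\<open>H\<close> is the sum of the iterates \<open>(Mx ^^ k) h / (2 * b) ^ k\<close>. Bounding it by twice the supremum of
  \<open>(Mx ^^ k) h / b ^ k\<close> avoids the Minkowski inequality.\<close>

lemma rubio_de_francia:
  assumes s: "0 < s" and D: "0 < D"
  obtains B D' where "0 < B" "0 < D'" "\<And>v h. v \<in> borel_measurable M \<Longrightarrow> (\<And>x. x \<in> space M \<Longrightarrow> 0 < v x) \<Longrightarrow>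
    (\<And>f. f \<in> borel_measurable M \<Longrightarrow> (\<integral>\<^sup>+x. ennpow (Mx f x) s * ennreal (v x) \<partial>M)
        \<le> ennreal D * (\<integral>\<^sup>+x. ennpow (f x) s * ennreal (v x) \<partial>M)) \<Longrightarrow>
    h \<in> borel_measurable M \<Longrightarrow> (\<And>x. x \<in> space M \<Longrightarrow> 0 < h x) \<Longrightarrow>
    (\<integral>\<^sup>+x. ennpow (h x) s * ennreal (v x) \<partial>M) < \<top> \<Longrightarrow>
    \<exists>H. H \<in> borel_measurable M \<and> (\<forall>x\<in>space M. 0 < H x) \<and> (AE x in M. h x \<le> ennreal (H x)) \<and>
      (\<forall>n. AE x in M. E n (\<lambda>x. ennreal (H x)) x \<le> ennreal (B * H x)) \<and>
      (\<integral>\<^sup>+x. ennreal (H x powr s * v x) \<partial>M) \<le> ennreal D' * (\<integral>\<^sup>+x. ennpow (h x) s * ennreal (v x) \<partial>M)"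
proof -
  \<comment> \<open>\<open>b powr s = 2 * D\<close> makes the weighted integral of the s-th power of
    \<open>T k / b ^ k\<close> decay like 2^(-k).\<close>
  define b where "b = (2 * D) powr (1 / s)"
  have b: "0 < b" "b powr s = 2 * D" using s D by (auto simp: b_def powr_powr)
  \<comment> \<open>\<open>2 powr s\<close> is the cost of passing from the series to
    \<open>Z\<close>, the other 2 is the sum of the geometric series in \<open>ZI\<close>.\<close>
  define D' where "D' = 2 powr s * 2"
  have D': "0 < D'" by (simp add: D'_def)
  have "\<exists>H. H \<in> borel_measurable M \<and> (\<forall>x\<in>space M. 0 < H x) \<and> (AE x in M. h x \<le> ennreal (H x)) \<and>
      (\<forall>n. AE x in M. E n (\<lambda>x. ennreal (H x)) x \<le> ennreal (2 * b * H x)) \<and>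
      (\<integral>\<^sup>+x. ennreal (H x powr s * v x) \<partial>M) \<le> ennreal D' * (\<integral>\<^sup>+x. ennpow (h x) s * ennreal (v x) \<partial>M)"
    if [measurable]: "v \<in> borel_measurable M" and v: "\<And>x. x \<in> space M \<Longrightarrow> 0 < v x"
      and bd: "\<And>f. f \<in> borel_measurable M \<Longrightarrow> (\<integral>\<^sup>+x. ennpow (Mx f x) s * ennreal (v x) \<partial>M)
        \<le> ennreal D * (\<integral>\<^sup>+x. ennpow (f x) s * ennreal (v x) \<partial>M)"
      and [measurable]: "h \<in> borel_measurable M" and h: "\<And>x. x \<in> space M \<Longrightarrow> 0 < h x"
      and I: "(\<integral>\<^sup>+x. ennpow (h x) s * ennreal (v x) \<partial>M) < \<top>" for v h
  proof -
    define T where "T k = (Mx ^^ k) h" for k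
    have T0: "T 0 = h" and TS: "T (Suc k) = Mx (T k)" for k by (auto simp: T_def)
    have T [measurable]: "T k \<in> borel_measurable M" for k by (cases k) (auto simp: T0 TS)
    define I where "I = (\<integral>\<^sup>+x. ennpow (h x) s * ennreal (v x) \<partial>M)"
    have TI: "(\<integral>\<^sup>+x. ennpow (T k x) s * ennreal (v x) \<partial>M) \<le> ennreal (D ^ k) * I" for k
    proof (induction k)
      case 0 then show ?case by (simp add: T0 I_def)
    next
      case (Suc k)
      have "(\<integral>\<^sup>+x. ennpow (T (Suc k) x) s * ennreal (v x) \<partial>M)
        \<le> ennreal D * (\<integral>\<^sup>+x. ennpow (T k x) s * ennreal (v x) \<partial>M)" unfolding TS by (rule bd) simp
      also have "\<dots> \<le> ennreal D * (ennreal (D ^ k) * I)" by (intro mult_left_mono Suc) simp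
      finally show ?case using D by (simp add: ennreal_mult mult.assoc)
    qed
    define H0 where "H0 x = (\<Sum>k. ennreal ((1 / (2 * b)) ^ k) * T k x)" for x
    define Z where "Z x = (\<Sum>k. ennpow (ennreal ((1 / b) ^ k) * T k x) s)" for x
    have [measurable]: "H0 \<in> borel_measurable M" "Z \<in> borel_measurable M" unfolding H0_def Z_def by measurable
    have hH0: "h x \<le> H0 x" for x
      using le_suminf_ennreal[of "\<lambda>k. ennreal ((1 / (2 * b)) ^ k) * T k x" 0] by (simp add: H0_def T0)
    have geo: "(\<Sum>k. ennreal ((1 / 2) ^ k)) = 2"
    proof -
      have "(\<lambda>k. (1 / 2 :: real) ^ k) sums 2" using geometric_sums[of "1 / 2 :: real"] by simp
      then have "(\<Sum>k. ennreal ((1 / 2) ^ k)) = ennreal 2" by (intro suminf_ennreal_eq) auto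
      then show ?thesis by simp
    qed
    have H0Z: "ennpow (H0 x) s \<le> ennreal (2 powr s) * Z x" for x
    proof -
      have "ennreal ((1 / b) ^ k) * T k x \<le> ennpow (Z x) (1 / s)" for k
      proof -
        have "ennpow (ennreal ((1 / b) ^ k) * T k x) s \<le> Z x" unfolding Z_def by (rule le_suminf_ennreal)
        then have "ennpow (ennpow (ennreal ((1 / b) ^ k) * T k x) s) (1 / s) \<le> ennpow (Z x) (1 / s)"
          using s by (intro ennpow_mono[of "1 / s"]) auto
        then show ?thesis using s by (simp add: ennpow_ennpow)
      qed
      then have "H0 x \<le> (\<Sum>k. ennreal ((1 / 2) ^ k) * ennpow (Z x) (1 / s))"
        unfolding H0_def
      proof (intro suminf_le)
        fix k
        assume *: "\<And>k. ennreal ((1 / b) ^ k) * T k x \<le> ennpow (Z x) (1 / s)"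
        have "(1 / (2 * b)) ^ k = (1 / 2) ^ k * (1 / b) ^ k" by (simp add: power_mult_distrib[symmetric])
        then have "ennreal ((1 / (2 * b)) ^ k) = ennreal ((1 / 2) ^ k) * ennreal ((1 / b) ^ k)"
          using b(1) ennreal_mult[of "(1 / 2) ^ k" "(1 / b) ^ k"] by simp
        then have "ennreal ((1 / (2 * b)) ^ k) * T k x = ennreal ((1 / 2) ^ k) * (ennreal ((1 / b) ^ k) * T k x)"
          by (simp only: mult.assoc)
        also have "\<dots> \<le> ennreal ((1 / 2) ^ k) * ennpow (Z x) (1 / s)" by (intro mult_left_mono *) simp
        finally show "ennreal ((1 / (2 * b)) ^ k) * T k x \<le> ennreal ((1 / 2) ^ k) * ennpow (Z x) (1 / s)" .
      qed auto
      also have "\<dots> = ennreal 2 * ennpow (Z x) (1 / s)" unfolding ennreal_suminf_multc geo by simp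
      finally have "ennpow (H0 x) s \<le> ennpow (ennreal 2 * ennpow (Z x) (1 / s)) s" using s by (intro ennpow_mono) auto
      also have "\<dots> = ennreal (2 powr s) * Z x" unfolding ennpow_mult using s by (simp add: ennpow_ennpow) (simp add: ennpow_def)
      finally show ?thesis .
    qed
    have "(\<integral>\<^sup>+x. Z x * ennreal (v x) \<partial>M) = (\<integral>\<^sup>+x. (\<Sum>k. ennpow (ennreal ((1 / b) ^ k) * T k x) s * ennreal (v x)) \<partial>M)"
      by (simp add: Z_def)
    also have "\<dots> = (\<Sum>k. \<integral>\<^sup>+x. ennpow (ennreal ((1 / b) ^ k) * T k x) s * ennreal (v x) \<partial>M)"
      by (rule nn_integral_suminf) measurable
    also have "\<dots> \<le> (\<Sum>k. ennreal ((1 / 2) ^ k) * I)"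
    proof (intro suminf_le)
      fix k
      have pw: "((1 / b) ^ k) powr s = (1 / (2 * D)) ^ k"
        using b D by (simp add: powr_divide power_divide powr_power[symmetric] flip: b(2)) (simp add: powr_powr powr_realpow[symmetric] mult.commute)
      have "(\<integral>\<^sup>+x. ennpow (ennreal ((1 / b) ^ k) * T k x) s * ennreal (v x) \<partial>M)
        = (\<integral>\<^sup>+x. ennreal ((1 / (2 * D)) ^ k) * (ennpow (T k x) s * ennreal (v x)) \<partial>M)"
        using b by (intro nn_integral_cong) (simp add: ennpow_mult ennpow_ennreal pw mult.assoc del: power_one_over)
      also have "\<dots> = ennreal ((1 / (2 * D)) ^ k) * (\<integral>\<^sup>+x. ennpow (T k x) s * ennreal (v x) \<partial>M)"
        by (rule nn_integral_cmult) measurable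
      also have "\<dots> \<le> ennreal ((1 / (2 * D)) ^ k) * (ennreal (D ^ k) * I)"
        by (intro mult_left_mono TI) simp
      also have "\<dots> = ennreal ((1 / (2 * D)) ^ k * D ^ k) * I" using D by (simp add: ennreal_mult mult.assoc)
      also have "(1 / (2 * D)) ^ k * D ^ k = (1 / 2) ^ k" using D by (simp flip: power_mult_distrib)
      finally show "(\<integral>\<^sup>+x. ennpow (ennreal ((1 / b) ^ k) * T k x) s * ennreal (v x) \<partial>M) \<le> ennreal ((1 / 2) ^ k) * I" .
    qed auto
    also have "\<dots> = 2 * I" unfolding ennreal_suminf_multc geo by simp
    finally have ZI: "(\<integral>\<^sup>+x. Z x * ennreal (v x) \<partial>M) \<le> 2 * I" .
    have "(\<integral>\<^sup>+x. ennpow (H0 x) s * ennreal (v x) \<partial>M) \<le> (\<integral>\<^sup>+x. ennreal (2 powr s) * (Z x * ennreal (v x)) \<partial>M)"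
      unfolding mult.assoc[symmetric] by (intro nn_integral_mono mult_right_mono H0Z) simp
    also have "\<dots> = ennreal (2 powr s) * (\<integral>\<^sup>+x. Z x * ennreal (v x) \<partial>M)" by (rule nn_integral_cmult) measurable
    also have "\<dots> \<le> ennreal (2 powr s) * (2 * I)" by (intro mult_left_mono ZI) simp
    also have "\<dots> = ennreal D' * I" by (simp add: D'_def ennreal_mult mult.assoc)
    finally have H0I: "(\<integral>\<^sup>+x. ennpow (H0 x) s * ennreal (v x) \<partial>M) \<le> ennreal D' * I" .
    then have "(\<integral>\<^sup>+x. ennpow (H0 x) s * ennreal (v x) \<partial>M) \<noteq> \<infinity>"
      using I by (auto simp: I_def top_unique ennreal_mult_eq_top_iff)
    then have "AE x in M. ennpow (H0 x) s * ennreal (v x) \<noteq> \<infinity>" by (intro nn_integral_PInf_AE) measurable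
    then have fin: "AE x in M. H0 x < \<top>" using AE_space
    proof eventually_elim
      case (elim x)
      then show ?case using v[of x] by (auto simp: ennreal_mult_eq_top_iff less_top[symmetric])
    qed
    have EH0: "AE x in M. E n H0 x \<le> ennreal (2 * b) * H0 x" for n
    proof -
      have "AE x in M. (\<Sum>k. E n (\<lambda>x. ennreal ((1 / (2 * b)) ^ k) * T k x) x) = E n H0 x"
        unfolding H0_def by (rule E_suminf) measurable
      moreover have "AE x in M. \<forall>k. ennreal ((1 / (2 * b)) ^ k) * E n (T k) x = E n (\<lambda>x. ennreal ((1 / (2 * b)) ^ k) * T k x) x"
        unfolding AE_all_countable by (intro allI E_cmult) measurable
      ultimately show ?thesis
      proof eventually_elim
        case (elim x)
        have "E n H0 x = (\<Sum>k. ennreal ((1 / (2 * b)) ^ k) * E n (T k) x)" using elim by simp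
        \<comment> \<open>\<open>E n (T k) \<le> T (Suc k)\<close>, and the coefficient of
          \<open>T k\<close> is \<open>2 * b\<close> times that of \<open>T (Suc k)\<close>: taking
          \<open>E n\<close> only shifts the series by one term.\<close>
        also have "\<dots> \<le> (\<Sum>k. ennreal (2 * b) * (ennreal ((1 / (2 * b)) ^ Suc k) * T (Suc k) x))"
        proof (intro suminf_le)
          fix k
          have "2 * b * (1 / (2 * b)) ^ Suc k = (1 / (2 * b)) ^ k" using b by simp
          then have "ennreal (2 * b) * (ennreal ((1 / (2 * b)) ^ Suc k) * T (Suc k) x) = ennreal ((1 / (2 * b)) ^ k) * T (Suc k) x"
            using b by (simp add: ennreal_mult[symmetric] mult.assoc[symmetric] del: power_Suc)
          then show "ennreal ((1 / (2 * b)) ^ k) * E n (T k) x \<le> ennreal (2 * b) * (ennreal ((1 / (2 * b)) ^ Suc k) * T (Suc k) x)"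
            using E_le_Mx[of n "T k" x] by (simp add: TS mult_left_mono del: power_Suc)
        qed auto
        also have "\<dots> = ennreal (2 * b) * (\<Sum>k. ennreal ((1 / (2 * b)) ^ Suc k) * T (Suc k) x)" by simp
        also have "\<dots> \<le> ennreal (2 * b) * H0 x"
          unfolding H0_def
          by (subst suminf_offset[of "\<lambda>k. ennreal ((1 / (2 * b)) ^ k) * T k x" 1])
             (auto intro!: mult_left_mono simp: add_increasing)
        finally show ?case .
      qed
    qed
    \<comment> \<open>The value 1 on the null set where \<open>H0\<close> is infinite keeps
      \<open>H\<close> real and strictly positive everywhere.\<close>
    define H where "H x = (if H0 x = \<top> then 1 else enn2real (H0 x))" for x
    have [measurable]: "H \<in> borel_measurable M" unfolding H_def by measurable
    have Hpos: "0 < H x" if "x \<in> space M" for x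
      using h[OF that] hH0[of x] by (auto simp: H_def enn2real_positive_iff less_top intro: less_le_trans)
    have eq: "AE x in M. ennreal (H x) = H0 x" using fin by eventually_elim (auto simp: H_def)
    have "AE x in M. h x \<le> ennreal (H x)" using eq by eventually_elim (simp add: hH0)
    moreover have "AE x in M. E n (\<lambda>x. ennreal (H x)) x \<le> ennreal (2 * b * H x)" for n
    proof -
      have "AE x in M. E n (\<lambda>x. ennreal (H x)) x = E n H0 x" by (rule E_cong[OF eq]) auto
      then show ?thesis using EH0[of n] eq AE_space
      proof eventually_elim
        case (elim x)
        then show ?case using Hpos[of x] b by (simp add: ennreal_mult)
      qed
    qed
    moreover have "(\<integral>\<^sup>+x. ennreal (H x powr s * v x) \<partial>M) = (\<integral>\<^sup>+x. ennpow (H0 x) s * ennreal (v x) \<partial>M)"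
    proof (rule nn_integral_cong_AE)
      show "AE x in M. ennreal (H x powr s * v x) = ennpow (H0 x) s * ennreal (v x)"
        using eq AE_space
      proof eventually_elim
        case (elim x)
        then have "ennpow (H0 x) s = ennreal (H x powr s)"
          using Hpos[of x] by (simp add: ennpow_ennreal flip: elim(1))
        then show ?case using v[of x] elim by (simp add: ennreal_mult)
      qed
    qed
    ultimately show ?thesis using Hpos H0I by (intro exI[of _ H]) (auto simp: I_def)
  qed
  then show ?thesis using b D' by (intro that[of "2 * b" D']) auto
qed

end

section \<open>Extrapolation to the vector-valued maximal inequality\<close>

definition lr_norm :: "real \<Rightarrow> (nat \<Rightarrow> 'a \<Rightarrow> ennreal) \<Rightarrow> 'a \<Rightarrow> ennreal" where
  "lr_norm r f x = ennpow (\<Sum>j. ennpow (f j x) r) (1 / r)"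

lemma borel_measurable_lr_norm [measurable (raw)]:
  assumes [measurable]: "\<And>j. f j \<in> borel_measurable N"
  shows "lr_norm r f \<in> borel_measurable N"
  unfolding lr_norm_def by measurable

lemma ennpow_lr: "r \<noteq> 0 \<Longrightarrow> ennpow (lr_norm r f x) r = (\<Sum>j. ennpow (f j x) r)"
  by (simp add: lr_norm_def ennpow_ennpow)

lemma ennpow_max_le: "0 \<le> p \<Longrightarrow> ennpow (max a b) p \<le> ennpow a p + ennpow b p"
  by (cases "a \<le> b") (auto simp: max_def add_increasing add_increasing2)

text \<open>Lets \<open>e\<close> tend to 0; this removes the floor \<open>e\<close> that the
  extrapolation arguments put under their starting functions.\<close>

lemma ennreal_le_limit:
  assumes C: "0 < C" and p: "0 < p" and W: "W < \<top>"
    and le: "\<And>e::real. 0 < e \<Longrightarrow> X \<le> ennreal C * (A + ennreal (e powr p) * W)"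
  shows "X \<le> ennreal C * A"
proof (rule ennreal_le_epsilon)
  fix e :: real assume e: "0 < e"
  obtain \<omega> where \<omega>: "0 \<le> \<omega>" "W = ennreal \<omega>" using W by (cases W) auto
  \<comment> \<open>Makes the error \<open>C * q * \<omega>\<close> at most \<open>e\<close>; the
    summand 1 guards against \<open>\<omega> = 0\<close>.\<close>
  define q where "q = e / (C * (\<omega> + 1))"
  have q: "0 < q" unfolding q_def using e C \<omega> by (intro divide_pos_pos mult_pos_pos) auto
  define d where "d = q powr (1 / p)"
  have d: "0 < d" "d powr p = q" using q p by (auto simp: d_def powr_powr)
  have "C * (d powr p * \<omega>) = e * (\<omega> / (\<omega> + 1))" unfolding d q_def using C by simp
  also have "\<dots> \<le> e * 1" using e \<omega> by (intro mult_left_mono) auto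
  finally have *: "C * (d powr p * \<omega>) \<le> e" by simp
  have "X \<le> ennreal C * A + ennreal (C * (d powr p * \<omega>))"
    using le[OF d(1)] C \<omega> by (simp add: distrib_left ennreal_mult[symmetric])
  also have "\<dots> \<le> ennreal C * A + ennreal e" using * by (intro add_left_mono ennreal_leI)
  finally show "X \<le> ennreal C * A + ennreal e" .
qed

context filtered_prob_space
begin

lemma vector_maximal_diagonal:
  assumes r: "1 < r" and K: "0 < K"
  obtains C where "0 < C" "\<And>w f. Ap r K w \<Longrightarrow> (\<And>j. f j \<in> borel_measurable M) \<Longrightarrow>
    (\<integral>\<^sup>+x. ennpow (lr_norm r (\<lambda>j. Mx (f j)) x) r * ennreal (w x) \<partial>M)
      \<le> ennreal C * (\<integral>\<^sup>+x. ennpow (lr_norm r f x) r * ennreal (w x) \<partial>M)"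
proof -
  obtain C where C: "0 < C" "\<And>w f. Ap r K w \<Longrightarrow> f \<in> borel_measurable M \<Longrightarrow>
    (\<integral>\<^sup>+x. ennpow (Mx f x) r * ennreal (w x) \<partial>M) \<le> ennreal C * (\<integral>\<^sup>+x. ennpow (f x) r * ennreal (w x) \<partial>M)"
    using Ap_maximal[OF r K] by blast
  have "(\<integral>\<^sup>+x. ennpow (lr_norm r (\<lambda>j. Mx (f j)) x) r * ennreal (w x) \<partial>M)
      \<le> ennreal C * (\<integral>\<^sup>+x. ennpow (lr_norm r f x) r * ennreal (w x) \<partial>M)"
    if w: "Ap r K w" and [measurable]: "\<And>j. f j \<in> borel_measurable M" for w f
  proof -
    note [measurable] = ApD(1)[OF w]
    have *: "(\<integral>\<^sup>+x. ennpow (lr_norm r g x) r * ennreal (w x) \<partial>M) = (\<Sum>j. \<integral>\<^sup>+x. ennpow (g j x) r * ennreal (w x) \<partial>M)"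
      if [measurable]: "\<And>j. g j \<in> borel_measurable M" for g
      using r by (subst nn_integral_suminf[symmetric]) (auto simp: ennpow_lr)
    have "(\<integral>\<^sup>+x. ennpow (lr_norm r (\<lambda>j. Mx (f j)) x) r * ennreal (w x) \<partial>M)
       = (\<Sum>j. \<integral>\<^sup>+x. ennpow (Mx (f j) x) r * ennreal (w x) \<partial>M)" by (rule *) measurable
    also have "\<dots> \<le> (\<Sum>j. ennreal C * (\<integral>\<^sup>+x. ennpow (f j x) r * ennreal (w x) \<partial>M))"
      by (intro suminf_le C w) auto
    also have "\<dots> = ennreal C * (\<integral>\<^sup>+x. ennpow (lr_norm r f x) r * ennreal (w x) \<partial>M)"
      by (subst *) auto
    finally show ?thesis .
  qed
  with C(1) that show ?thesis by blast
qed

text \<open>Let \<open>H\<close> be an A_1 majorant of the right-hand function and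
  \<open>u = H powr (p - r) * w\<close>, a weight for the diagonal case. As \<open>p - r\<close> is
  negative, the integrand on the left is at most \<open>ennpow (G x) r * ennreal (u x)\<close> where
  \<open>G\<close> exceeds \<open>H\<close>; elsewhere it is at most \<open>H powr p * w\<close>,
  whose integral the iteration controls.\<close>

lemma vector_maximal_below:
  assumes p: "1 < p" "p < r" and K: "0 < K"
  obtains C where "0 < C" "\<And>w f. Ap p K w \<Longrightarrow> (\<integral>\<^sup>+x. ennreal (w x) \<partial>M) < \<top> \<Longrightarrow>
    (\<And>j. f j \<in> borel_measurable M) \<Longrightarrow>
    (\<integral>\<^sup>+x. ennpow (lr_norm r (\<lambda>j. Mx (f j)) x) p * ennreal (w x) \<partial>M)
      \<le> ennreal C * (\<integral>\<^sup>+x. ennpow (lr_norm r f x) p * ennreal (w x) \<partial>M)"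
proof -
  obtain D where D: "0 < D" "\<And>w f. Ap p K w \<Longrightarrow> f \<in> borel_measurable M \<Longrightarrow>
    (\<integral>\<^sup>+x. ennpow (Mx f x) p * ennreal (w x) \<partial>M) \<le> ennreal D * (\<integral>\<^sup>+x. ennpow (f x) p * ennreal (w x) \<partial>M)"
    using Ap_maximal[OF p(1) K] by blast
  have p0: "0 < p" using p by simp
  obtain B D' where B: "0 < B" and D': "0 < D'" and RdF: "\<And>v h. v \<in> borel_measurable M \<Longrightarrow> (\<And>x. x \<in> space M \<Longrightarrow> 0 < v x) \<Longrightarrow>
    (\<And>f. f \<in> borel_measurable M \<Longrightarrow> (\<integral>\<^sup>+x. ennpow (Mx f x) p * ennreal (v x) \<partial>M)
        \<le> ennreal D * (\<integral>\<^sup>+x. ennpow (f x) p * ennreal (v x) \<partial>M)) \<Longrightarrow>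
    h \<in> borel_measurable M \<Longrightarrow> (\<And>x. x \<in> space M \<Longrightarrow> 0 < h x) \<Longrightarrow>
    (\<integral>\<^sup>+x. ennpow (h x) p * ennreal (v x) \<partial>M) < \<top> \<Longrightarrow>
    \<exists>H. H \<in> borel_measurable M \<and> (\<forall>x\<in>space M. 0 < H x) \<and> (AE x in M. h x \<le> ennreal (H x)) \<and>
      (\<forall>n. AE x in M. E n (\<lambda>x. ennreal (H x)) x \<le> ennreal (B * H x)) \<and>
      (\<integral>\<^sup>+x. ennreal (H x powr p * v x) \<partial>M) \<le> ennreal D' * (\<integral>\<^sup>+x. ennpow (h x) p * ennreal (v x) \<partial>M)"
    using rubio_de_francia[OF p0 D(1)] by blast
  define K' where "K' = B powr (r - p) * K"
  have r: "1 < r" and K': "0 < K'" using p B K by (auto simp: K'_def)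
  obtain C0 where C0: "0 < C0" "\<And>w f. Ap r K' w \<Longrightarrow> (\<And>j. f j \<in> borel_measurable M) \<Longrightarrow>
    (\<integral>\<^sup>+x. ennpow (lr_norm r (\<lambda>j. Mx (f j)) x) r * ennreal (w x) \<partial>M)
      \<le> ennreal C0 * (\<integral>\<^sup>+x. ennpow (lr_norm r f x) r * ennreal (w x) \<partial>M)"
    using vector_maximal_diagonal[OF r K'] by blast
  \<comment> \<open>\<open>C0\<close> pays for the region where \<open>G\<close> exceeds
    \<open>H\<close>, 1 for its complement, and \<open>D'\<close> for the majorant.\<close>
  define C where "C = (C0 + 1) * D'"
  have C: "0 < C" using C0 D' by (simp add: C_def)
  have "(\<integral>\<^sup>+x. ennpow (lr_norm r (\<lambda>j. Mx (f j)) x) p * ennreal (w x) \<partial>M)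
      \<le> ennreal C * (\<integral>\<^sup>+x. ennpow (lr_norm r f x) p * ennreal (w x) \<partial>M)"
    if w: "Ap p K w" and W: "(\<integral>\<^sup>+x. ennreal (w x) \<partial>M) < \<top>" and [measurable]: "\<And>j. f j \<in> borel_measurable M" for w f
  proof -
    note [measurable] = ApD(1)[OF w]
    note wpos = ApD(2)[OF w]
    define G where "G = lr_norm r (\<lambda>j. Mx (f j))"
    define L where "L = lr_norm r f"
    have [measurable]: "G \<in> borel_measurable M" "L \<in> borel_measurable M" unfolding G_def L_def by measurable
    define A where "A = (\<integral>\<^sup>+x. ennpow (L x) p * ennreal (w x) \<partial>M)"
    define W where "W = (\<integral>\<^sup>+x. ennreal (w x) \<partial>M)"
    have "(\<integral>\<^sup>+x. ennpow (G x) p * ennreal (w x) \<partial>M) \<le> ennreal C * A"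
    proof (cases "A = \<top>")
      case True
      then show ?thesis using C by (simp add: ennreal_mult_top)
    next
      case False
      show ?thesis
      proof (rule ennreal_le_limit[OF C p0])
        show "W < \<top>" using W by (simp add: W_def)
        fix e :: real assume e: "0 < e"
        \<comment> \<open>The floor \<open>e\<close> makes the starting function strictly positive,
          as the iteration requires; finiteness of \<open>W\<close> keeps its weighted integral
          finite.\<close>
        define h where "h x = max (L x) (ennreal e)" for x
        have [measurable]: "h \<in> borel_measurable M" unfolding h_def by measurable
        have "(\<integral>\<^sup>+x. ennpow (h x) p * ennreal (w x) \<partial>M)
          \<le> (\<integral>\<^sup>+x. ennpow (L x) p * ennreal (w x) + ennreal (e powr p) * ennreal (w x) \<partial>M)"
          unfolding distrib_right[symmetric] h_def
          using p e by (intro nn_integral_mono mult_right_mono order_trans[OF ennpow_max_le]) (auto simp: ennpow_ennreal)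
        also have "\<dots> = A + ennreal (e powr p) * W"
          by (simp add: nn_integral_add nn_integral_cmult A_def W_def)
        finally have hA: "(\<integral>\<^sup>+x. ennpow (h x) p * ennreal (w x) \<partial>M) \<le> A + ennreal (e powr p) * W" .
        also have "\<dots> < \<top>" using False W by (simp add: W_def less_top ennreal_mult_less_top)
        finally have hfin: "(\<integral>\<^sup>+x. ennpow (h x) p * ennreal (w x) \<partial>M) < \<top>" .
        have hpos: "0 < h x" for x using e by (auto simp: h_def less_max_iff_disj)
        obtain H where [measurable]: "H \<in> borel_measurable M" and Hpos: "\<And>x. x \<in> space M \<Longrightarrow> 0 < H x"
          and hH: "AE x in M. h x \<le> ennreal (H x)"
          and HB: "\<And>n. AE x in M. E n (\<lambda>x. ennreal (H x)) x \<le> ennreal (B * H x)"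
          and HI: "(\<integral>\<^sup>+x. ennreal (H x powr p * w x) \<partial>M) \<le> ennreal D' * (\<integral>\<^sup>+x. ennpow (h x) p * ennreal (w x) \<partial>M)"
          using RdF[of w h, OF _ wpos D(2)[OF w] _ hpos hfin] by auto
        define u where "u x = H x powr (p - r) * w x" for x
        have u: "Ap r K' u" unfolding u_def K'_def
          by (rule Ap_factor[OF w p K _ Hpos B HB]) auto
        have [measurable]: "u \<in> borel_measurable M" using ApD(1)[OF u] .
        have G1: "AE x in M. ennpow (G x) p * ennreal (w x) \<le> ennpow (G x) r * ennreal (u x) + ennreal (H x powr p * w x)"
          using AE_space
        proof eventually_elim
          case (elim x)
          note Hx = Hpos[OF elim] and wx = wpos[OF elim]
          show ?case
          proof (cases "G x \<le> ennreal (H x)")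
            case True
            then have "ennpow (G x) p * ennreal (w x) \<le> ennpow (ennreal (H x)) p * ennreal (w x)"
              using p by (intro mult_right_mono ennpow_mono) auto
            also have "\<dots> = ennreal (H x powr p * w x)" using Hx wx by (simp add: ennpow_ennreal ennreal_mult)
            finally show ?thesis by (simp add: add_increasing)
          next
            case False
            have "ennpow (G x) p * ennreal (w x) \<le> ennpow (G x) r * ennreal (u x)"
            proof (cases "G x")
              case (real y)
              then have y: "H x < y" using False Hx by (simp add: ennreal_less_iff not_le)
              have "y powr p = y powr r * y powr (p - r)" by (simp flip: powr_add)
              also have "\<dots> \<le> y powr r * H x powr (p - r)"
                using y Hx p by (intro mult_left_mono powr_mono2') auto
              finally have "y powr p * w x \<le> y powr r * H x powr (p - r) * w x" using wx by (intro mult_right_mono) auto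
              then show ?thesis using real wx unfolding u_def
                by (simp add: ennpow_ennreal ennreal_mult[symmetric] ennreal_leI mult.assoc)
            next
              case top
              then show ?thesis using Hx wx by (simp add: u_def ennreal_top_mult)
            qed
            then show ?thesis by (simp add: add_increasing2)
          qed
        qed
        have L1: "AE x in M. ennpow (L x) r * ennreal (u x) \<le> ennreal (H x powr p * w x)"
          using AE_space hH
        proof eventually_elim
          case (elim x)
          note Hx = Hpos[OF elim(1)] and wx = wpos[OF elim(1)]
          have "L x \<le> ennreal (H x)" using elim(2) by (simp add: h_def)
          then have "ennpow (L x) r * ennreal (u x) \<le> ennpow (ennreal (H x)) r * ennreal (u x)"
            using p by (intro mult_right_mono ennpow_mono) auto
          also have "\<dots> = ennreal (H x powr r * H x powr (p - r) * w x)"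
            using Hx wx by (simp add: ennpow_ennreal u_def ennreal_mult mult.assoc)
          also have "H x powr r * H x powr (p - r) = H x powr p" by (simp flip: powr_add)
          finally show ?case .
        qed
        have "(\<integral>\<^sup>+x. ennpow (G x) p * ennreal (w x) \<partial>M)
          \<le> (\<integral>\<^sup>+x. ennpow (G x) r * ennreal (u x) + ennreal (H x powr p * w x) \<partial>M)"
          by (rule nn_integral_mono_AE[OF G1])
        also have "\<dots> = (\<integral>\<^sup>+x. ennpow (G x) r * ennreal (u x) \<partial>M) + (\<integral>\<^sup>+x. ennreal (H x powr p * w x) \<partial>M)"
          by (rule nn_integral_add) measurable
        also have "\<dots> \<le> ennreal C0 * (\<integral>\<^sup>+x. ennpow (L x) r * ennreal (u x) \<partial>M) + (\<integral>\<^sup>+x. ennreal (H x powr p * w x) \<partial>M)"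
          unfolding G_def L_def by (intro add_right_mono C0 u) auto
        also have "\<dots> \<le> ennreal C0 * (\<integral>\<^sup>+x. ennreal (H x powr p * w x) \<partial>M) + (\<integral>\<^sup>+x. ennreal (H x powr p * w x) \<partial>M)"
          by (intro add_right_mono mult_left_mono nn_integral_mono_AE L1) simp
        also have "\<dots> = ennreal (C0 + 1) * (\<integral>\<^sup>+x. ennreal (H x powr p * w x) \<partial>M)"
          using C0 by (simp add: distrib_right)
        also have "\<dots> \<le> ennreal (C0 + 1) * (ennreal D' * (A + ennreal (e powr p) * W))"
          by (intro mult_left_mono order_trans[OF HI] hA) auto
        also have "\<dots> = ennreal C * (A + ennreal (e powr p) * W)"
          using C0 D' by (simp add: C_def ennreal_mult mult.assoc del: ennreal_plus)
        finally show "(\<integral>\<^sup>+x. ennpow (G x) p * ennreal (w x) \<partial>M) \<le> ennreal C * (A + ennreal (e powr p) * W)" .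
      qed
    qed
    then show ?thesis unfolding A_def G_def L_def .
  qed
  with C that show ?thesis by blast
qed

text \<open>The majorant \<open>H\<close> is built from the maximal function itself (truncated by \<open>N\<close> from above and \<open>e\<close> from below),
  and \<open>u\<close> is the dual of the weight of the case \<open>p < r\<close> for the conjugate exponents. The truncation
  makes the left-hand side finite, so that half of it can be absorbed.\<close>

lemma vector_maximal_above:
  assumes p: "1 < r" "r < p" and K: "0 < K"
  obtains C where "0 < C" "\<And>w f N. Ap p K w \<Longrightarrow> (\<integral>\<^sup>+x. ennreal (w x) \<partial>M) < \<top> \<Longrightarrow>
    (\<And>j. f j \<in> borel_measurable M) \<Longrightarrow> 0 < N \<Longrightarrow>
    (\<integral>\<^sup>+x. ennpow (min (lr_norm r (\<lambda>j. Mx (f j)) x) (ennreal N)) p * ennreal (w x) \<partial>M)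
      \<le> ennreal C * (\<integral>\<^sup>+x. ennpow (lr_norm r f x) p * ennreal (w x) \<partial>M)"
proof -
  have p1: "1 < p" and p0: "0 < p" using p by auto
  \<comment> \<open>\<open>p'\<close> and \<open>r'\<close> are the conjugate exponents, so
    \<open>r < p\<close> becomes \<open>p' < r'\<close>. \<open>K1\<close> is the constant of the
    dual weight, and \<open>s\<close> is the exponent that \<open>H\<close> will carry in
    \<open>u\<close>, which equals \<open>H powr s * w powr (1 - s)\<close>.\<close>
  define p' r' s K1 where "p' = p / (p - 1)" and "r' = r / (r - 1)" and "s = (p - r) / (p - 1)"
    and "K1 = K powr (1 / (p - 1))"
  have p': "1 < p'" "p' < r'" "0 < p'" using p by (auto simp: p'_def r'_def field_simps)
  have pp: "(p - 1) * p' = p" using p1 by (simp add: p'_def)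
  have s: "0 < s" "s < 1" "(p - 1) * s = p - r" using p by (auto simp: s_def)
  have K1: "0 < K1" using K by (simp add: K1_def)
  obtain D where D: "0 < D" "\<And>w f. Ap p' K1 w \<Longrightarrow> f \<in> borel_measurable M \<Longrightarrow>
    (\<integral>\<^sup>+x. ennpow (Mx f x) p' * ennreal (w x) \<partial>M) \<le> ennreal D * (\<integral>\<^sup>+x. ennpow (f x) p' * ennreal (w x) \<partial>M)"
    using Ap_maximal[OF p'(1) K1] by blast
  obtain B D' where B: "0 < B" and D': "0 < D'" and RdF: "\<And>v h. v \<in> borel_measurable M \<Longrightarrow> (\<And>x. x \<in> space M \<Longrightarrow> 0 < v x) \<Longrightarrow>
    (\<And>f. f \<in> borel_measurable M \<Longrightarrow> (\<integral>\<^sup>+x. ennpow (Mx f x) p' * ennreal (v x) \<partial>M)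
        \<le> ennreal D * (\<integral>\<^sup>+x. ennpow (f x) p' * ennreal (v x) \<partial>M)) \<Longrightarrow>
    h \<in> borel_measurable M \<Longrightarrow> (\<And>x. x \<in> space M \<Longrightarrow> 0 < h x) \<Longrightarrow>
    (\<integral>\<^sup>+x. ennpow (h x) p' * ennreal (v x) \<partial>M) < \<top> \<Longrightarrow>
    \<exists>H. H \<in> borel_measurable M \<and> (\<forall>x\<in>space M. 0 < H x) \<and> (AE x in M. h x \<le> ennreal (H x)) \<and>
      (\<forall>n. AE x in M. E n (\<lambda>x. ennreal (H x)) x \<le> ennreal (B * H x)) \<and>
      (\<integral>\<^sup>+x. ennreal (H x powr p' * v x) \<partial>M) \<le> ennreal D' * (\<integral>\<^sup>+x. ennpow (h x) p' * ennreal (v x) \<partial>M)"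
    using rubio_de_francia[OF p'(3) D(1)] by blast
  define K2 where "K2 = B powr (r' - p') * K1"
  define K3 where "K3 = K2 powr (1 / (r' - 1))"
  have K2: "0 < K2" and K3: "0 < K3" using B K1 by (auto simp: K2_def K3_def)
  obtain C0 where C0: "0 < C0" "\<And>w f. Ap r K3 w \<Longrightarrow> (\<And>j. f j \<in> borel_measurable M) \<Longrightarrow>
    (\<integral>\<^sup>+x. ennpow (lr_norm r (\<lambda>j. Mx (f j)) x) r * ennreal (w x) \<partial>M)
      \<le> ennreal C0 * (\<integral>\<^sup>+x. ennpow (lr_norm r f x) r * ennreal (w x) \<partial>M)"
    using vector_maximal_diagonal[OF p(1) K3] by blast
  \<comment> \<open>The splitting parameter of \<open>L1\<close>, tuned so that the coefficient
    \<open>C0 * d powr r * D'\<close> in front of \<open>X\<close> is one half.\<close>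
  define d where "d = (1 / (2 * C0 * D')) powr (1 / r)"
  have d: "0 < d" "C0 * (d powr r * D') = 1 / 2" using C0(1) D' p by (auto simp: d_def powr_powr)
  \<comment> \<open>The factor 2 results from the absorption; the summand 1 ensures that
    \<open>C\<close> is at least 1, so the error term in \<open>e\<close> can be multiplied by
    \<open>C\<close> too.\<close>
  define C where "C = 2 * C0 * d powr (r - p) + 1"
  have C: "0 < C" using C0 d by (simp add: C_def add_nonneg_pos)
  have "(\<integral>\<^sup>+x. ennpow (min (lr_norm r (\<lambda>j. Mx (f j)) x) (ennreal N)) p * ennreal (w x) \<partial>M)
      \<le> ennreal C * (\<integral>\<^sup>+x. ennpow (lr_norm r f x) p * ennreal (w x) \<partial>M)"
    if w: "Ap p K w" and W: "(\<integral>\<^sup>+x. ennreal (w x) \<partial>M) < \<top>" and [measurable]: "\<And>j. f j \<in> borel_measurable M"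
      and N: "0 < N" for w f N
  proof -
    note [measurable] = ApD(1)[OF w]
    note wpos = ApD(2)[OF w]
    define G where "G = lr_norm r (\<lambda>j. Mx (f j))"
    define L where "L = lr_norm r f"
    have [measurable]: "G \<in> borel_measurable M" "L \<in> borel_measurable M" unfolding G_def L_def by measurable
    define A where "A = (\<integral>\<^sup>+x. ennpow (L x) p * ennreal (w x) \<partial>M)"
    define W where "W = (\<integral>\<^sup>+x. ennreal (w x) \<partial>M)"
    have Wfin: "W < \<top>" using W by (simp add: W_def)
    define X where "X = (\<integral>\<^sup>+x. ennpow (min (G x) (ennreal N)) p * ennreal (w x) \<partial>M)"
    have "X \<le> (\<integral>\<^sup>+x. ennreal (N powr p) * ennreal (w x) \<partial>M)"
    proof -
      have "ennpow (min (G x) (ennreal N)) p \<le> ennreal (N powr p)" for x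
        using ennpow_mono[of p "min (G x) (ennreal N)" "ennreal N"] N p0 by (simp add: ennpow_ennreal)
      then show ?thesis unfolding X_def by (intro nn_integral_mono mult_right_mono) auto
    qed
    also have "\<dots> = ennreal (N powr p) * W" by (simp add: nn_integral_cmult W_def)
    also have "\<dots> < \<top>" using Wfin by (simp add: ennreal_mult_less_top)
    finally have Xfin: "X < \<top>" .
    define \<sigma> where "\<sigma> x = w x powr (- 1 / (p - 1))" for x
    have \<sigma>: "Ap p' K1 \<sigma>" unfolding p'_def K1_def \<sigma>_def using Ap_dual[OF w p1 K] .
    note [measurable] = ApD(1)[OF \<sigma>]
    have "X \<le> ennreal C * A"
    proof (rule ennreal_le_limit[OF C p0 Wfin])
      fix e :: real assume e: "0 < e"
      define g where "g x = enn2real (max (min (G x) (ennreal N)) (ennreal e))" for x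
      have [measurable]: "g \<in> borel_measurable M" unfolding g_def by measurable
      have geq: "max (min (G x) (ennreal N)) (ennreal e) = ennreal (g x)" for x
        unfolding g_def by (subst ennreal_enn2real) (auto simp: max_def min_def less_top[symmetric] top_unique)
      have gpos: "0 < g x" for x
      proof -
        have "ennreal e \<le> ennreal (g x)" unfolding geq[symmetric] by simp
        then show ?thesis using e by (auto simp: ennreal_le_iff2)
      qed
      have gX: "(\<integral>\<^sup>+x. ennreal (g x powr p * w x) \<partial>M) \<le> X + ennreal (e powr p) * W"
      proof -
        have "(\<integral>\<^sup>+x. ennreal (g x powr p * w x) \<partial>M)
          \<le> (\<integral>\<^sup>+x. ennpow (min (G x) (ennreal N)) p * ennreal (w x) + ennreal (e powr p) * ennreal (w x) \<partial>M)"
        proof (rule nn_integral_mono)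
          fix x assume "x \<in> space M"
          have "ennreal (g x powr p * w x) = ennpow (ennreal (g x)) p * ennreal (w x)"
            using gpos[of x] wpos[OF \<open>x \<in> space M\<close>] by (simp add: ennpow_ennreal ennreal_mult)
          also have "\<dots> \<le> (ennpow (min (G x) (ennreal N)) p + ennpow (ennreal e) p) * ennreal (w x)"
            unfolding geq[symmetric] using p0 by (intro mult_right_mono ennpow_max_le) auto
          finally show "ennreal (g x powr p * w x) \<le> ennpow (min (G x) (ennreal N)) p * ennreal (w x) + ennreal (e powr p) * ennreal (w x)"
            using e by (simp add: distrib_right ennpow_ennreal)
        qed
        also have "\<dots> = X + ennreal (e powr p) * W" by (simp add: nn_integral_add nn_integral_cmult X_def W_def)
        finally show ?thesis .
      qed
      \<comment> \<open>The extremal function of the duality between L^p(w) and L^p'(\<sigma>):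
        \<open>(p - 1) * p' = p\<close> gives
        \<open>h powr p' * \<sigma> = g powr p * w\<close>.\<close>
      define h where "h x = g x powr (p - 1) * w x" for x
      have [measurable]: "h \<in> borel_measurable M" unfolding h_def by measurable
      have hpos: "0 < h x" if "x \<in> space M" for x using gpos[of x] wpos[OF that] by (simp add: h_def)
      have hg: "ennpow (ennreal (h x)) p' * ennreal (\<sigma> x) = ennreal (g x powr p * w x)" if "x \<in> space M" for x
      proof -
        have wx: "0 < w x" using wpos[OF that] .
        have "p' + - 1 / (p - 1) = 1" using p1 by (simp add: p'_def flip: diff_divide_distrib)
        then have "w x powr p' * \<sigma> x = w x" unfolding \<sigma>_def using wx by (simp flip: powr_add)
        then have "h x powr p' * \<sigma> x = g x powr p * w x"
          unfolding h_def using wx gpos[of x] pp by (simp add: powr_mult powr_powr)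
        then show ?thesis using hpos[OF that] by (simp add: ennpow_ennreal ennreal_mult[symmetric] \<sigma>_def)
      qed
      have hI: "(\<integral>\<^sup>+x. ennpow (ennreal (h x)) p' * ennreal (\<sigma> x) \<partial>M) = (\<integral>\<^sup>+x. ennreal (g x powr p * w x) \<partial>M)"
        by (rule nn_integral_cong) (rule hg)
      have "(\<integral>\<^sup>+x. ennpow (ennreal (h x)) p' * ennreal (\<sigma> x) \<partial>M) \<le> X + ennreal (e powr p) * W"
        unfolding hI by (rule gX)
      also have "\<dots> < \<top>" using Xfin Wfin by (simp add: ennreal_mult_less_top)
      finally have hfin: "(\<integral>\<^sup>+x. ennpow (ennreal (h x)) p' * ennreal (\<sigma> x) \<partial>M) < \<top>" .
      obtain H where [measurable]: "H \<in> borel_measurable M" and Hpos: "\<And>x. x \<in> space M \<Longrightarrow> 0 < H x"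
        and hH: "AE x in M. ennreal (h x) \<le> ennreal (H x)"
        and HB: "\<And>n. AE x in M. E n (\<lambda>x. ennreal (H x)) x \<le> ennreal (B * H x)"
        and HI: "(\<integral>\<^sup>+x. ennreal (H x powr p' * \<sigma> x) \<partial>M) \<le> ennreal D' * (\<integral>\<^sup>+x. ennpow (ennreal (h x)) p' * ennreal (\<sigma> x) \<partial>M)"
        using RdF[of \<sigma> "\<lambda>x. ennreal (h x)", OF _ ApD(2)[OF \<sigma>] D(2)[OF \<sigma>] _ _ hfin] hpos by auto
      define u where "u x = (H x powr (p' - r') * \<sigma> x) powr (- 1 / (r' - 1))" for x
      \<comment> \<open>As \<open>p' < r'\<close>, the dual weight can be lifted from the class of
        \<open>p'\<close> to that of \<open>r'\<close>; dualising again lands in the class of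
        \<open>r\<close>.\<close>
      have "Ap r' K2 (\<lambda>x. H x powr (p' - r') * \<sigma> x)"
        unfolding K2_def by (rule Ap_factor[OF \<sigma> p'(1,2) K1 _ Hpos B HB]) auto
      from Ap_dual[OF this _ K2] have "Ap (r' / (r' - 1)) K3 u"
        unfolding u_def K3_def using p' by simp
      moreover have "r' / (r' - 1) = r" using p by (simp add: r'_def field_simps)
      ultimately have u: "Ap r K3 u" by simp
      have [measurable]: "u \<in> borel_measurable M" using ApD(1)[OF u] .
      \<comment> \<open>Defined by \<open>H = m powr (p - 1) * w\<close>, just as \<open>h\<close>
        arises from \<open>g\<close>. In terms of \<open>m\<close> the weight is
        \<open>u = m powr (p - r) * w\<close>, the integrand of the majorant is
        \<open>m powr p * w\<close>, and \<open>h \<le> H\<close> reads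
        \<open>g \<le> m\<close>.\<close>
      define m where "m x = (H x / w x) powr (1 / (p - 1))" for x
      have [measurable]: "m \<in> borel_measurable M" unfolding m_def by measurable
      have mpos: "0 < m x" if "x \<in> space M" for x using Hpos[OF that] wpos[OF that] by (simp add: m_def)
      have ueq: "u x = m x powr (p - r) * w x" if "x \<in> space M" for x
      proof -
        have Hx: "0 < H x" and wx: "0 < w x" using Hpos wpos that by auto
        have e1: "(p' - r') * (- 1 / (r' - 1)) = s"
        proof -
          have "r' - 1 = 1 / (r - 1)" using p by (simp add: r'_def field_simps)
          then have "- 1 / (r' - 1) = - (r - 1)" by simp
          moreover have "(p' - r') * (- (r - 1)) = (r' - p') * (r - 1)" by (simp add: algebra_simps)
          ultimately have "(p' - r') * (- 1 / (r' - 1)) = (r' - p') * (r - 1)" by (simp only:)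
          moreover have "(r' - p') * (r - 1) = s"
          proof -
            have "r' * (r - 1) = r" using p by (simp add: r'_def)
            moreover have "r - p' * (r - 1) = s" using p by (simp add: p'_def s_def divide_simps) (simp add: algebra_simps)
            ultimately show ?thesis by (simp add: left_diff_distrib)
          qed
          ultimately show ?thesis by (simp only:)
        qed
        have e2: "- 1 / (p - 1) * (- 1 / (r' - 1)) = 1 - s"
          using p by (simp add: r'_def s_def divide_simps)
        have "u x = H x powr s * w x powr (1 - s)"
          unfolding u_def \<sigma>_def using e1 e2 by (simp only: powr_mult powr_powr)
        moreover have "m x powr (p - r) = (H x / w x) powr s"
          unfolding m_def powr_powr s_def by simp
        ultimately show ?thesis using Hx wx by (simp add: powr_divide powr_diff)
      qed
      have meq: "H x powr p' * \<sigma> x = m x powr p * w x" if "x \<in> space M" for x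
      proof -
        have Hx: "0 < H x" and wx: "0 < w x" using Hpos wpos that by auto
        have "- 1 / (p - 1) = - p' + 1" using p1 by (simp add: p'_def field_simps)
        then have "\<sigma> x = w x powr (- p') * w x" unfolding \<sigma>_def using wx by (simp only: powr_add) simp
        moreover have "m x powr p = (H x / w x) powr p'" unfolding m_def powr_powr p'_def by simp
        then have "m x powr p = H x powr p' * w x powr (- p')"
          using Hx wx by (simp add: powr_divide powr_minus inverse_eq_divide)
        ultimately show ?thesis by (simp only: mult.assoc)
      qed
      have G1: "AE x in M. ennpow (min (G x) (ennreal N)) p * ennreal (w x) \<le> ennpow (G x) r * ennreal (u x)"
        using AE_space hH
      proof eventually_elim
        case (elim x)
        have Hx: "0 < H x" and wx: "0 < w x" and mx: "0 < m x" using Hpos wpos mpos elim by auto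
        have "h x \<le> H x" using elim(2) Hx by (simp add: ennreal_le_iff)
        then have "g x powr (p - 1) \<le> H x / w x" using wx by (simp add: h_def field_simps)
        then have "(g x powr (p - 1)) powr (1 / (p - 1)) \<le> m x" unfolding m_def using p1 by (intro powr_mono2) auto
        then have gm: "g x \<le> m x" using gpos[of x] p1 by (simp add: powr_powr)
        have "min (G x) (ennreal N) \<le> ennreal (g x)" unfolding geq[symmetric] by simp
        also have "\<dots> \<le> ennreal (m x)" using gm by (rule ennreal_leI)
        finally have *: "min (G x) (ennreal N) \<le> ennreal (m x)" .
        have "ennpow (min (G x) (ennreal N)) p = ennpow (min (G x) (ennreal N)) r * ennpow (min (G x) (ennreal N)) (p - r)"
          by (simp flip: ennpow_add)
        also have "\<dots> \<le> ennpow (G x) r * ennpow (ennreal (m x)) (p - r)"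
          using p * by (intro mult_mono ennpow_mono) auto
        finally have "ennpow (min (G x) (ennreal N)) p * ennreal (w x) \<le> ennpow (G x) r * ennpow (ennreal (m x)) (p - r) * ennreal (w x)"
          by (rule mult_right_mono) simp
        also have "\<dots> = ennpow (G x) r * ennreal (u x)"
          using mx wx elim by (simp add: ueq ennpow_ennreal ennreal_mult mult.assoc)
        finally show ?case .
      qed
      \<comment> \<open>Young's inequality with a small parameter, by comparing \<open>L\<close>
        with \<open>d * m\<close>: where \<open>L\<close> is smaller, its r-th power is replaced by
        that of \<open>d * m\<close>; where it is larger, \<open>m\<close> is replaced by
        \<open>L / d\<close>.\<close>
      have L1: "AE x in M. ennpow (L x) r * ennreal (u x)
         \<le> ennreal (d powr (r - p)) * (ennpow (L x) p * ennreal (w x)) + ennreal (d powr r) * ennreal (H x powr p' * \<sigma> x)"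
        using AE_space
      proof eventually_elim
        case (elim x)
        have wx: "0 < w x" and mx: "0 < m x" using wpos mpos elim by auto
        show ?case
        proof (cases "L x")
          case (real y)
          have "y powr r * m x powr (p - r) \<le> d powr (r - p) * y powr p + d powr r * m x powr p"
          proof (cases "y \<le> d * m x")
            case True
            then have "y powr r * m x powr (p - r) \<le> (d * m x) powr r * m x powr (p - r)"
              using real p by (intro mult_right_mono powr_mono2) auto
            also have "\<dots> = d powr r * (m x powr r * m x powr (p - r))" using d mx by (simp add: powr_mult)
            also have "m x powr r * m x powr (p - r) = m x powr p" by (simp flip: powr_add)
            finally show ?thesis by (simp add: add_increasing)
          next
            case False
            then have y0: "0 < y" using d mx by (meson le_less_trans mult_pos_pos not_le order_less_trans)
            from False have "m x \<le> y / d" using d by (simp add: field_simps)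
            then have "y powr r * m x powr (p - r) \<le> y powr r * (y / d) powr (p - r)"
              using mx p by (intro mult_left_mono powr_mono2) auto
            also have "\<dots> = d powr (r - p) * (y powr r * y powr (p - r))" using d y0 by (simp add: powr_divide powr_diff)
            also have "y powr r * y powr (p - r) = y powr p" by (simp flip: powr_add)
            finally show ?thesis by (simp add: add_increasing2)
          qed
          then have "y powr r * m x powr (p - r) * w x \<le> (d powr (r - p) * y powr p + d powr r * m x powr p) * w x"
            using wx by (intro mult_right_mono) auto
          then have "y powr r * (m x powr (p - r) * w x) \<le> d powr (r - p) * (y powr p * w x) + d powr r * (m x powr p * w x)"
            by (simp add: algebra_simps)
          from ennreal_leI[OF this] show ?thesis
            using real wx elim by (simp add: ueq meq ennpow_ennreal ennreal_mult)
        next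
          case top
          then show ?thesis using wx d by (simp add: ennreal_top_mult ennreal_mult_top)
        qed
      qed
      define Y where "Y = ennreal (C0 * d powr (r - p)) * A"
      have "X \<le> (\<integral>\<^sup>+x. ennpow (G x) r * ennreal (u x) \<partial>M)"
        unfolding X_def by (rule nn_integral_mono_AE[OF G1])
      also have "\<dots> \<le> ennreal C0 * (\<integral>\<^sup>+x. ennpow (L x) r * ennreal (u x) \<partial>M)"
        unfolding G_def L_def by (intro C0 u) auto
      also have "\<dots> \<le> ennreal C0 * (\<integral>\<^sup>+x. ennreal (d powr (r - p)) * (ennpow (L x) p * ennreal (w x)) + ennreal (d powr r) * ennreal (H x powr p' * \<sigma> x) \<partial>M)"
        by (intro mult_left_mono nn_integral_mono_AE L1) simp
      also have "\<dots> = ennreal C0 * (ennreal (d powr (r - p)) * A + ennreal (d powr r) * (\<integral>\<^sup>+x. ennreal (H x powr p' * \<sigma> x) \<partial>M))"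
        by (simp add: nn_integral_add nn_integral_cmult A_def)
      also have "\<dots> \<le> ennreal C0 * (ennreal (d powr (r - p)) * A + ennreal (d powr r) * (ennreal D' * (X + ennreal (e powr p) * W)))"
        by (intro mult_left_mono add_left_mono order_trans[OF HI]) (auto simp: hI gX)
      also have "\<dots> = Y + ennreal (C0 * (d powr r * D')) * (X + ennreal (e powr p) * W)"
        using C0(1) D' by (simp add: Y_def ennreal_mult distrib_left mult.assoc)
      finally have XY: "X \<le> Y + ennreal (1 / 2) * (X + ennreal (e powr p) * W)" unfolding d(2) .
      have "X \<le> 2 * Y + ennreal (e powr p) * W"
      proof (cases "Y = \<top>")
        case False
        then obtain \<xi> y \<omega> where "X = ennreal \<xi>" "0 \<le> \<xi>" "Y = ennreal y" "0 \<le> y" "ennreal (e powr p) * W = ennreal \<omega>" "0 \<le> \<omega>"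
          using Xfin Wfin by (cases X; cases Y; cases "ennreal (e powr p) * W") (auto simp: ennreal_mult_eq_top_iff)
        moreover from this have "\<xi> \<le> y + 1 / 2 * (\<xi> + \<omega>)"
          using XY by (simp add: ennreal_mult[symmetric] ennreal_plus[symmetric] ennreal_le_iff del: ennreal_plus ennreal_half)
        then have "\<xi> \<le> 2 * y + \<omega>" by (simp add: field_simps)
        ultimately show ?thesis
          by (simp add: numeral_mult_ennreal ennreal_plus[symmetric] ennreal_leI del: ennreal_plus)
      qed (simp add: ennreal_mult_top)
      also have "\<dots> \<le> ennreal C * A + ennreal C * (ennreal (e powr p) * W)"
      proof (intro add_mono)
        have "2 * Y = ennreal (2 * C0 * d powr (r - p)) * A"
          unfolding Y_def using C0(1) by (simp add: ennreal_mult mult.assoc)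
        also have "\<dots> \<le> ennreal C * A" by (intro mult_right_mono ennreal_leI) (auto simp: C_def)
        finally show "2 * Y \<le> ennreal C * A" .
        have "1 \<le> ennreal C" using C0(1) by (simp add: C_def)
        then show "ennreal (e powr p) * W \<le> ennreal C * (ennreal (e powr p) * W)"
          using mult_right_mono[of 1 "ennreal C" "ennreal (e powr p) * W"] by simp
      qed
      finally show "X \<le> ennreal C * (A + ennreal (e powr p) * W)" by (simp add: distrib_left)
    qed
    then show ?thesis unfolding A_def X_def G_def L_def .
  qed
  with C that show ?thesis by blast
qed

lemma vector_maximal_truncated:
  assumes p: "1 < p" and r: "1 < r" and K: "0 < K"
  obtains C where "0 < C" "\<And>w f N. Ap p K w \<Longrightarrow> (\<integral>\<^sup>+x. ennreal (w x) \<partial>M) < \<top> \<Longrightarrow>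
    (\<And>j. f j \<in> borel_measurable M) \<Longrightarrow> 0 < N \<Longrightarrow>
    (\<integral>\<^sup>+x. ennpow (min (lr_norm r (\<lambda>j. Mx (f j)) x) (ennreal N)) p * ennreal (w x) \<partial>M)
      \<le> ennreal C * (\<integral>\<^sup>+x. ennpow (lr_norm r f x) p * ennreal (w x) \<partial>M)"
proof -
  have trunc: "(\<integral>\<^sup>+x. ennpow (min (G x) (ennreal N)) p * ennreal (w x) \<partial>M)
     \<le> (\<integral>\<^sup>+x. ennpow (G x) p * ennreal (w x) \<partial>M)" for G :: "'a \<Rightarrow> ennreal" and N w
    using p by (intro nn_integral_mono mult_right_mono ennpow_mono) auto
  consider "p = r" | "p < r" | "r < p" by linarith
  then show ?thesis
  proof cases
    case 1
    obtain C where C: "0 < C" "\<And>w f. Ap r K w \<Longrightarrow> (\<And>j. f j \<in> borel_measurable M) \<Longrightarrow>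
        (\<integral>\<^sup>+x. ennpow (lr_norm r (\<lambda>j. Mx (f j)) x) r * ennreal (w x) \<partial>M)
          \<le> ennreal C * (\<integral>\<^sup>+x. ennpow (lr_norm r f x) r * ennreal (w x) \<partial>M)"
      using vector_maximal_diagonal[OF r K] by blast
    show ?thesis using 1 by (intro that[OF C(1)] order_trans[OF trunc]) (auto intro: C(2))
  next
    case 2
    obtain C where C: "0 < C" "\<And>w f. Ap p K w \<Longrightarrow> (\<integral>\<^sup>+x. ennreal (w x) \<partial>M) < \<top> \<Longrightarrow>
        (\<And>j. f j \<in> borel_measurable M) \<Longrightarrow>
        (\<integral>\<^sup>+x. ennpow (lr_norm r (\<lambda>j. Mx (f j)) x) p * ennreal (w x) \<partial>M)
          \<le> ennreal C * (\<integral>\<^sup>+x. ennpow (lr_norm r f x) p * ennreal (w x) \<partial>M)"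
      using vector_maximal_below[OF p 2 K] by blast
    show ?thesis by (intro that[OF C(1)] order_trans[OF trunc]) (rule C(2))
  next
    case 3
    show ?thesis using vector_maximal_above[OF r 3 K] that by blast
  qed
qed

end

section \<open>Splitting the sequence and estimating level sets\<close>

lemma lr_mono:
  assumes "0 < r" "\<And>j. f j x \<le> g j x"
  shows "lr_norm r f x \<le> lr_norm r g x"
  unfolding lr_norm_def using assms by (intro ennpow_mono suminf_le) auto

lemma lr_indicator: "lr_norm r (\<lambda>j x. f j x * indicator S x) x = lr_norm r f x * indicator S x"
  by (auto simp: lr_norm_def indicator_def)

lemma ennpow_add_le:
  assumes "0 < r" shows "ennpow (a + b) r \<le> ennreal (2 powr r) * (ennpow a r + ennpow b r)"
proof -
  have "a + b \<le> 2 * max a b" by (simp add: mult_2 add_mono)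
  then have "ennpow (a + b) r \<le> ennpow (2 * max a b) r" using assms by (intro ennpow_mono) auto
  also have "\<dots> = ennreal (2 powr r) * ennpow (max a b) r" unfolding ennpow_mult by (simp add: ennpow_def)
  also have "\<dots> \<le> ennreal (2 powr r) * (ennpow a r + ennpow b r)"
    using assms by (intro mult_left_mono ennpow_max_le) auto
  finally show ?thesis .
qed

lemma one_less_divide_ennreal: "0 < l \<Longrightarrow> 1 < a / ennreal l \<longleftrightarrow> ennreal l < a"
  by (cases a) (auto simp: divide_ennreal ennreal_less_iff ennreal_top_divide)

context filtered_prob_space
begin

lemma Mx_add: "f \<in> borel_measurable M \<Longrightarrow> g \<in> borel_measurable M \<Longrightarrow>
  AE x in M. Mx (\<lambda>x. f x + g x) x \<le> Mx f x + Mx g x"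
proof -
  assume [measurable]: "f \<in> borel_measurable M" "g \<in> borel_measurable M"
  have "AE x in M. \<forall>n. E n f x + E n g x = E n (\<lambda>x. f x + g x) x"
    unfolding AE_all_countable by (intro allI E_add) auto
  then show ?thesis
  proof eventually_elim
    case (elim x)
    show ?case unfolding Mx_def[of "\<lambda>x. f x + g x"]
      by (rule SUP_least) (auto simp: elim[rule_format, symmetric] intro: add_mono E_le_Mx)
  qed
qed

text \<open>The fraction 1/4 fits the crude bound \<open>ennpow_add_le\<close>: two quantities of
  size at most l / 4 give at most 2^r * 2 * (l / 4)^r for the r-th power of the sum, and
  \<open>2 \<le> 2 powr r\<close> brings this below l^r.\<close>

lemma lr_Mx_split:
  assumes r: "1 < r" and [measurable]: "\<And>j. f j \<in> borel_measurable M" "\<And>j. g j \<in> borel_measurable M"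
    and l: "0 < l"
  shows "AE x in M. ennreal l < lr_norm r (\<lambda>j. Mx (\<lambda>x. f j x + g j x)) x \<longrightarrow>
     ennreal (l / 4) < lr_norm r (\<lambda>j. Mx (f j)) x \<or> ennreal (l / 4) < lr_norm r (\<lambda>j. Mx (g j)) x"
proof -
  have "AE x in M. \<forall>j. Mx (\<lambda>x. f j x + g j x) x \<le> Mx (f j) x + Mx (g j) x"
    unfolding AE_all_countable by (intro allI Mx_add) auto
  then show ?thesis
  proof eventually_elim
    case (elim x)
    let ?G = "lr_norm r (\<lambda>j. Mx (\<lambda>x. f j x + g j x)) x" and ?A = "lr_norm r (\<lambda>j. Mx (f j)) x" and ?B = "lr_norm r (\<lambda>j. Mx (g j)) x"
    have "?G \<le> ennreal l" if "?A \<le> ennreal (l / 4)" "?B \<le> ennreal (l / 4)"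
    proof -
      have "ennpow ?G r = (\<Sum>j. ennpow (Mx (\<lambda>x. f j x + g j x) x) r)" using r by (simp add: ennpow_lr)
      also have "\<dots> \<le> (\<Sum>j. ennreal (2 powr r) * (ennpow (Mx (f j) x) r + ennpow (Mx (g j) x) r))"
        using elim r by (intro suminf_le order_trans[OF ennpow_mono ennpow_add_le]) auto
      also have "\<dots> = ennreal (2 powr r) * (ennpow ?A r + ennpow ?B r)"
        using r by (simp add: ennpow_lr suminf_add)
      also have "\<dots> \<le> ennreal (2 powr r) * (ennpow (ennreal (l / 4)) r + ennpow (ennreal (l / 4)) r)"
        using that r by (intro mult_left_mono add_mono ennpow_mono) auto
      also have "\<dots> = ennreal (2 powr r * (2 * (l / 4) powr r))"
        using l by (simp add: ennpow_ennreal ennreal_plus[symmetric] ennreal_mult[symmetric] del: ennreal_plus)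
      also have "\<dots> \<le> ennreal (l powr r)"
      proof (rule ennreal_leI)
        have "2 powr 1 \<le> 2 powr r" using r by (intro powr_mono) auto
        then have "2 powr r * (2 * (l / 4) powr r) \<le> 2 powr r * (2 powr r * (l / 4) powr r)"
          by (intro mult_left_mono mult_right_mono) auto
        also have "\<dots> = (2 * (2 * (l / 4))) powr r" using l by (simp only: powr_mult)
        finally show "2 powr r * (2 * (l / 4) powr r) \<le> l powr r" by simp
      qed
      also have "\<dots> = ennpow (ennreal l) r" using l by (simp add: ennpow_ennreal)
      finally show ?thesis using r by (simp add: ennpow_le_iff)
    qed
    then show ?case by (meson not_le)
  qed
qed

text \<open>Only the truncation of \<open>G\<close> at the level itself enters, which is why maximal
  bounds truncated at \<open>N\<close>, with a constant independent of \<open>N\<close>, can be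
  used.\<close>

lemma chebyshev_truncated:
  assumes p: "0 < p" and l: "0 < l" and [measurable]: "G \<in> borel_measurable M" "w \<in> borel_measurable M"
  shows "(\<integral>\<^sup>+x. indicator {a. ennreal l < a} (G x) * ennreal (w x) \<partial>M)
     \<le> ennreal (l powr (- p)) * (\<integral>\<^sup>+x. ennpow (min (G x) (ennreal l)) p * ennreal (w x) \<partial>M)"
proof -
  have "indicator {a. ennreal l < a} (G x) * ennreal (w x)
      \<le> ennreal (l powr (- p)) * (ennpow (min (G x) (ennreal l)) p * ennreal (w x))" for x
  proof (cases "ennreal l < G x")
    case True
    then have "min (G x) (ennreal l) = ennreal l" by (simp add: min_absorb2)
    moreover have "ennreal (l powr (- p)) * ennreal (l powr p) = 1" using l by (simp add: ennreal_mult[symmetric] flip: powr_add)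
    ultimately show ?thesis using True l by (simp add: ennpow_ennreal mult.assoc[symmetric])
  qed simp
  then show ?thesis by (subst nn_integral_cmult[symmetric]) (auto intro!: nn_integral_mono)
qed

text \<open>The sequence is cut where its pointwise l^r norm passes the level \<open>l\<close>. The
  large part is estimated with \<open>p0\<close> and the small part with \<open>p1\<close>; each
  resulting integrand is dominated by \<open>kern\<close>.\<close>

lemma vector_maximal_level:
  assumes p0: "1 < p0" and p1: "1 < p1" and r: "1 < r" and K: "0 < K"
  obtains A where "0 < A" "\<And>w f l. Ap p0 K w \<Longrightarrow> Ap p1 K w \<Longrightarrow> (\<integral>\<^sup>+x. ennreal (w x) \<partial>M) < \<top> \<Longrightarrow>
    (\<And>j. f j \<in> borel_measurable M) \<Longrightarrow> 0 < l \<Longrightarrow>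
    (\<integral>\<^sup>+x. indicator {a. ennreal l < a} (lr_norm r (\<lambda>j. Mx (f j)) x) * ennreal (w x) \<partial>M)
      \<le> ennreal A * (\<integral>\<^sup>+x. kern p0 p1 (lr_norm r f x / ennreal l) * ennreal (w x) \<partial>M)"
proof -
  obtain C0 where C0: "0 < C0" "\<And>w f N. Ap p0 K w \<Longrightarrow> (\<integral>\<^sup>+x. ennreal (w x) \<partial>M) < \<top> \<Longrightarrow>
    (\<And>j. f j \<in> borel_measurable M) \<Longrightarrow> 0 < N \<Longrightarrow>
    (\<integral>\<^sup>+x. ennpow (min (lr_norm r (\<lambda>j. Mx (f j)) x) (ennreal N)) p0 * ennreal (w x) \<partial>M)
      \<le> ennreal C0 * (\<integral>\<^sup>+x. ennpow (lr_norm r f x) p0 * ennreal (w x) \<partial>M)"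
    using vector_maximal_truncated[OF p0 r K] by blast
  obtain C1 where C1: "0 < C1" "\<And>w f N. Ap p1 K w \<Longrightarrow> (\<integral>\<^sup>+x. ennreal (w x) \<partial>M) < \<top> \<Longrightarrow>
    (\<And>j. f j \<in> borel_measurable M) \<Longrightarrow> 0 < N \<Longrightarrow>
    (\<integral>\<^sup>+x. ennpow (min (lr_norm r (\<lambda>j. Mx (f j)) x) (ennreal N)) p1 * ennreal (w x) \<partial>M)
      \<le> ennreal C1 * (\<integral>\<^sup>+x. ennpow (lr_norm r f x) p1 * ennreal (w x) \<partial>M)"
    using vector_maximal_truncated[OF p1 r K] by blast
  \<comment> \<open>The powers of 4 come from Chebyshev's inequality at \<open>l / 4\<close>, the
    level left over by \<open>lr_Mx_split\<close>.\<close>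
  define A where "A = 4 powr p0 * C0 + 4 powr p1 * C1"
  have A: "0 < A" using C0 C1 by (simp add: A_def add_pos_pos)
  have "(\<integral>\<^sup>+x. indicator {a. ennreal l < a} (lr_norm r (\<lambda>j. Mx (f j)) x) * ennreal (w x) \<partial>M)
      \<le> ennreal A * (\<integral>\<^sup>+x. kern p0 p1 (lr_norm r f x / ennreal l) * ennreal (w x) \<partial>M)"
    if w: "Ap p0 K w" "Ap p1 K w" and W: "(\<integral>\<^sup>+x. ennreal (w x) \<partial>M) < \<top>"
      and [measurable]: "\<And>j. f j \<in> borel_measurable M" and l: "0 < l" for w f l
  proof -
    note [measurable] = ApD(1)[OF w(1)]
    define L where "L = lr_norm r f"
    have [measurable]: "L \<in> borel_measurable M" unfolding L_def by measurable
    \<comment> \<open>A single set for all \<open>j\<close>, defined through the norm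
      \<open>L\<close> of the whole sequence, so that cutting commutes with \<open>lr_norm\<close>
      by \<open>lr_indicator\<close>.\<close>
    define S where "S = {x \<in> space M. ennreal l < L x}"
    have [measurable]: "S \<in> sets M" unfolding S_def by measurable
    define f1 where "f1 j x = f j x * indicator S x" for j x
    define f2 where "f2 j x = f j x * indicator (- S) x" for j x
    have [measurable]: "f1 j \<in> borel_measurable M" "f2 j \<in> borel_measurable M" for j
      unfolding f1_def f2_def by (auto simp: indicator_compl intro!: borel_measurable_times_ennreal)
    have f12: "(\<lambda>x. f1 j x + f2 j x) = f j" for j
      by (auto simp: f1_def f2_def indicator_def fun_eq_iff)
    let ?G = "\<lambda>f. lr_norm r (\<lambda>j. Mx (f j))"
    let ?k = "\<integral>\<^sup>+x. kern p0 p1 (L x / ennreal l) * ennreal (w x) \<partial>M"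
    have piece: "(\<integral>\<^sup>+x. indicator {a. ennreal (l / 4) < a} (?G g x) * ennreal (w x) \<partial>M) \<le> ennreal (4 powr p * C) * ?k"
      if p: "1 < p" and C: "0 < C" and [measurable]: "\<And>j. g j \<in> borel_measurable M"
        and bd: "(\<integral>\<^sup>+x. ennpow (min (?G g x) (ennreal (l / 4))) p * ennreal (w x) \<partial>M)
           \<le> ennreal C * (\<integral>\<^sup>+x. ennpow (lr_norm r g x) p * ennreal (w x) \<partial>M)"
        and kp: "\<And>x. x \<in> space M \<Longrightarrow> ennpow (lr_norm r g x / ennreal l) p \<le> kern p0 p1 (L x / ennreal l)" for g p C
    proof -
      have "(\<integral>\<^sup>+x. indicator {a. ennreal (l / 4) < a} (?G g x) * ennreal (w x) \<partial>M)
         \<le> ennreal ((l / 4) powr (- p)) * (\<integral>\<^sup>+x. ennpow (min (?G g x) (ennreal (l / 4))) p * ennreal (w x) \<partial>M)"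
        using p l by (intro chebyshev_truncated) auto
      also have "\<dots> \<le> ennreal ((l / 4) powr (- p)) * (ennreal C * (\<integral>\<^sup>+x. ennpow (lr_norm r g x) p * ennreal (w x) \<partial>M))"
        by (intro mult_left_mono bd) simp
      also have "(l / 4) powr (- p) = 4 powr p * l powr (- p)"
        using l by (simp add: powr_divide powr_minus field_simps)
      also have "ennreal (4 powr p * l powr (- p)) * (ennreal C * (\<integral>\<^sup>+x. ennpow (lr_norm r g x) p * ennreal (w x) \<partial>M))
         = ennreal (4 powr p * C) * (ennreal (l powr (- p)) * (\<integral>\<^sup>+x. ennpow (lr_norm r g x) p * ennreal (w x) \<partial>M))"
        using C by (simp add: ennreal_mult mult.assoc mult.left_commute)
      also have "ennreal (l powr (- p)) * (\<integral>\<^sup>+x. ennpow (lr_norm r g x) p * ennreal (w x) \<partial>M)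
         = (\<integral>\<^sup>+x. ennpow (lr_norm r g x / ennreal l) p * ennreal (w x) \<partial>M)"
      proof (subst nn_integral_cmult[symmetric])
        have "ennpow (lr_norm r g x / ennreal l) p = ennreal (l powr (- p)) * ennpow (lr_norm r g x) p" for x
          using l by (simp add: divide_ennreal_def inverse_ennreal ennpow_mult ennpow_ennreal powr_minus
              inverse_eq_divide powr_divide mult.commute)
        then show "(\<integral>\<^sup>+x. ennreal (l powr (- p)) * (ennpow (lr_norm r g x) p * ennreal (w x)) \<partial>M)
          = (\<integral>\<^sup>+x. ennpow (lr_norm r g x / ennreal l) p * ennreal (w x) \<partial>M)" by (simp add: mult.assoc)
      qed measurable
      also have "\<dots> \<le> ?k" by (intro nn_integral_mono mult_right_mono kp) auto
      finally show ?thesis by (simp add: mult_left_mono)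
    qed
    have k1: "ennpow (lr_norm r f1 x / ennreal l) p0 \<le> kern p0 p1 (L x / ennreal l)" if "x \<in> space M" for x
      using that l unfolding f1_def lr_indicator L_def[symmetric]
      by (cases "x \<in> S") (auto simp: S_def kern_def one_less_divide_ennreal)
    have k2: "ennpow (lr_norm r f2 x / ennreal l) p1 \<le> kern p0 p1 (L x / ennreal l)" if "x \<in> space M" for x
      using that l unfolding f2_def lr_indicator L_def[symmetric]
      by (cases "x \<in> S") (auto simp: S_def kern_def one_less_divide_ennreal)
    have "AE x in M. indicator {a. ennreal l < a} (?G f x) * ennreal (w x)
       \<le> indicator {a. ennreal (l / 4) < a} (?G f1 x) * ennreal (w x) + indicator {a. ennreal (l / 4) < a} (?G f2 x) * ennreal (w x)"
      using lr_Mx_split[of r f1 f2 l] r l unfolding f12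
      by (auto elim!: eventually_mono simp: indicator_def)
    then have "(\<integral>\<^sup>+x. indicator {a. ennreal l < a} (?G f x) * ennreal (w x) \<partial>M)
       \<le> (\<integral>\<^sup>+x. indicator {a. ennreal (l / 4) < a} (?G f1 x) * ennreal (w x) + indicator {a. ennreal (l / 4) < a} (?G f2 x) * ennreal (w x) \<partial>M)"
      by (rule nn_integral_mono_AE)
    also have "\<dots> = (\<integral>\<^sup>+x. indicator {a. ennreal (l / 4) < a} (?G f1 x) * ennreal (w x) \<partial>M)
       + (\<integral>\<^sup>+x. indicator {a. ennreal (l / 4) < a} (?G f2 x) * ennreal (w x) \<partial>M)"
      by (rule nn_integral_add) measurable
    also have "\<dots> \<le> ennreal (4 powr p0 * C0) * ?k + ennreal (4 powr p1 * C1) * ?k"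
      using l p0 p1 C0(1) C1(1) by (intro add_mono piece C0(2) C1(2) w W k1 k2) auto
    also have "\<dots> = ennreal A * ?k" using C0 C1 by (simp add: A_def distrib_right)
    finally show ?thesis unfolding L_def .
  qed
  with A that show ?thesis by blast
qed

text \<open>A bridge between two notions: \<open>A_class\<close> for \<open>q = 1\<close> is phrased
  with \<open>real_cond_exp\<close>, \<open>Ap\<close> with \<open>nn_cond_exp\<close>. The negative
  part contributes 0, and integrability makes the positive part finite almost everywhere.\<close>

lemma E_eq_real_cond_exp:
  assumes "integrable M f" and nonneg: "\<And>x. x \<in> space M \<Longrightarrow> 0 \<le> f x"
  shows "AE x in M. E n (\<lambda>x. ennreal (f x)) x = ennreal (real_cond_exp M (F n) f x)"
proof -
  have [measurable]: "f \<in> borel_measurable M" using assms by auto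
  have "(\<integral>\<^sup>+x. 1 * E n (\<lambda>x. ennreal (f x)) x \<partial>M) = (\<integral>\<^sup>+x. 1 * ennreal (f x) \<partial>M)" by (rule E_intg) auto
  also have "\<dots> < \<infinity>" using assms nonneg by (simp add: integrable_iff_bounded cong: nn_integral_cong)
  finally have "AE x in M. E n (\<lambda>x. ennreal (f x)) x \<noteq> \<infinity>" by (intro nn_integral_PInf_AE) auto
  moreover have "AE x in M. E n (\<lambda>x. ennreal (- f x)) x = E n (\<lambda>x. 0) x"
    using nonneg by (intro E_cong) (auto simp: ennreal_neg)
  moreover have "AE x in M. 0 = E n (\<lambda>x. 0) x" by (rule E_F_meas) auto
  ultimately show ?thesis
  proof eventually_elim
    case (elim x)
    then have "E n (\<lambda>x. ennreal (- f x)) x = 0" by simp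
    then show ?case using elim(1) by (simp add: real_cond_exp_def less_top)
  qed
qed

text \<open>\<open>Ap_of_A1\<close> and \<open>Ap_mono\<close> both preserve the constant, so one
  \<open>K\<close> serves all \<open>p\<close> above \<open>q\<close> and all \<open>t\<close>.
  Replacing the given constant by \<open>max K 1\<close> makes it positive.\<close>

lemma A_class_imp_Ap:
  assumes phi: "musielak_orlicz M \<phi>" and q: "1 \<le> q" "A_class M F \<phi> q"
  obtains K where "0 < K" "\<And>p t. q < p \<Longrightarrow> 0 < t \<Longrightarrow> Ap p K (\<lambda>x. \<phi> x t)"
proof (cases "q = 1")
  case True
  then obtain K where K: "\<And>n t. 0 < t \<Longrightarrow> AE x in M. real_cond_exp M (F n) (\<lambda>y. \<phi> y t) x \<le> K * \<phi> x t"
    using q by (auto simp: A_class_def)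
  have "Ap p (max K 1) (\<lambda>x. \<phi> x t)" if "q < p" "0 < t" for p t
  proof (rule Ap_of_A1)
    have pos: "0 < \<phi> x t" if "x \<in> space M" for x using phi \<open>0 < t\<close> that by (auto simp: musielak_orlicz_def)
    have int: "integrable M (\<lambda>x. \<phi> x t)" using phi \<open>0 < t\<close> by (auto simp: musielak_orlicz_def)
    then show "(\<lambda>x. \<phi> x t) \<in> borel_measurable M" by auto
    show "0 < \<phi> x t" if "x \<in> space M" for x using pos[OF that] .
    show "AE x in M. E n (\<lambda>x. ennreal (\<phi> x t)) x \<le> ennreal (max K 1 * \<phi> x t)" for n
    proof -
      have "AE x in M. E n (\<lambda>x. ennreal (\<phi> x t)) x = ennreal (real_cond_exp M (F n) (\<lambda>x. \<phi> x t) x)"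
        by (rule E_eq_real_cond_exp[OF int]) (auto intro: less_imp_le pos)
      then show ?thesis using K[OF \<open>0 < t\<close>, of n] AE_space
      proof eventually_elim
        case (elim x)
        have "K * \<phi> x t \<le> max K 1 * \<phi> x t" using pos[of x] elim by (intro mult_right_mono) auto
        then show ?case using elim by (simp add: ennreal_leI order_trans[OF _ ennreal_leI])
      qed
    qed
  qed (use True that in auto)
  then show ?thesis using that[of "max K 1"] by simp
next
  case False
  then have q1: "1 < q" using q by simp
  obtain K where K: "\<And>n t. 0 < t \<Longrightarrow> AE x in M. E n (\<lambda>y. ennreal (\<phi> y t)) x *
           ennpow (E n (\<lambda>y. ennreal (\<phi> y t powr (- 1 / (q - 1)))) x) (q - 1) \<le> ennreal K"
    using q False by (auto simp: A_class_def)
  have "Ap q (max K 1) (\<lambda>x. \<phi> x t)" if "0 < t" for t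
    unfolding Ap_def
  proof (intro conjI allI ballI)
    fix n
    show "AE x in M. E n (\<lambda>x. ennreal (\<phi> x t)) x * ennpow (E n (\<lambda>x. ennreal (\<phi> x t powr (- 1 / (q - 1)))) x) (q - 1)
       \<le> ennreal (max K 1)"
      using K[OF that, of n] by eventually_elim (auto elim!: order_trans intro!: ennreal_leI)
  qed (use phi that in \<open>auto simp: musielak_orlicz_def\<close>)
  then show ?thesis using that[of "max K 1"] Ap_mono[OF _ q1] by simp
qed

end

section \<open>From the modular inequality to the Luxemburg norm\<close>

lemma phi_ext_divide: "0 < l \<Longrightarrow> phi_ext (\<lambda>x t. \<phi> x (t / l)) x g = phi_ext \<phi> x (g / ennreal l)"
  by (cases g) (auto simp: phi_ext_def divide_ennreal ennreal_top_divide)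

text \<open>The type inequalities keep their constants under dilation, so the Luxemburg parameter
  \<open>l\<close> can be carried by \<phi> instead of by the functions \<open>f j\<close>.\<close>

lemma orlicz_type_dilate:
  assumes phi: "orlicz_type M \<phi> pm pp c" and l: "0 < l"
  shows "orlicz_type M (\<lambda>x t. \<phi> x (t / l)) pm pp c"
  unfolding orlicz_type_def
proof (intro conjI ballI allI impI)
  fix x assume x: "x \<in> space M"
  have phix: "mono_on {0..} (\<phi> x)" "\<phi> x 0 = 0" "filterlim (\<phi> x) at_top at_top"
    using phi x by (auto simp: orlicz_type_def)
  show "mono_on {0..} (\<lambda>t. \<phi> x (t / l))"
    using l by (intro mono_onI mono_onD[OF phix(1)]) (auto simp: divide_right_mono)
  show "\<phi> x (0 / l) = 0" using phix by simp
  have "filterlim (\<lambda>t. t / l) at_top at_top"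
    unfolding divide_inverse using l
    by (intro filterlim_at_top_mult_tendsto_pos[OF tendsto_const _ filterlim_ident]) auto
  then show "filterlim (\<lambda>t. \<phi> x (t / l)) at_top at_top"
    by (rule filterlim_compose[OF phix(3)])
  show "\<phi> x (s * t / l) \<le> c * s powr pm * \<phi> x (t / l)" if "0 \<le> t" "0 < s \<and> s < 1" for s t
    using phi x l that by (auto simp: orlicz_type_def simp flip: times_divide_eq_right)
  show "\<phi> x (s * t / l) \<le> c * s powr pp * \<phi> x (t / l)" if "0 \<le> t" "1 \<le> s" for s t
    using phi x l that by (auto simp: orlicz_type_def simp flip: times_divide_eq_right)
qed (use phi l in \<open>auto simp: orlicz_type_def\<close>)

lemma phi_ext_mono:
  assumes "mono_on {0..} (\<phi> x)" "a \<le> b"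
  shows "phi_ext \<phi> x a \<le> phi_ext \<phi> x b"
  using assms(2) by (cases a; cases b) (auto simp: phi_ext_def top_unique intro!: ennreal_leI mono_onD[OF assms(1)])

text \<open>Trades a modular constant for a norm constant: enlarging the Luxemburg parameter by
  \<open>s\<close> gains \<open>s powr (- pm)\<close> through the lower type.\<close>

lemma phi_ext_contract:
  assumes phi: "orlicz_type M \<phi> pm pp c" and x: "x \<in> space M" and c: "0 < c" and s: "1 < s" and l: "0 < l"
  shows "phi_ext \<phi> x (g / ennreal (s * l)) \<le> ennreal (c * s powr (- pm)) * phi_ext \<phi> x (g / ennreal l)"
proof (cases g)
  case (real y)
  have "\<phi> x (1 / s * (y / l)) \<le> c * (1 / s) powr pm * \<phi> x (y / l)"
  proof -
    have "\<And>t u. 0 \<le> t \<Longrightarrow> 0 < u \<Longrightarrow> u < 1 \<Longrightarrow> \<phi> x (u * t) \<le> c * u powr pm * \<phi> x t"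
      using phi x by (auto simp: orlicz_type_def)
    from this[of "y / l" "1 / s"] show ?thesis using s l real by simp
  qed
  then have "\<phi> x (y / (s * l)) \<le> c * s powr (- pm) * \<phi> x (y / l)"
    using s by (simp add: powr_divide powr_minus inverse_eq_divide)
  then have "ennreal (\<phi> x (y / (s * l))) \<le> ennreal (c * s powr (- pm)) * ennreal (\<phi> x (y / l))"
    using c by (subst ennreal_mult'[symmetric]) (auto intro: ennreal_leI)
  then show ?thesis using real s l by (simp add: phi_ext_def divide_ennreal)
next
  case top
  then show ?thesis using c s l by (simp add: phi_ext_def ennreal_top_divide ennreal_mult_top)
qed

context filtered_prob_space
begin

text \<open>The conditional triangle inequality with a possibly infinite right-hand side, so that
  arbitrary measurable \<open>f\<close> are covered and the rest concerns nonnegative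
  functions.\<close>

lemma doob_max_le_Mx:
  assumes [measurable]: "f \<in> borel_measurable M"
  shows "AE x in M. doob_max M F f x \<le> Mx (\<lambda>x. ennreal \<bar>f x\<bar>) x"
proof -
  have "AE x in M. \<forall>n. ennreal \<bar>real_cond_exp M (F n) f x\<bar> \<le> E n (\<lambda>x. ennreal \<bar>f x\<bar>) x"
    unfolding AE_all_countable using sigma_finite_subalgebra.real_cond_exp_abs[OF sigma_finite_F assms] by simp
  then show ?thesis
  proof eventually_elim
    case (elim x)
    show ?case unfolding doob_max_def
    proof (rule SUP_least)
      fix n
      show "ennreal \<bar>real_cond_exp M (F n) f x\<bar> \<le> Mx (\<lambda>x. ennreal \<bar>f x\<bar>) x"
        using elim E_le_Mx[of n "\<lambda>x. ennreal \<bar>f x\<bar>" x] by (meson order_trans)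
    qed
  qed
qed

lemma vector_maximal_modular:
  assumes phi: "musielak_orlicz M \<phi>" and ot: "orlicz_type M \<phi> pm pp c" and c: "0 < c"
    and q: "1 \<le> q" "A_class M F \<phi> q" "q < pm" and pmpp: "pm \<le> pp" and r: "1 < r"
  obtains C where "0 < C" "\<And>f l. (\<And>j. f j \<in> borel_measurable M) \<Longrightarrow> 0 < l \<Longrightarrow>
    (\<integral>\<^sup>+x. phi_ext \<phi> x (lr_norm r (\<lambda>j. Mx (f j)) x / ennreal l) \<partial>M)
      \<le> ennreal C * (\<integral>\<^sup>+x. phi_ext \<phi> x (lr_norm r f x / ennreal l) \<partial>M)"
proof -
  obtain K where K: "0 < K" "\<And>p t. q < p \<Longrightarrow> 0 < t \<Longrightarrow> Ap p K (\<lambda>x. \<phi> x t)"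
    using A_class_imp_Ap[OF phi q(1,2)] by blast
  \<comment> \<open>The midpoint lies above \<open>q\<close>, where the weights are available, and
    below \<open>pm\<close>, as the dyadic sum demands; \<open>p1\<close> exceeds \<open>pp\<close>
    and hence also \<open>q\<close>.\<close>
  define p0 p1 where "p0 = (q + pm) / 2" and "p1 = pp + 1"
  have p: "q < p0" "p0 < pm" "pp < p1" "q < p1" "1 < p0" "1 < p1"
    using q pmpp by (auto simp: p0_def p1_def)
  obtain A where A: "0 < A" "\<And>w f l. Ap p0 K w \<Longrightarrow> Ap p1 K w \<Longrightarrow> (\<integral>\<^sup>+x. ennreal (w x) \<partial>M) < \<top> \<Longrightarrow>
    (\<And>j. f j \<in> borel_measurable M) \<Longrightarrow> 0 < l \<Longrightarrow>
    (\<integral>\<^sup>+x. indicator {a. ennreal l < a} (lr_norm r (\<lambda>j. Mx (f j)) x) * ennreal (w x) \<partial>M)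
      \<le> ennreal A * (\<integral>\<^sup>+x. kern p0 p1 (lr_norm r f x / ennreal l) * ennreal (w x) \<partial>M)"
    using vector_maximal_level[OF p(5,6) r K(1)] by blast
  obtain C where C: "0 < C" "\<And>(M::'a measure) \<phi> G H. orlicz_type M \<phi> pm pp c \<Longrightarrow>
    G \<in> borel_measurable M \<Longrightarrow> H \<in> borel_measurable M \<Longrightarrow>
    (\<And>l. 0 < l \<Longrightarrow> (\<integral>\<^sup>+x. indicator {a. ennreal l < a} (G x) * ennreal (\<phi> x (2 * l)) \<partial>M)
       \<le> ennreal A * (\<integral>\<^sup>+x. kern p0 p1 (H x / ennreal l) * ennreal (\<phi> x (2 * l)) \<partial>M)) \<Longrightarrow>
    (\<integral>\<^sup>+x. phi_ext \<phi> x (G x) \<partial>M) \<le> ennreal C * (\<integral>\<^sup>+x. phi_ext \<phi> x (H x) \<partial>M)"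
    using musielak_orlicz_interpolation[OF p(2,3) c A(1)] by blast
  have fin: "(\<integral>\<^sup>+x. ennreal (\<phi> x t) \<partial>M) < \<top>" if "0 < t" for t
  proof -
    have int: "integrable M (\<lambda>x. \<phi> x t)" and nn: "\<And>x. x \<in> space M \<Longrightarrow> 0 \<le> \<phi> x t"
      using phi that by (auto simp: musielak_orlicz_def less_imp_le)
    show ?thesis
      using int nn by (simp add: integrable_iff_bounded cong: nn_integral_cong)
  qed
  have "(\<integral>\<^sup>+x. phi_ext (\<lambda>x t. \<phi> x (t / l)) x (lr_norm r (\<lambda>j. Mx (f j)) x) \<partial>M)
      \<le> ennreal C * (\<integral>\<^sup>+x. phi_ext (\<lambda>x t. \<phi> x (t / l)) x (lr_norm r f x) \<partial>M)"
    if [measurable]: "\<And>j. f j \<in> borel_measurable M" and l: "0 < l" for f l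
  proof (rule C(2)[OF orlicz_type_dilate[OF ot l]])
    fix k :: real assume k: "0 < k"
    show "(\<integral>\<^sup>+x. indicator {a. ennreal k < a} (lr_norm r (\<lambda>j. Mx (f j)) x) * ennreal (\<phi> x (2 * k / l)) \<partial>M)
       \<le> ennreal A * (\<integral>\<^sup>+x. kern p0 p1 (lr_norm r f x / ennreal k) * ennreal (\<phi> x (2 * k / l)) \<partial>M)"
      using l k p by (intro A(2) K(2) fin) auto
  qed measurable
  then show ?thesis using that[OF C(1)] by (simp add: phi_ext_divide)
qed

end

theorem theorem3p12:
  fixes M :: "'a measure" and F :: "nat \<Rightarrow> 'a measure"
    and \<phi> :: "'a \<Rightarrow> real \<Rightarrow> real" and pminus pplus :: real
  assumes "prob_space M"
    and "filtration_of M F"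
    and "musielak_orlicz M \<phi>"
    and "A_infty M F \<phi>"
    and "unif_lower_type M \<phi> pminus"
    and "unif_upper_type M \<phi> pplus"
    and "critical_index M F \<phi> < pminus"
    and "pminus \<le> pplus"
  shows "\<forall>r>1. \<exists>C>0. \<forall>f :: nat \<Rightarrow> 'a \<Rightarrow> real. (\<forall>j. f j \<in> borel_measurable M) \<longrightarrow>
           lux_norm M \<phi> (\<lambda>x. ennpow (\<Sum>j. ennpow (doob_max M F (f j) x) r) (1 / r))
           \<le> ennreal C * lux_norm M \<phi> (\<lambda>x. ennpow (\<Sum>j. ennreal (\<bar>f j x\<bar> powr r)) (1 / r))"
proof (intro allI impI)
  fix r :: real assume r: "1 < r"
  interpret prob_space M by fact
  interpret filtered_prob_space M F by unfold_locales fact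
  note phi = assms(3)
  \<comment> \<open>The infimum need not be attained, but lying below \<open>pminus\<close> it
    leaves an admissible \<open>q\<close> below \<open>pminus\<close>.\<close>
  obtain q where q: "1 \<le> q" "A_class M F \<phi> q" "q < pminus"
  proof -
    have "{q. 1 \<le> q \<and> A_class M F \<phi> q} \<noteq> {}" using assms(4) by (auto simp: A_infty_def)
    moreover have "bdd_below {q. 1 \<le> q \<and> A_class M F \<phi> q}" by (rule bdd_belowI[of _ 1]) auto
    ultimately have "\<exists>q\<in>{q. 1 \<le> q \<and> A_class M F \<phi> q}. q < pminus"
      using assms(7) by (simp add: critical_index_def cInf_less_iff)
    then show ?thesis using that by auto
  qed
  have nonneg: "0 \<le> \<phi> x t" if "x \<in> space M" "0 \<le> t" for x t
    using phi that by (auto simp: musielak_orlicz_def)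
  obtain c1 where c1: "0 < c1" "\<And>x t s. x \<in> space M \<Longrightarrow> 0 \<le> t \<Longrightarrow> 0 < s \<Longrightarrow> s < 1 \<Longrightarrow> \<phi> x (s * t) \<le> c1 * s powr pminus * \<phi> x t"
    using assms(5) by (auto simp: unif_lower_type_def)
  obtain c2 where c2: "0 < c2" "\<And>x t s. x \<in> space M \<Longrightarrow> 0 \<le> t \<Longrightarrow> 1 \<le> s \<Longrightarrow> \<phi> x (s * t) \<le> c2 * s powr pplus * \<phi> x t"
    using assms(6) by (auto simp: unif_upper_type_def)
  define c where "c = max c1 c2"
  have c: "0 < c" using c1 by (auto simp: c_def)
  have ot: "orlicz_type M \<phi> pminus pplus c"
    unfolding orlicz_type_def
  proof (intro conjI ballI allI impI)
    fix x assume x: "x \<in> space M"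
    show "\<phi> x (s * t) \<le> c * s powr pminus * \<phi> x t" if "0 \<le> t" "0 < s \<and> s < 1" for s t
    proof -
      have "c1 * s powr pminus * \<phi> x t \<le> c * s powr pminus * \<phi> x t"
        using nonneg[OF x that(1)] by (intro mult_right_mono) (auto simp: c_def)
      then show ?thesis using c1(2)[of x t s] x that by (meson order_trans)
    qed
    show "\<phi> x (s * t) \<le> c * s powr pplus * \<phi> x t" if "0 \<le> t" "1 \<le> s" for s t
    proof -
      have "c2 * s powr pplus * \<phi> x t \<le> c * s powr pplus * \<phi> x t"
        using nonneg[OF x that(1)] by (intro mult_right_mono) (auto simp: c_def)
      then show ?thesis using c2(2)[of x t s] x that by (meson order_trans)
    qed
  qed (use phi in \<open>auto simp: musielak_orlicz_def\<close>)
  obtain C where C: "0 < C" "\<And>f l. (\<And>j. f j \<in> borel_measurable M) \<Longrightarrow> 0 < l \<Longrightarrow>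
    (\<integral>\<^sup>+x. phi_ext \<phi> x (lr_norm r (\<lambda>j. Mx (f j)) x / ennreal l) \<partial>M)
      \<le> ennreal C * (\<integral>\<^sup>+x. phi_ext \<phi> x (lr_norm r f x / ennreal l) \<partial>M)"
    using vector_maximal_modular[OF phi ot c q assms(8) r] by blast
  have pm: "0 < pminus" using q by simp
  \<comment> \<open>Solves \<open>s powr pminus = c * C + 2\<close>, so that enlarging the Luxemburg
    parameter by \<open>s\<close> absorbs the modular constant \<open>c * C\<close>; the summand 2
    keeps \<open>s\<close> above 1, as \<open>phi_ext_contract\<close> requires. This
    \<open>s\<close> is the constant of the theorem.\<close>
  define s where "s = (c * C + 2) powr (1 / pminus)"
  have cC: "0 < c * C" using c C by simp
  have s1: "1 < s" unfolding s_def using cC pm by (simp add: gr_one_powr)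
  have "s powr (- pminus) = 1 / (c * C + 2)"
    unfolding s_def powr_powr using pm cC by (simp add: powr_minus inverse_eq_divide)
  then have s2: "c * s powr (- pminus) * C \<le> 1" using cC by (simp add: mult_ac)
  show "\<exists>C>0. \<forall>f :: nat \<Rightarrow> 'a \<Rightarrow> real. (\<forall>j. f j \<in> borel_measurable M) \<longrightarrow>
           lux_norm M \<phi> (\<lambda>x. ennpow (\<Sum>j. ennpow (doob_max M F (f j) x) r) (1 / r))
           \<le> ennreal C * lux_norm M \<phi> (\<lambda>x. ennpow (\<Sum>j. ennreal (\<bar>f j x\<bar> powr r)) (1 / r))"
  proof (intro exI[of _ s] conjI allI impI)
    show "0 < s" using s1 by simp
    fix f :: "nat \<Rightarrow> 'a \<Rightarrow> real" assume "\<forall>j. f j \<in> borel_measurable M"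
    then have [measurable]: "f j \<in> borel_measurable M" for j by blast
    let ?g = "\<lambda>j x. ennreal \<bar>f j x\<bar>"
    let ?D = "lr_norm r (\<lambda>j. doob_max M F (f j))"
    have L: "(\<lambda>x. ennpow (\<Sum>j. ennreal (\<bar>f j x\<bar> powr r)) (1 / r)) = lr_norm r ?g"
      by (simp add: lr_norm_def ennpow_ennreal fun_eq_iff)
    have DG: "AE x in M. ?D x \<le> lr_norm r (\<lambda>j. Mx (?g j)) x"
    proof -
      have "AE x in M. \<forall>j. doob_max M F (f j) x \<le> Mx (?g j) x"
        unfolding AE_all_countable by (intro allI doob_max_le_Mx) auto
      then show ?thesis by eventually_elim (use r in \<open>auto intro!: lr_mono\<close>)
    qed
    have key: "(\<integral>\<^sup>+x. phi_ext \<phi> x (?D x / ennreal (s * l)) \<partial>M) \<le> 1"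
      if l: "0 < l" and le: "(\<integral>\<^sup>+x. phi_ext \<phi> x (lr_norm r ?g x / ennreal l) \<partial>M) \<le> 1" for l
    proof -
      let ?c = "c * s powr (- pminus)"
      have c0: "0 < ?c" using c s1 by simp
      have "(\<integral>\<^sup>+x. phi_ext \<phi> x (?D x / ennreal (s * l)) \<partial>M)
        \<le> (\<integral>\<^sup>+x. ennreal ?c * phi_ext \<phi> x (lr_norm r (\<lambda>j. Mx (?g j)) x / ennreal l) \<partial>M)"
      proof (rule nn_integral_mono_AE)
        show "AE x in M. phi_ext \<phi> x (?D x / ennreal (s * l))
            \<le> ennreal ?c * phi_ext \<phi> x (lr_norm r (\<lambda>j. Mx (?g j)) x / ennreal l)"
          using DG AE_space
        proof eventually_elim
          case (elim x)
          have "phi_ext \<phi> x (?D x / ennreal (s * l)) \<le> phi_ext \<phi> x (lr_norm r (\<lambda>j. Mx (?g j)) x / ennreal (s * l))"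
            using phi elim by (intro phi_ext_mono divide_right_mono_ennreal) (auto simp: musielak_orlicz_def)
          also have "\<dots> \<le> ennreal ?c * phi_ext \<phi> x (lr_norm r (\<lambda>j. Mx (?g j)) x / ennreal l)"
            by (rule phi_ext_contract[OF ot elim(2) c s1 l])
          finally show ?case .
        qed
      qed
      also have "\<dots> \<le> ennreal ?c * (\<integral>\<^sup>+x. phi_ext \<phi> x (lr_norm r (\<lambda>j. Mx (?g j)) x / ennreal l) \<partial>M)"
        by (rule nn_integral_cmult_le[OF c0])
      also have "\<dots> \<le> ennreal ?c * (ennreal C * (\<integral>\<^sup>+x. phi_ext \<phi> x (lr_norm r ?g x / ennreal l) \<partial>M))"
        using l by (intro mult_left_mono C(2)) auto
      also have "\<dots> \<le> ennreal ?c * (ennreal C * 1)" by (intro mult_left_mono le) auto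
      also have "\<dots> = ennreal (?c * C)" using c0 C(1) by (simp add: ennreal_mult)
      also have "\<dots> \<le> 1" using s2 by simp
      finally show ?thesis .
    qed
    \<comment> \<open>If no parameter is admissible on the right, the infimum is over the empty set
      and equals \<top>, so infinite norms are covered by the same argument.\<close>
    have "lux_norm M \<phi> ?D / ennreal s \<le> lux_norm M \<phi> (lr_norm r ?g)"
      unfolding lux_norm_def[of _ _ "lr_norm r ?g"]
    proof (rule Inf_greatest, clarify)
      fix l :: real assume l: "0 < l" and le: "(\<integral>\<^sup>+x. phi_ext \<phi> x (lr_norm r ?g x / ennreal l) \<partial>M) \<le> 1"
      have "lux_norm M \<phi> ?D \<le> ennreal (s * l)"
        unfolding lux_norm_def using key[OF l le] l s1 by (intro Inf_lower imageI) auto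
      then show "lux_norm M \<phi> ?D / ennreal s \<le> ennreal l"
        using s1 l by (intro divide_le_posI_ennreal) (auto simp: ennreal_mult mult.commute)
    qed
    then have "ennreal s * (lux_norm M \<phi> ?D / ennreal s) \<le> ennreal s * lux_norm M \<phi> (lr_norm r ?g)"
      by (rule mult_left_mono) simp
    also have "ennreal s * (lux_norm M \<phi> ?D / ennreal s) = lux_norm M \<phi> ?D"
      using s1 mult_divide_eq_ennreal[of "ennreal s" "lux_norm M \<phi> ?D"]
      by (simp add: ennreal_times_divide mult.commute)
    finally show "lux_norm M \<phi> (\<lambda>x. ennpow (\<Sum>j. ennpow (doob_max M F (f j) x) r) (1 / r))
       \<le> ennreal s * lux_norm M \<phi> (\<lambda>x. ennpow (\<Sum>j. ennreal (\<bar>f j x\<bar> powr r)) (1 / r))"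
      unfolding L by (simp add: lr_norm_def[abs_def])
  qed
qed

end
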